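(* Let $V\subset\mathbb F_q^d$ ($d\ge 2$) be a regular variety, let $k\ge 3$ be an integer and let $E\subset V$. There is a sufficiently large constant $C>0$ (depending only on $d$, $k$ and the regularity constants of $V$, not on $q$) such that if $|E|\ge C q^{\frac{d-1}{2}+\frac{1}{k-1}}$, then $\Delta_k(E)\supset\mathbb F_q^*$ when $d\ge 2$ is even, and $\Delta_k(E)=\mathbb F_q$ when $d\ge 3$ is odd.
   Context: $\mathbb F_q$ is a finite field with $q$ elements, $q$ odd, and $\mathbb F_q^*=\mathbb F_q\setminus\{0\}$. For $\alpha\in\mathbb F_q^d$, $\|\alpha\|=\alpha_1^2+\cdots+\alpha_d^2$. For $E\subset\mathbb F_q^d$ and integer $k\ge2$, $\Delta_k(E)=\{\|x^1-x^2-\cdots-x^k\|: x^j\in E\}$. Fix a nontrivial additive character $\chi$ of $\mathbb F_q$; for $f:\mathbb F_q^d\to\mathbb C$ let $\widehat f(m)=q^{-d}\sum_{x\in\mathbb F_q^d}\chi(-m\cdot x)f(x)$, and identify a set with its characteristic function. A variety $V=\{x\in\mathbb F_q^d: Q(x)=0\}$, $Q\in\mathbb F_q[x_1,\dots,x_d]$, is a regular variety if $|V|\approx q^{d-1}$ and $|\widehat V(m)|\lesssim q^{-(d+1)/2}$ for all $m\ne(0,\dots,0)$, where the implied constants (the regularity constants) are independent of $q$. *)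

theory Defs
  imports
    Complex_Main
    "HOL-Library.Indicator_Function"
    "HOL-Algebra.Indexed_Polynomials"
begin

text \<open>
  Constants that must not depend on \<open>q\<close> have to be quantified before the field.  Types cannot be
  quantified inside a formula, so fields are HOL-Algebra structures of type \<open>'a ring\<close>, not instances
  of the class of fields.  Every finite field has an isomorphic copy of type \<open>'a ring\<close> as soon as
  \<open>'a\<close> is infinite (e.g. \<open>nat\<close>).  Vectors are indexed by \<open>{..<d}\<close>, and extensional.
\<close>

definition vec_space :: "('a, 'b) ring_scheme \<Rightarrow> nat \<Rightarrow> (nat \<Rightarrow> 'a) set" where
  "vec_space F d = ({..<d} \<rightarrow>\<^sub>E carrier F)"

definition zero_vec :: "('a, 'b) ring_scheme \<Rightarrow> nat \<Rightarrow> nat \<Rightarrow> 'a" where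
  "zero_vec F d = (\<lambda>i\<in>{..<d}. \<zero>\<^bsub>F\<^esub>)"

definition dot_prod :: "('a, 'b) ring_scheme \<Rightarrow> nat \<Rightarrow> (nat \<Rightarrow> 'a) \<Rightarrow> (nat \<Rightarrow> 'a) \<Rightarrow> 'a" where
  "dot_prod F d x y = (\<Oplus>\<^bsub>F\<^esub>i\<in>{..<d}. x i \<otimes>\<^bsub>F\<^esub> y i)"

definition sq_norm :: "('a, 'b) ring_scheme \<Rightarrow> nat \<Rightarrow> (nat \<Rightarrow> 'a) \<Rightarrow> 'a" where
  "sq_norm F d x = (\<Oplus>\<^bsub>F\<^esub>i\<in>{..<d}. x i [^]\<^bsub>F\<^esub> (2::nat))"

definition dist_set ::
    "('a, 'b) ring_scheme \<Rightarrow> nat \<Rightarrow> nat \<Rightarrow> (nat \<Rightarrow> 'a) set \<Rightarrow> 'a set" where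
  "dist_set F d k E =
     {sq_norm F d (\<lambda>i\<in>{..<d}. x 1 i \<ominus>\<^bsub>F\<^esub> (\<Oplus>\<^bsub>F\<^esub>j\<in>{2..k}. x j i)) | x. \<forall>j\<in>{1..k}. x j \<in> E}"

definition nontrivial_additive_character ::
    "('a, 'b) ring_scheme \<Rightarrow> ('a \<Rightarrow> complex) \<Rightarrow> bool" where
  "nontrivial_additive_character F \<chi> \<longleftrightarrow>
     (\<forall>x\<in>carrier F. cmod (\<chi> x) = 1) \<and>
     (\<forall>x\<in>carrier F. \<forall>y\<in>carrier F. \<chi> (x \<oplus>\<^bsub>F\<^esub> y) = \<chi> x * \<chi> y) \<and>
     (\<exists>x\<in>carrier F. \<chi> x \<noteq> 1)"

definition fourier ::
    "('a, 'b) ring_scheme \<Rightarrow> nat \<Rightarrow> ('a \<Rightarrow> complex) \<Rightarrow> ((nat \<Rightarrow> 'a) \<Rightarrow> complex) \<Rightarrow> (nat \<Rightarrow> 'a) \<Rightarrow> complex"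
  where
  "fourier F d \<chi> f m =
     (1 / of_nat (order F) ^ d) * (\<Sum>x\<in>vec_space F d. \<chi> (\<ominus>\<^bsub>F\<^esub> dot_prod F d m x) * f x)"

text \<open>
  Elements of \<open>indexed_pset\<close> map monomials (multisets of variables) to coefficients, with finite
  support.  The library's \<open>indexed_eval\<close> substitutes a variable into a list of coefficients; it is
  not evaluation at a point.
\<close>

definition poly_value ::
    "('a, 'b) ring_scheme \<Rightarrow> (nat multiset \<Rightarrow> 'a) \<Rightarrow> (nat \<Rightarrow> 'a) \<Rightarrow> 'a" where
  "poly_value F Q x =
     (\<Oplus>\<^bsub>F\<^esub>m\<in>{m. Q m \<noteq> \<zero>\<^bsub>F\<^esub>}. Q m \<otimes>\<^bsub>F\<^esub> (\<Otimes>\<^bsub>F\<^esub>i\<in>set_mset m. x i [^]\<^bsub>F\<^esub> count m i))"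

definition is_variety :: "('a, 'b) ring_scheme \<Rightarrow> nat \<Rightarrow> (nat \<Rightarrow> 'a) set \<Rightarrow> bool" where
  "is_variety F d V \<longleftrightarrow>
     (\<exists>Q\<in>ring.indexed_pset F {..<d} (carrier F). V = {x \<in> vec_space F d. poly_value F Q x = \<zero>\<^bsub>F\<^esub>})"

text \<open>
  The regularity constants are explicit parameters: \<open>a\<close> and \<open>b\<close> are the lower and upper constants in
  \<open>|V| \<approx> q^(d-1)\<close>, and \<open>c\<close> is the constant in the Fourier decay.
\<close>

definition regular_variety ::
    "('a, 'b) ring_scheme \<Rightarrow> nat \<Rightarrow> ('a \<Rightarrow> complex) \<Rightarrow> real \<Rightarrow> real \<Rightarrow> real \<Rightarrow> (nat \<Rightarrow> 'a) set \<Rightarrow> bool"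
  where
  "regular_variety F d \<chi> a b c V \<longleftrightarrow>
     is_variety F d V \<and>
     a * real (order F) ^ (d - 1) \<le> real (card V) \<and>
     real (card V) \<le> b * real (order F) ^ (d - 1) \<and>
     (\<forall>m\<in>vec_space F d - {zero_vec F d}.
        cmod (fourier F d \<chi> (indicator V) m) \<le> c * real (order F) powr (- (real d + 1) / 2))"

end

theory Submission
  imports Defs "HOL-Algebra.Multiplicative_Group"
begin

text \<open>
  Write \<open>q\<close> for the order of the field, \<open>N = |E|\<close>, \<open>P = q^((d-1)/2)\<close> and \<open>e(w)\<close> for the exponential
  sum over \<open>E\<close>. If \<open>t\<close> is missed by \<open>\<Delta>\<^sub>k(E)\<close>, Fourier inversion on the sphere of radius \<open>t\<close> gives
  \<open>(P\<^sup>2 - 2 P) N^k \<le> 2 P B\<^sub>k\<close>, where \<open>B\<^sub>k\<close> is the sum of \<open>|e(w)|^k\<close> over \<open>w \<noteq> 0\<close>. In even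
  moments one factor \<open>e\<close> may be replaced by the exponential sum over \<open>V\<close>, as the remaining
  product is the transform of a nonnegative function; with the Fourier decay of \<open>V\<close> and
  AM-GM this yields \<open>B\<^bsub>2j+2\<^esub> \<le> 2 |V| N^(2j+1) + (c P)\<^sup>2 B\<^bsub>2j\<^esub>\<close>. Iterating down to \<open>B\<^sub>2 \<le> q^d N\<close>
  contradicts the lower bound for \<open>B\<^sub>k\<close> as soon as \<open>N\<close> is above the threshold.

  The Fourier transform of the sphere is a Salie sum for odd \<open>d\<close> and a Kloosterman sum for even
  \<open>d\<close>; the latter needs Weil's bound \<open>|K| \<le> 2 \<surd>q\<close>. Over the quadratic extension the Kloosterman
  sum becomes \<open>2 q - K\<^sup>2\<close>. If \<open>|K| > 2 \<surd>q\<close>, then in the tower of quadratic extensions the ratio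
  \<open>|K| / \<surd>q\<close> would be unbounded, whereas Stepanov's method bounds it in terms of the order of the
  base field.
\<close>

section \<open>Finite fields, squares and additive characters\<close>

text \<open>With s = N / P the iteration bounds B_k by a constant times P N^k (1/s + q / s^(k-1)).
  The last term is what remains of B_2, and it is small as soon as s is a large multiple of
  q^(1/(k-1)): this is the origin of the exponent. The iteration has step 2 and reaches even moments
  only, so an odd k is interpolated between k - 1 and k + 1. Radius 0 is excluded for even d because
  the Kloosterman sum with both coefficients 0, which then occurs, has no cancellation.

  For Weil's bound no L-function is introduced. Of the pattern K = -(\<alpha> + \<beta>), \<alpha>
  \<beta> = q, K_2 = -(\<alpha>^2 + \<beta>^2) only the passage to the quadratic extension is
  proved, by counting. On normalised sums it dominates x -> x^2 - 2, which drives every x > 2 to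
  infinity; hence any bound that is uniform along the tower is enough, even one as crude as 4 q + 1.
  All fields of the tower must share one type for the induction; they are copied into
  \<open>nat ring\<close>.\<close>

locale finite_field = field R for R (structure) +
  assumes finite_carrier [simp, intro]: "finite (carrier R)"
begin

lemma order_pos: "0 < order R"
  using order_gt_0_iff_finite by blast

lemma inv_closed' [simp]: "x \<in> carrier R \<Longrightarrow> x \<noteq> \<zero> \<Longrightarrow> inv x \<in> carrier R"
  by (simp add: field_Units)

lemma r_inv' [simp]: "x \<in> carrier R \<Longrightarrow> x \<noteq> \<zero> \<Longrightarrow> x \<otimes> inv x = \<one>"
  by (simp add: field_Units)

lemma l_inv' [simp]: "x \<in> carrier R \<Longrightarrow> x \<noteq> \<zero> \<Longrightarrow> inv x \<otimes> x = \<one>"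
  by (simp add: field_Units)

lemma inv_nonzero [simp]: "x \<in> carrier R \<Longrightarrow> x \<noteq> \<zero> \<Longrightarrow> inv x \<noteq> \<zero>"
  using r_inv'[of x] by (metis r_null zero_not_one)

lemma inv_eqI: "x \<in> carrier R \<Longrightarrow> y \<in> carrier R \<Longrightarrow> x \<otimes> y = \<one> \<Longrightarrow> inv x = y"
  by (rule comm_inv_char)

lemma inv_inv [simp]: "x \<in> carrier R \<Longrightarrow> x \<noteq> \<zero> \<Longrightarrow> inv (inv x) = x"
  by (intro inv_eqI) auto

lemma mult_eq_zero_iff [simp]:
  "x \<in> carrier R \<Longrightarrow> y \<in> carrier R \<Longrightarrow> x \<otimes> y = \<zero> \<longleftrightarrow> x = \<zero> \<or> y = \<zero>"
  using integral by auto

lemma bij_mult: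
  assumes "a \<in> carrier R" "a \<noteq> \<zero>"
  shows "bij_betw (\<lambda>x. a \<otimes> x) (carrier R) (carrier R)"
  by (rule bij_betw_byWitness[where f' = "\<lambda>x. inv a \<otimes> x"])
     (use assms in \<open>auto simp: m_assoc[symmetric]\<close>)

lemma bij_add:
  assumes "a \<in> carrier R"
  shows "bij_betw (\<lambda>x. x \<oplus> a) (carrier R) (carrier R)"
  by (rule bij_betw_byWitness[where f' = "\<lambda>x. x \<ominus> a"])
     (use assms in \<open>auto simp: a_assoc minus_eq l_neg r_neg\<close>)

lemma bij_mult_nonzero:
  assumes "a \<in> carrier R" "a \<noteq> \<zero>"
  shows "bij_betw (\<lambda>x. a \<otimes> x) (carrier R - {\<zero>}) (carrier R - {\<zero>})"
  by (rule bij_betw_byWitness[where f' = "\<lambda>x. inv a \<otimes> x"])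
     (use assms in \<open>auto simp: m_assoc[symmetric]\<close>)

lemma bij_inv: "bij_betw (\<lambda>x. inv x) (carrier R - {\<zero>}) (carrier R - {\<zero>})"
  by (rule bij_betw_byWitness[where f' = "\<lambda>x. inv x"]) auto

lemma inv_mult_distrib:
  assumes "x \<in> carrier R" "x \<noteq> \<zero>" "y \<in> carrier R" "y \<noteq> \<zero>"
  shows "inv (x \<otimes> y) = inv x \<otimes> inv y"
proof (rule inv_eqI)
  have "x \<otimes> y \<otimes> (inv x \<otimes> inv y) = (x \<otimes> inv x) \<otimes> (y \<otimes> inv y)"
    using assms inv_closed'[of x] inv_closed'[of y] by algebra
  then show "x \<otimes> y \<otimes> (inv x \<otimes> inv y) = \<one>" using assms by simp
qed (use assms in auto)

text \<open>For \<open>x\<close> in the field, \<open>nsqrt x - 1\<close> is the quadratic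
  character. Counting roots makes it available before any multiplicativity is known.\<close>

definition nsqrt :: "'a \<Rightarrow> nat" where
  "nsqrt x = card {y \<in> carrier R. y \<otimes> y = x}"

lemma square_eq_iff:
  assumes "x \<in> carrier R" "y \<in> carrier R"
  shows "x \<otimes> x = y \<otimes> y \<longleftrightarrow> x = y \<or> x = \<ominus> y"
proof -
  have "(x \<ominus> y) \<otimes> (x \<oplus> y) = x \<otimes> x \<ominus> y \<otimes> y" using assms by algebra
  moreover have "x \<otimes> x = y \<otimes> y \<longleftrightarrow> x \<otimes> x \<ominus> y \<otimes> y = \<zero>"
    using assms by simp
  moreover have "x \<oplus> y = \<zero> \<longleftrightarrow> x = \<ominus> y"
    using assms by (metis a_comm minus_equality r_neg)
  ultimately show ?thesis using assms
    by (metis a_closed integral_iff minus_closed r_right_minus_eq)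
qed

lemma nsqrt_zero: "nsqrt \<zero> = 1"
proof -
  have "{y \<in> carrier R. y \<otimes> y = \<zero>} = {\<zero>}" by auto
  then show ?thesis by (simp add: nsqrt_def)
qed

lemma nsqrt_le: "nsqrt x \<le> 2"
proof (cases "\<exists>y\<in>carrier R. y \<otimes> y = x")
  case True
  then obtain y where y: "y \<in> carrier R" "y \<otimes> y = x" by auto
  then have "{z \<in> carrier R. z \<otimes> z = x} \<subseteq> {y, \<ominus> y}" using square_eq_iff by auto
  then have "nsqrt x \<le> card {y, \<ominus> y}" unfolding nsqrt_def by (intro card_mono) auto
  also have "\<dots> \<le> 2" by (simp add: card_insert_if)
  finally show ?thesis .
next
  case False
  then have "{z \<in> carrier R. z \<otimes> z = x} = {}" by blast
  then show ?thesis unfolding nsqrt_def by (metis card.empty le0)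
qed

lemma sum_nsqrt:
  fixes g :: "'a \<Rightarrow> complex"
  shows "(\<Sum>y\<in>carrier R. g (y \<otimes> y)) = (\<Sum>x\<in>carrier R. of_nat (nsqrt x) * g x)"
proof -
  have "(\<Sum>y\<in>carrier R. g (y \<otimes> y)) = (\<Sum>x\<in>carrier R. \<Sum>y | y \<in> carrier R \<and> y \<otimes> y = x. g (y \<otimes> y))"
    by (rule sum.group[symmetric]) auto
  also have "\<dots> = (\<Sum>x\<in>carrier R. \<Sum>y | y \<in> carrier R \<and> y \<otimes> y = x. g x)"
    by (intro sum.cong) auto
  finally show ?thesis by (simp add: nsqrt_def)
qed

lemma nsqrt_pos_iff: "0 < nsqrt x \<longleftrightarrow> (\<exists>y\<in>carrier R. y \<otimes> y = x)"
  unfolding nsqrt_def by (auto simp: card_gt_0_iff)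

lemma nsqrt_mult_square:
  assumes "c \<in> carrier R" "c \<noteq> \<zero>" "x \<in> carrier R"
  shows "nsqrt (c \<otimes> c \<otimes> x) = nsqrt x"
proof -
  have "bij_betw (\<lambda>y. c \<otimes> y) {y \<in> carrier R. y \<otimes> y = x} {y \<in> carrier R. y \<otimes> y = c \<otimes> c \<otimes> x}"
  proof (rule bij_betw_byWitness[where f' = "\<lambda>y. inv c \<otimes> y"])
    show "(\<lambda>y. c \<otimes> y) ` {y \<in> carrier R. y \<otimes> y = x} \<subseteq> {y \<in> carrier R. y \<otimes> y = c \<otimes> c \<otimes> x}"
    proof clarify
      fix y assume y: "y \<in> carrier R"
      then have "c \<otimes> y \<otimes> (c \<otimes> y) = c \<otimes> c \<otimes> (y \<otimes> y)" using assms by algebra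
      then show "c \<otimes> y \<in> carrier R \<and> c \<otimes> y \<otimes> (c \<otimes> y) = c \<otimes> c \<otimes> (y \<otimes> y)" using y assms by auto
    qed
    show "(\<lambda>y. inv c \<otimes> y) ` {y \<in> carrier R. y \<otimes> y = c \<otimes> c \<otimes> x} \<subseteq> {y \<in> carrier R. y \<otimes> y = x}"
    proof clarify
      fix y assume y: "y \<in> carrier R" "y \<otimes> y = c \<otimes> c \<otimes> x"
      have "inv c \<otimes> y \<otimes> (inv c \<otimes> y) = inv c \<otimes> inv c \<otimes> (y \<otimes> y)"
        using assms y(1) inv_closed'[of c] by algebra
      also have "\<dots> = (inv c \<otimes> c) \<otimes> (inv c \<otimes> c) \<otimes> x" unfolding y(2) using assms inv_closed'[of c] by algebra
      finally show "inv c \<otimes> y \<in> carrier R \<and> inv c \<otimes> y \<otimes> (inv c \<otimes> y) = x" using y assms by auto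
    qed
  qed (use assms in \<open>auto simp: m_assoc[symmetric]\<close>)
  then show ?thesis unfolding nsqrt_def by (simp add: bij_betw_same_card)
qed

end

section \<open>Square classes in fields of odd order\<close>

locale odd_finite_field = finite_field +
  assumes odd_order: "odd (order R)"
begin

text \<open>The sum of |R| ones is 0; if 1 + 1 were 0, this sum of an odd number of ones would
  collapse to a single 1.\<close>

lemma two_nonzero: "\<one> \<oplus> \<one> \<noteq> \<zero>"
proof
  assume two: "\<one> \<oplus> \<one> = \<zero>"
  obtain k where k: "order R = Suc (2 * k)" using odd_order oddE by (metis Suc_eq_plus1)
  have z: "add_pow R (2 * j) \<one> = \<zero>" for j :: nat
    by (induction j) (auto simp: two a_assoc)
  have "add_pow R (order R) \<one> = \<zero>"
    using add.pow_order_eq_1[of \<one>] by (simp add: order_def)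
  then show False using k z[of k] by simp
qed

lemma double: "x \<in> carrier R \<Longrightarrow> x \<oplus> x = (\<one> \<oplus> \<one>) \<otimes> x"
  by (simp add: l_distr)

lemma double_zero_iff [simp]: "x \<in> carrier R \<Longrightarrow> x \<oplus> x = \<zero> \<longleftrightarrow> x = \<zero>"
  using double[of x] two_nonzero by simp

lemma minus_eq_self_iff: "x \<in> carrier R \<Longrightarrow> x = \<ominus> x \<longleftrightarrow> x = \<zero>"
  using double_zero_iff[of x] r_neg[of x] by fastforce

definition half :: "'a \<Rightarrow> 'a" where
  "half x = inv (\<one> \<oplus> \<one>) \<otimes> x"

lemma half_closed [simp]: "x \<in> carrier R \<Longrightarrow> half x \<in> carrier R"
  using two_nonzero by (simp add: half_def)

lemma half_double [simp]: "x \<in> carrier R \<Longrightarrow> half x \<oplus> half x = x"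
  using two_nonzero double[of "half x"] by (simp add: half_def m_assoc[symmetric])

lemma half_unique: "x \<in> carrier R \<Longrightarrow> y \<in> carrier R \<Longrightarrow> y \<oplus> y = x \<Longrightarrow> half x = y"
  using two_nonzero double[of y] by (auto simp add: half_def m_assoc[symmetric])

lemma nsqrt_square:
  assumes "x \<in> carrier R" "x \<noteq> \<zero>"
  shows "nsqrt (x \<otimes> x) = 2"
proof -
  have "{y \<in> carrier R. y \<otimes> y = x \<otimes> x} = {x, \<ominus> x}" using assms square_eq_iff by auto
  moreover have "x \<noteq> \<ominus> x" using assms minus_eq_self_iff by blast
  ultimately show ?thesis by (simp add: nsqrt_def)
qed

text \<open>Were every element a square, squaring would be a surjective, hence injective, self-map
  of a finite set; but 1 and -1 are distinct with equal squares.\<close>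

lemma nonsquare_exists: "\<exists>\<delta>\<in>carrier R. nsqrt \<delta> = 0"
proof (rule ccontr)
  assume "\<not> ?thesis"
  then have "carrier R \<subseteq> (\<lambda>y. y \<otimes> y) ` carrier R" using nsqrt_pos_iff by fastforce
  then have "inj_on (\<lambda>y. y \<otimes> y) (carrier R)"
    by (intro eq_card_imp_inj_on) (auto intro!: antisym card_image_le card_mono)
  moreover have "\<one> \<otimes> \<one> = \<ominus> \<one> \<otimes> \<ominus> \<one>" by algebra
  ultimately have "\<one> = \<ominus> \<one>" by (meson a_inv_closed inj_onD one_closed)
  then show False using minus_eq_self_iff[of \<one>] by simp
qed

lemma sum_nsqrt_card: "(\<Sum>x\<in>carrier R. nsqrt x) = order R"
proof -
  have "of_nat (\<Sum>x\<in>carrier R. nsqrt x) = (of_nat (order R) :: complex)"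
    using sum_nsqrt[of "\<lambda>_. 1"] by (simp add: order_def)
  then show ?thesis by (metis of_nat_eq_iff)
qed

text \<open>Both sides sum to \<open>2 |R|\<close> over \<open>x\<close>, and \<open>\<le>\<close> holds termwise.\<close>

lemma nsqrt_nonsquare_mult:
  assumes \<delta>: "\<delta> \<in> carrier R" "nsqrt \<delta> = 0" and x: "x \<in> carrier R"
  shows "nsqrt x + nsqrt (\<delta> \<otimes> x) = 2"
proof -
  have d0: "\<delta> \<noteq> \<zero>" using \<delta> nsqrt_zero by auto
  have le: "nsqrt y + nsqrt (\<delta> \<otimes> y) \<le> 2" if y: "y \<in> carrier R" for y
  proof (cases "y = \<zero>")
    case True
    then show ?thesis using \<delta> by (simp add: nsqrt_zero)
  next
    case False
    show ?thesis
    proof (cases "nsqrt y = 0")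
      case True
      then show ?thesis using nsqrt_le by simp
    next
      case not0: False
      then obtain z where z: "z \<in> carrier R" "z \<otimes> z = y" using nsqrt_pos_iff by auto
      then have "z \<noteq> \<zero>" using False by auto
      \<comment> \<open>A nonzero square times a nonsquare has no root, so the two counts are never
        both positive.\<close>
      then have "nsqrt (z \<otimes> z \<otimes> \<delta>) = 0" using nsqrt_mult_square[OF z(1) _ \<delta>(1)] \<delta> by simp
      moreover have "z \<otimes> z \<otimes> \<delta> = \<delta> \<otimes> y" using z \<delta> m_comm by auto
      ultimately show ?thesis using nsqrt_le[of y] by simp
    qed
  qed
  have "(\<Sum>y\<in>carrier R. nsqrt (\<delta> \<otimes> y)) = (\<Sum>y\<in>carrier R. nsqrt y)"
    using sum.reindex_bij_betw[OF bij_mult[OF \<delta>(1) d0]] by simp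
  then have "(\<Sum>y\<in>carrier R. nsqrt y + nsqrt (\<delta> \<otimes> y)) = (\<Sum>y\<in>carrier R. 2)"
    by (simp add: sum.distrib sum_nsqrt_card order_def)
  then show ?thesis using sum_mono_inv[OF _ le x] by simp
qed

end

section \<open>Orthogonality of additive characters\<close>

locale field_character = finite_field +
  fixes \<chi> :: "'a \<Rightarrow> complex"
  assumes character: "nontrivial_additive_character R \<chi>"
begin

lemma norm_char: "x \<in> carrier R \<Longrightarrow> cmod (\<chi> x) = 1"
  using character unfolding nontrivial_additive_character_def by blast

lemma char_add: "x \<in> carrier R \<Longrightarrow> y \<in> carrier R \<Longrightarrow> \<chi> (x \<oplus> y) = \<chi> x * \<chi> y"
  using character unfolding nontrivial_additive_character_def by blast

lemma char_nonzero: "x \<in> carrier R \<Longrightarrow> \<chi> x \<noteq> 0"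
  using norm_char by force

lemma char_zero [simp]: "\<chi> \<zero> = 1"
  using char_add[of \<zero> \<zero>] char_nonzero[of \<zero>] by simp

lemma char_minus: "x \<in> carrier R \<Longrightarrow> \<chi> (\<ominus> x) = cnj (\<chi> x)"
proof -
  assume x: "x \<in> carrier R"
  have "\<chi> x * \<chi> (\<ominus> x) = 1" using char_add[of x "\<ominus> x"] x by (simp add: r_neg)
  moreover have "\<chi> x * cnj (\<chi> x) = 1" using norm_char[OF x] by (simp add: complex_norm_square[symmetric])
  ultimately show ?thesis using char_nonzero[OF x] by (metis mult_left_cancel)
qed

lemma char_diff: "x \<in> carrier R \<Longrightarrow> y \<in> carrier R \<Longrightarrow> \<chi> (x \<ominus> y) = \<chi> x * cnj (\<chi> y)"
  by (simp add: minus_eq char_add char_minus)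

lemma char_finsum:
  assumes "finite A" "f \<in> A \<rightarrow> carrier R"
  shows "\<chi> (\<Oplus>i\<in>A. f i) = (\<Prod>i\<in>A. \<chi> (f i))"
  using assms by (induction A) (auto simp: char_add Pi_def)

lemma sum_char: "(\<Sum>x\<in>carrier R. \<chi> x) = 0"
proof -
  obtain a where a: "a \<in> carrier R" "\<chi> a \<noteq> 1"
    using character unfolding nontrivial_additive_character_def by blast
  have "(\<Sum>x\<in>carrier R. \<chi> x) = (\<Sum>x\<in>carrier R. \<chi> (x \<oplus> a))"
    using sum.reindex_bij_betw[OF bij_add[OF a(1)], of \<chi>] by simp
  also have "\<dots> = (\<Sum>x\<in>carrier R. \<chi> x) * \<chi> a"
    using a by (simp add: char_add sum_distrib_right)
  finally show ?thesis using a(2) by (metis mult.right_neutral mult_left_cancel)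
qed

lemma sum_char_mult:
  assumes "a \<in> carrier R"
  shows "(\<Sum>x\<in>carrier R. \<chi> (a \<otimes> x)) = (if a = \<zero> then of_nat (order R) else 0)"
  using sum.reindex_bij_betw[OF bij_mult, of a \<chi>] assms sum_char by (auto simp: order_def)

lemma sum_char_mult_nonzero:
  assumes "a \<in> carrier R" "a \<noteq> \<zero>"
  shows "(\<Sum>x\<in>carrier R - {\<zero>}. \<chi> (a \<otimes> x)) = -1"
  using sum_char_mult[OF assms(1)] assms by (simp add: sum.remove[where x = \<zero>] eq_neg_iff_add_eq_0 add.commute)

end

section \<open>Polynomial functions\<close>

context finite_field
begin

definition poly_le :: "nat \<Rightarrow> ('a \<Rightarrow> 'a) \<Rightarrow> bool" where
  "poly_le n g \<longleftrightarrow> (\<exists>p\<in>carrier (UP R). deg R p \<le> n \<and> (\<forall>x\<in>carrier R. g x = UnivPoly.eval R R id x p))"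

text \<open>The representing polynomial is not unique, as x^|R| - x vanishes on the whole field: a
  function may satisfy this for several \<open>n\<close>, and for large \<open>n\<close> it may even
  be the zero function. The root bound stays true and is then trivial.\<close>

definition poly_eq :: "nat \<Rightarrow> ('a \<Rightarrow> 'a) \<Rightarrow> bool" where
  "poly_eq n g \<longleftrightarrow> (\<exists>p\<in>carrier (UP R). p \<noteq> \<zero>\<^bsub>UP R\<^esub> \<and> deg R p = n \<and>
     (\<forall>x\<in>carrier R. g x = UnivPoly.eval R R id x p))"

interpretation UP: UP_domain R "UP R" by unfold_locales simp

lemma poly_le_closed: "poly_le n g \<Longrightarrow> x \<in> carrier R \<Longrightarrow> g x \<in> carrier R"
  unfolding poly_le_def using UP.carrier_evalRR by auto

lemma poly_le_mono: "poly_le n g \<Longrightarrow> n \<le> m \<Longrightarrow> poly_le m g"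
  unfolding poly_le_def using order_trans by blast

lemma poly_le_cong: "poly_le n g \<Longrightarrow> (\<And>x. x \<in> carrier R \<Longrightarrow> h x = g x) \<Longrightarrow> poly_le n h"
  unfolding poly_le_def by simp

lemma poly_le_monom:
  assumes "a \<in> carrier R"
  shows "poly_le n (\<lambda>x. a \<otimes> x [^] n)"
  unfolding poly_le_def
  by (rule bexI[of _ "UnivPoly.monom (UP R) a n"]) (use assms in \<open>auto simp: UP.evalRR_monom UP.deg_monom_le\<close>)

lemma poly_le_const: "a \<in> carrier R \<Longrightarrow> poly_le 0 (\<lambda>x. a)"
  using poly_le_monom[of a 0] by (rule poly_le_cong) auto

lemma poly_le_power: "poly_le n (\<lambda>x. x [^] n)"
  using poly_le_monom[of \<one> n] by (rule poly_le_cong) auto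

lemma poly_le_add:
  assumes "poly_le n g" "poly_le n h"
  shows "poly_le n (\<lambda>x. g x \<oplus> h x)"
proof -
  from assms obtain p r where pr: "p \<in> carrier (UP R)" "r \<in> carrier (UP R)" "deg R p \<le> n" "deg R r \<le> n"
    "\<forall>x\<in>carrier R. g x = UnivPoly.eval R R id x p" "\<forall>x\<in>carrier R. h x = UnivPoly.eval R R id x r"
    unfolding poly_le_def by blast
  show ?thesis unfolding poly_le_def
    by (rule bexI[of _ "p \<oplus>\<^bsub>UP R\<^esub> r"]) (use pr order_trans[OF UP.deg_add[of p r]] in \<open>auto simp: UP.evalRR_add\<close>)
qed

lemma poly_le_mult:
  assumes "poly_le n g" "poly_le m h"
  shows "poly_le (n + m) (\<lambda>x. g x \<otimes> h x)"
proof -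
  from assms obtain p r where pr: "p \<in> carrier (UP R)" "r \<in> carrier (UP R)" "deg R p \<le> n" "deg R r \<le> m"
    "\<forall>x\<in>carrier R. g x = UnivPoly.eval R R id x p" "\<forall>x\<in>carrier R. h x = UnivPoly.eval R R id x r"
    unfolding poly_le_def by blast
  show ?thesis unfolding poly_le_def
    by (rule bexI[of _ "p \<otimes>\<^bsub>UP R\<^esub> r"]) (use pr UP.deg_mult_ring[of p r] in \<open>auto simp: UP.evalRR_mult\<close>)
qed

lemma poly_le_pow:
  assumes "poly_le n g"
  shows "poly_le (n * l) (\<lambda>x. g x [^] (l::nat))"
proof (induction l)
  case 0
  then show ?case using poly_le_const[of \<one>] by simp
next
  case (Suc l)
  show ?case using poly_le_mult[OF Suc assms] by (simp add: add.commute)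
qed

lemma poly_le_minus:
  assumes "poly_le n g"
  shows "poly_le n (\<lambda>x. \<ominus> g x)"
proof (rule poly_le_cong)
  show "poly_le n (\<lambda>x. \<ominus> \<one> \<otimes> g x)"
    using poly_le_mult[OF poly_le_const[of "\<ominus> \<one>"] assms] by simp
qed (use assms poly_le_closed in \<open>auto simp: l_minus\<close>)

lemma poly_le_diff:
  assumes "poly_le n g" "poly_le n h"
  shows "poly_le n (\<lambda>x. g x \<ominus> h x)"
  using poly_le_add[OF assms(1) poly_le_minus[OF assms(2)]] by (simp add: minus_eq)

lemma poly_le_sum:
  assumes "finite A" "\<And>i. i \<in> A \<Longrightarrow> poly_le n (g i)"
  shows "poly_le n (\<lambda>x. \<Oplus>i\<in>A. g i x)"
  using assms
proof (induction A)
  case empty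
  then show ?case using poly_le_mono[OF poly_le_const[of \<zero>], of n] by simp
next
  case (insert i A)
  have "poly_le n (\<lambda>x. g i x \<oplus> (\<Oplus>i\<in>A. g i x))" using insert by (intro poly_le_add) auto
  then show ?case
    by (rule poly_le_cong) (use insert poly_le_closed in \<open>auto intro!: finsum_insert\<close>)
qed

lemma poly_eq_le: "poly_eq n g \<Longrightarrow> poly_le n g"
  unfolding poly_le_def poly_eq_def by auto

lemma poly_eq_cong: "poly_eq n g \<Longrightarrow> (\<And>x. x \<in> carrier R \<Longrightarrow> h x = g x) \<Longrightarrow> poly_eq n h"
  unfolding poly_eq_def by simp

lemma poly_eq_monom:
  assumes "a \<in> carrier R" "a \<noteq> \<zero>"
  shows "poly_eq n (\<lambda>x. a \<otimes> x [^] n)"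
proof -
  have "UnivPoly.monom (UP R) a n \<noteq> \<zero>\<^bsub>UP R\<^esub>"
    using UP.coeff_monom[OF assms(1), of n n] assms(2) by (metis UP.coeff_zero)
  then show ?thesis unfolding poly_eq_def
    by (intro bexI[of _ "UnivPoly.monom (UP R) a n"]) (use assms in \<open>auto simp: UP.evalRR_monom\<close>)
qed

lemma poly_eq_power: "poly_eq n (\<lambda>x. x [^] n)"
  using poly_eq_monom[of \<one> n] by (rule poly_eq_cong) auto

lemma poly_eq_mult:
  assumes "poly_eq n g" "poly_eq m h"
  shows "poly_eq (n + m) (\<lambda>x. g x \<otimes> h x)"
proof -
  from assms obtain p r where pr: "p \<in> carrier (UP R)" "r \<in> carrier (UP R)" "p \<noteq> \<zero>\<^bsub>UP R\<^esub>" "r \<noteq> \<zero>\<^bsub>UP R\<^esub>"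
    "deg R p = n" "deg R r = m"
    "\<forall>x\<in>carrier R. g x = UnivPoly.eval R R id x p" "\<forall>x\<in>carrier R. h x = UnivPoly.eval R R id x r"
    unfolding poly_eq_def by blast
  have "p \<otimes>\<^bsub>UP R\<^esub> r \<noteq> \<zero>\<^bsub>UP R\<^esub>" using pr UP.integral by blast
  then show ?thesis unfolding poly_eq_def
    by (intro bexI[of _ "p \<otimes>\<^bsub>UP R\<^esub> r"]) (use pr UP.deg_mult[of p r] in \<open>auto simp: UP.evalRR_mult\<close>)
qed

lemma poly_eq_pow:
  assumes "poly_eq n g"
  shows "poly_eq (n * l) (\<lambda>x. g x [^] (l::nat))"
proof (induction l)
  case 0
  then show ?case using poly_eq_power[of 0] by simp
next
  case (Suc l)
  show ?case using poly_eq_mult[OF Suc assms] by (simp add: add.commute)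
qed

lemma poly_eq_add_le:
  assumes "poly_eq n g" "poly_le m h" "m < n"
  shows "poly_eq n (\<lambda>x. g x \<oplus> h x)"
proof -
  from assms obtain p where p: "p \<in> carrier (UP R)" "p \<noteq> \<zero>\<^bsub>UP R\<^esub>" "deg R p = n"
    "\<forall>x\<in>carrier R. g x = UnivPoly.eval R R id x p" unfolding poly_eq_def by blast
  from assms obtain r where r: "r \<in> carrier (UP R)" "deg R r \<le> m"
    "\<forall>x\<in>carrier R. h x = UnivPoly.eval R R id x r" unfolding poly_le_def by blast
  have "UnivPoly.coeff (UP R) (p \<oplus>\<^bsub>UP R\<^esub> r) n = UnivPoly.coeff (UP R) p n"
    using p r assms(3) UP.deg_aboveD[of r n] by simp
  then have ne: "UnivPoly.coeff (UP R) (p \<oplus>\<^bsub>UP R\<^esub> r) n \<noteq> \<zero>" using UP.lcoeff_nonzero[of p] p by auto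
  then have "n \<le> deg R (p \<oplus>\<^bsub>UP R\<^esub> r)" using p r UP.deg_belowI by simp
  moreover have "deg R (p \<oplus>\<^bsub>UP R\<^esub> r) \<le> n" using UP.deg_add[of p r] p r assms(3) by simp
  moreover have "p \<oplus>\<^bsub>UP R\<^esub> r \<noteq> \<zero>\<^bsub>UP R\<^esub>" using ne by (metis UP.coeff_zero)
  ultimately show ?thesis unfolding poly_eq_def
    by (intro bexI[of _ "p \<oplus>\<^bsub>UP R\<^esub> r"]) (use p r in \<open>auto simp: UP.evalRR_add\<close>)
qed

lemma poly_eq_roots:
  assumes "poly_eq n g"
  shows "card {x \<in> carrier R. g x = \<zero>} \<le> n"
proof -
  from assms obtain p where p: "p \<in> carrier (UP R)" "p \<noteq> \<zero>\<^bsub>UP R\<^esub>" "deg R p = n"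
    "\<forall>x\<in>carrier R. g x = UnivPoly.eval R R id x p" unfolding poly_eq_def by blast
  have "{x \<in> carrier R. g x = \<zero>} = {x \<in> carrier R. UnivPoly.eval R R id x p = \<zero>}" using p by auto
  then show ?thesis using UP.roots_bound[of p] p by simp
qed

lemma poly_le_roots:
  assumes "poly_le n g" "n < card {x \<in> carrier R. g x = \<zero>}" "x \<in> carrier R"
  shows "g x = \<zero>"
proof -
  from assms obtain p where p: "p \<in> carrier (UP R)" "deg R p \<le> n"
    "\<forall>x\<in>carrier R. g x = UnivPoly.eval R R id x p" unfolding poly_le_def by blast
  have eq: "{x \<in> carrier R. g x = \<zero>} = {x \<in> carrier R. UnivPoly.eval R R id x p = \<zero>}" using p by auto
  have "p = \<zero>\<^bsub>UP R\<^esub>"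
  proof (rule ccontr)
    assume "p \<noteq> \<zero>\<^bsub>UP R\<^esub>"
    then show False using UP.roots_bound[OF p(1)] assms(2) p(2) eq by simp
  qed
  moreover have "UnivPoly.eval R R id x \<zero>\<^bsub>UP R\<^esub> = \<zero>"
    using UP.evalRR_monom[of \<zero> x 0] assms(3) by simp
  ultimately show ?thesis using p assms(3) by simp
qed

text \<open>Distinct exact degrees replace linear independence: the last nonzero coefficient decides
  the degree of the combination. The offset \<open>t > 0\<close> keeps \<open>m + t - 1\<close>
  below \<open>m + t\<close> even for \<open>m = 0\<close>.\<close>

lemma poly_eq_sum_nonzero:
  assumes \<phi>: "\<And>e. e < m \<Longrightarrow> poly_eq (e + t) (\<phi> e)" and "0 < t"
    and c: "\<And>e. e < m \<Longrightarrow> c e \<in> carrier R" and ne: "\<exists>e<m. c e \<noteq> \<zero>"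
  shows "\<exists>e<m. poly_eq (e + t) (\<lambda>x. \<Oplus>i\<in>{..<m}. c i \<otimes> \<phi> i x)"
  using \<phi> c ne
proof (induction m)
  case 0
  then show ?case by simp
next
  case (Suc m)
  have cl: "\<phi> e x \<in> carrier R" if "e < Suc m" "x \<in> carrier R" for e x
    using Suc.prems(1)[OF that(1)] that(2) poly_eq_le poly_le_closed by blast
  have split: "(\<Oplus>i\<in>{..<Suc m}. c i \<otimes> \<phi> i x) = c m \<otimes> \<phi> m x \<oplus> (\<Oplus>i\<in>{..<m}. c i \<otimes> \<phi> i x)"
    if "x \<in> carrier R" for x
    unfolding lessThan_Suc using Suc.prems(2) cl[OF _ that] that by (subst finsum_insert) (auto simp: Pi_def)
  have le: "poly_le (m + t - 1) (\<lambda>x. \<Oplus>i\<in>{..<m}. c i \<otimes> \<phi> i x)"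
  proof (rule poly_le_sum)
    fix i assume "i \<in> {..<m}"
    then have "poly_le (0 + (i + t)) (\<lambda>x. c i \<otimes> \<phi> i x)"
      using Suc.prems by (intro poly_le_mult poly_le_const poly_eq_le) auto
    then show "poly_le (m + t - 1) (\<lambda>x. c i \<otimes> \<phi> i x)"
      by (rule poly_le_mono) (use \<open>i \<in> {..<m}\<close> in auto)
  qed simp
  show ?case
  proof (cases "c m = \<zero>")
    case True
    then have "\<exists>e<m. c e \<noteq> \<zero>" using Suc.prems(3) less_Suc_eq by auto
    then obtain e where "e < m" "poly_eq (e + t) (\<lambda>x. \<Oplus>i\<in>{..<m}. c i \<otimes> \<phi> i x)"
      using Suc.IH[OF Suc.prems(1,2)] by auto
    note e = this
    have "(\<Oplus>i\<in>{..<Suc m}. c i \<otimes> \<phi> i x) = (\<Oplus>i\<in>{..<m}. c i \<otimes> \<phi> i x)" if "x \<in> carrier R" for x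
      using split[OF that] True cl[OF _ that] Suc.prems(2) by (simp add: Pi_def)
    from poly_eq_cong[OF e(2) this] show ?thesis using e(1) less_SucI by blast
  next
    case False
    have "poly_eq (0 + (m + t)) (\<lambda>x. (c m \<otimes> x [^] (0::nat)) \<otimes> \<phi> m x)"
      using False Suc.prems by (intro poly_eq_mult poly_eq_monom) auto
    then have "poly_eq (m + t) (\<lambda>x. c m \<otimes> \<phi> m x)"
      using Suc.prems(2) by simp
    from poly_eq_add_le[OF this le] \<open>0 < t\<close>
    have "poly_eq (m + t) (\<lambda>x. c m \<otimes> \<phi> m x \<oplus> (\<Oplus>i\<in>{..<m}. c i \<otimes> \<phi> i x))" by simp
    from poly_eq_cong[OF this split] show ?thesis by blast
  qed
qed

text \<open>Induction through (x + y)^(n+1) - x^(n+1) = ((x + y)^n - x^n) x + y (x + y)^n, where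
  both summands have degree at most n.\<close>

lemma poly_le_binomial:
  assumes y: "y \<in> carrier R"
  shows "poly_le (n - 1) (\<lambda>x. (x \<oplus> y) [^] n \<ominus> x [^] n)"
proof (induction n)
  case 0
  show ?case using poly_le_const[of \<zero>] by (simp add: minus_eq r_neg)
next
  case (Suc n)
  have x: "poly_le 1 (\<lambda>x. x)" using poly_le_power[of 1] by (rule poly_le_cong) auto
  have xy: "poly_le 1 (\<lambda>x. x \<oplus> y)"
    using poly_le_add[OF x poly_le_mono[OF poly_le_const[OF y]]] by simp
  have 1: "poly_le n (\<lambda>x. y \<otimes> (x \<oplus> y) [^] n)"
    using poly_le_mult[OF poly_le_const[OF y] poly_le_pow[OF xy, of n]] by simp
  have "poly_le n (\<lambda>x. ((x \<oplus> y) [^] n \<ominus> x [^] n) \<otimes> x)"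
  \<comment> \<open>For \<open>n = 0\<close> the truncated \<open>n - 1\<close> is 0, and
    multiplying by \<open>x\<close> would give degree 1; but here the function itself
    vanishes.\<close>
  proof (cases n)
    case 0
    show ?thesis unfolding 0 by (rule poly_le_cong[OF poly_le_const[OF zero_closed]]) (auto simp: minus_eq r_neg)
  next
    case (Suc k)
    then show ?thesis using poly_le_mult[OF Suc.IH x] by simp
  qed
  from poly_le_add[OF this 1] show ?case
  proof (simp, rule poly_le_cong)
    fix x assume x: "x \<in> carrier R"
    define u v where "u = (x \<oplus> y) [^] n" and "v = x [^] n"
    have "u \<in> carrier R" "v \<in> carrier R" unfolding u_def v_def using x y by auto
    then have "u \<otimes> (x \<oplus> y) \<ominus> v \<otimes> x = (u \<ominus> v) \<otimes> x \<oplus> y \<otimes> u" using x y by algebra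
    then show "(x \<oplus> y) [^] n \<otimes> (x \<oplus> y) \<ominus> x [^] n \<otimes> x = ((x \<oplus> y) [^] n \<ominus> x [^] n) \<otimes> x \<oplus> y \<otimes> (x \<oplus> y) [^] n"
      unfolding u_def v_def .
  qed
qed

text \<open>The polynomial \<open>(X + y)^q - X^q - y^q\<close> has degree less than \<open>q\<close> and vanishes at the \<open>q\<close>
  points \<open>c y\<close>, so no characteristic and no binomial coefficients are needed.\<close>

lemma power_additive:
  assumes S: "S \<subseteq> carrier R" "card S = q" "0 < q"
    and fx: "\<And>c. c \<in> S \<Longrightarrow> c [^] q = c" "\<And>c. c \<in> S \<Longrightarrow> (c \<oplus> \<one>) [^] q = c \<oplus> \<one>"
    and xy: "x \<in> carrier R" "y \<in> carrier R"
  shows "(x \<oplus> y) [^] q = x [^] q \<oplus> y [^] q"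
proof (cases "y = \<zero>")
  case True
  then show ?thesis using xy \<open>0 < q\<close> by (simp add: nat_pow_zero)
next
  case False
  define g where "g = (\<lambda>x. ((x \<oplus> y) [^] q \<ominus> x [^] q) \<ominus> y [^] q)"
  have g: "poly_le (q - 1) g"
    unfolding g_def using xy by (intro poly_le_diff poly_le_binomial poly_le_mono[OF poly_le_const]) auto
  have "inj_on (\<lambda>c. c \<otimes> y) S" using S(1) False xy by (intro inj_onI) (meson m_rcancel subsetD)
  then have "card ((\<lambda>c. c \<otimes> y) ` S) = q" using S by (simp add: card_image)
  \<comment> \<open>At \<open>c y\<close> the two powers are (c + 1) y^q and c y^q, since both
    \<open>c\<close> and \<open>c + 1\<close> are fixed by the q-th power.\<close>
  moreover have "(\<lambda>c. c \<otimes> y) ` S \<subseteq> {x \<in> carrier R. g x = \<zero>}"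
  proof safe
    fix c assume c: "c \<in> S"
    then have cc: "c \<in> carrier R" using S by auto
    then show "c \<otimes> y \<in> carrier R" using xy by simp
    have "c \<otimes> y \<oplus> y = (c \<oplus> \<one>) \<otimes> y" using cc xy by algebra
    then have "(c \<otimes> y \<oplus> y) [^] q = (c \<oplus> \<one>) \<otimes> y [^] q"
      using cc xy fx(2)[OF c] by (simp add: nat_pow_distrib)
    moreover have "(c \<otimes> y) [^] q = c \<otimes> y [^] q" using cc xy fx(1)[OF c] by (simp add: nat_pow_distrib)
    moreover have "((c \<oplus> \<one>) \<otimes> w \<ominus> c \<otimes> w) \<ominus> w = \<zero>" if "w \<in> carrier R" for w
      using cc that by algebra
    ultimately show "g (c \<otimes> y) = \<zero>" unfolding g_def using xy by simp
  qed
  ultimately have "q \<le> card {x \<in> carrier R. g x = \<zero>}"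
    by (metis (no_types, lifting) card_mono finite_carrier finite_subset mem_Collect_eq subsetI)
  then have "g x = \<zero>" using poly_le_roots[OF g _ xy(1)] \<open>0 < q\<close> by simp
  define u v w where "u = (x \<oplus> y) [^] q" and "v = x [^] q" and "w = y [^] q"
  have cl: "u \<in> carrier R" "v \<in> carrier R" "w \<in> carrier R" unfolding u_def v_def w_def using xy by auto
  have "(u \<ominus> v) \<ominus> w = \<zero>" using \<open>g x = \<zero>\<close> unfolding g_def u_def v_def w_def .
  moreover have "u = ((u \<ominus> v) \<ominus> w) \<oplus> (v \<oplus> w)" using cl by algebra
  ultimately show ?thesis using cl by (metis a_closed l_zero u_def v_def w_def)
qed

lemma power_order:
  assumes "x \<in> carrier R"
  shows "x [^] order R = x"
proof (cases "x = \<zero>")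
  case True
  then show ?thesis using order_pos by (simp add: nat_pow_zero)
next
  case False
  have "x [^]\<^bsub>Multiplicative_Group.mult_of R\<^esub> order (Multiplicative_Group.mult_of R) = \<one>"
    using group.pow_order_eq_1[OF field_mult_group, of x] False assms by simp
  then have "x [^] (order R - 1) = \<one>"
    by (simp add: Multiplicative_Group.nat_pow_mult_of order_mult_of)
  then have "x [^] (order R - 1) \<otimes> x = x" using assms by simp
  moreover have "Suc (order R - 1) = order R" using order_pos by simp
  ultimately show ?thesis by (metis nat_pow_Suc)
qed

end

section \<open>Kloosterman sums and quadratic extensions\<close>

definition kloosterman :: "('a, 'b) ring_scheme \<Rightarrow> ('a \<Rightarrow> complex) \<Rightarrow> 'a \<Rightarrow> 'a \<Rightarrow> complex" where
  "kloosterman R \<chi> a b = (\<Sum>x\<in>carrier R - {\<zero>\<^bsub>R\<^esub>}. \<chi> (a \<otimes>\<^bsub>R\<^esub> x \<oplus>\<^bsub>R\<^esub> b \<otimes>\<^bsub>R\<^esub> inv\<^bsub>R\<^esub> x))"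

text \<open>The algebra R[w]/(w^2 - \<delta>), with (x, y) standing for x + y w.\<close>

definition quad_ring :: "('a, 'b) ring_scheme \<Rightarrow> 'a \<Rightarrow> ('a \<times> 'a) ring" where
  "quad_ring R \<delta> =
    \<lparr>carrier = carrier R \<times> carrier R,
     monoid.mult = (\<lambda>(x, y) (u, v). (x \<otimes>\<^bsub>R\<^esub> u \<oplus>\<^bsub>R\<^esub> \<delta> \<otimes>\<^bsub>R\<^esub> (y \<otimes>\<^bsub>R\<^esub> v), x \<otimes>\<^bsub>R\<^esub> v \<oplus>\<^bsub>R\<^esub> y \<otimes>\<^bsub>R\<^esub> u)),
     monoid.one = (\<one>\<^bsub>R\<^esub>, \<zero>\<^bsub>R\<^esub>), ring.zero = (\<zero>\<^bsub>R\<^esub>, \<zero>\<^bsub>R\<^esub>),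
     ring.add = (\<lambda>(x, y) (u, v). (x \<oplus>\<^bsub>R\<^esub> u, y \<oplus>\<^bsub>R\<^esub> v))\<rparr>"

section \<open>Construction of the quadratic extension\<close>

context finite_field
begin

lemma diff_diff: "x \<in> carrier R \<Longrightarrow> y \<in> carrier R \<Longrightarrow> x \<ominus> (x \<ominus> y) = y"
  by algebra

lemma add_eq_zero_iff: "x \<in> carrier R \<Longrightarrow> y \<in> carrier R \<Longrightarrow> x \<oplus> y = \<zero> \<longleftrightarrow> x = \<ominus> y"
  using minus_equality[of x y] l_neg[of y] by auto

text \<open>This is the norm of x + y w; if it vanished with \<open>y\<close> nonzero, x / y would
  be a square root of \<open>\<delta>\<close>.\<close>

lemma norm_form_nonzero:
  assumes \<delta>: "\<delta> \<in> carrier R" "nsqrt \<delta> = 0" and xy: "x \<in> carrier R" "y \<in> carrier R" "x \<noteq> \<zero> \<or> y \<noteq> \<zero>"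
  shows "x \<otimes> x \<ominus> \<delta> \<otimes> (y \<otimes> y) \<noteq> \<zero>"
proof
  assume "x \<otimes> x \<ominus> \<delta> \<otimes> (y \<otimes> y) = \<zero>"
  then have eq: "x \<otimes> x = \<delta> \<otimes> (y \<otimes> y)" using \<delta> xy by simp
  show False
  proof (cases "y = \<zero>")
    case True
    then show False using eq xy \<delta> by auto
  next
    case False
    then have i: "inv y \<in> carrier R" "inv y \<otimes> y = \<one>" using xy by auto
    have "(x \<otimes> inv y) \<otimes> (x \<otimes> inv y) = (x \<otimes> x) \<otimes> (inv y \<otimes> inv y)" using i xy by algebra
    also have "\<dots> = \<delta> \<otimes> (inv y \<otimes> y) \<otimes> (inv y \<otimes> y)" unfolding eq using i(1) xy \<delta> by algebra
    also have "\<dots> = \<delta>" unfolding i(2) using \<delta> by simp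
    finally have "0 < nsqrt \<delta>" using nsqrt_pos_iff i xy by blast
    then show False using \<delta> by simp
  qed
qed

lemma quad_ring_field:
  assumes \<delta>: "\<delta> \<in> carrier R" "nsqrt \<delta> = 0"
  shows "field (quad_ring R \<delta>)"
proof -
  let ?Q = "quad_ring R \<delta>"
  interpret Q: cring "?Q"
  proof (intro cringI abelian_groupI comm_monoidI)
    fix x assume "x \<in> carrier (?Q)"
    then show "\<exists>y\<in>carrier (?Q). y \<oplus>\<^bsub>?Q\<^esub> x = \<zero>\<^bsub>?Q\<^esub>"
      by (intro bexI[of _ "(\<ominus> fst x, \<ominus> snd x)"]) (auto simp: quad_ring_def l_neg)
  next
    fix x y z assume "x \<in> carrier (?Q)" "y \<in> carrier (?Q)" "z \<in> carrier (?Q)"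
    then obtain x1 x2 y1 y2 z1 z2 where eq: "x = (x1, x2)" "y = (y1, y2)" "z = (z1, z2)"
      and c: "x1 \<in> carrier R" "x2 \<in> carrier R" "y1 \<in> carrier R" "y2 \<in> carrier R" "z1 \<in> carrier R" "z2 \<in> carrier R"
      by (auto simp: quad_ring_def)
    have "(x1 \<otimes> y1 \<oplus> \<delta> \<otimes> (x2 \<otimes> y2)) \<otimes> z1 \<oplus> \<delta> \<otimes> ((x1 \<otimes> y2 \<oplus> x2 \<otimes> y1) \<otimes> z2) =
        x1 \<otimes> (y1 \<otimes> z1 \<oplus> \<delta> \<otimes> (y2 \<otimes> z2)) \<oplus> \<delta> \<otimes> (x2 \<otimes> (y1 \<otimes> z2 \<oplus> y2 \<otimes> z1))"
      using c \<delta> by algebra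
    moreover have "(x1 \<otimes> y1 \<oplus> \<delta> \<otimes> (x2 \<otimes> y2)) \<otimes> z2 \<oplus> (x1 \<otimes> y2 \<oplus> x2 \<otimes> y1) \<otimes> z1 =
        x1 \<otimes> (y1 \<otimes> z2 \<oplus> y2 \<otimes> z1) \<oplus> x2 \<otimes> (y1 \<otimes> z1 \<oplus> \<delta> \<otimes> (y2 \<otimes> z2))"
      using c \<delta> by algebra
    ultimately show "x \<otimes>\<^bsub>?Q\<^esub> y \<otimes>\<^bsub>?Q\<^esub> z = x \<otimes>\<^bsub>?Q\<^esub> (y \<otimes>\<^bsub>?Q\<^esub> z)"
      unfolding eq by (simp add: quad_ring_def)
    have "(x1 \<oplus> y1) \<otimes> z1 \<oplus> \<delta> \<otimes> ((x2 \<oplus> y2) \<otimes> z2) =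
        (x1 \<otimes> z1 \<oplus> \<delta> \<otimes> (x2 \<otimes> z2)) \<oplus> (y1 \<otimes> z1 \<oplus> \<delta> \<otimes> (y2 \<otimes> z2))"
      using c \<delta> by algebra
    moreover have "(x1 \<oplus> y1) \<otimes> z2 \<oplus> (x2 \<oplus> y2) \<otimes> z1 = (x1 \<otimes> z2 \<oplus> x2 \<otimes> z1) \<oplus> (y1 \<otimes> z2 \<oplus> y2 \<otimes> z1)"
      using c \<delta> by algebra
    ultimately show "(x \<oplus>\<^bsub>?Q\<^esub> y) \<otimes>\<^bsub>?Q\<^esub> z =
        x \<otimes>\<^bsub>?Q\<^esub> z \<oplus>\<^bsub>?Q\<^esub> y \<otimes>\<^bsub>?Q\<^esub> z"
      unfolding eq by (simp add: quad_ring_def)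
  qed (use \<delta> in \<open>auto simp: quad_ring_def a_ac m_ac\<close>)
  show ?thesis
  proof (rule Q.cring_fieldI2)
    show "\<zero>\<^bsub>?Q\<^esub> \<noteq> \<one>\<^bsub>?Q\<^esub>" by (simp add: quad_ring_def)
    fix z assume z: "z \<in> carrier (?Q)" "z \<noteq> \<zero>\<^bsub>?Q\<^esub>"
    then obtain x y where xy: "z = (x, y)" "x \<in> carrier R" "y \<in> carrier R" "x \<noteq> \<zero> \<or> y \<noteq> \<zero>"
      by (auto simp: quad_ring_def)
    \<comment> \<open>The inverse is the conjugate x - y w divided by the norm
      \<open>N\<close>.\<close>
    define N where "N = x \<otimes> x \<ominus> \<delta> \<otimes> (y \<otimes> y)"
    have N: "N \<in> carrier R" "N \<noteq> \<zero>" using norm_form_nonzero[OF \<delta> xy(2-4)] xy \<delta> by (auto simp: N_def)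
    then have i: "inv N \<in> carrier R" by simp
    have "x \<otimes> (x \<otimes> inv N) \<oplus> \<delta> \<otimes> (y \<otimes> (\<ominus> (y \<otimes> inv N))) = N \<otimes> inv N"
      unfolding N_def[symmetric] using xy \<delta> i unfolding N_def by algebra
    moreover have "x \<otimes> (\<ominus> (y \<otimes> inv N)) \<oplus> y \<otimes> (x \<otimes> inv N) = \<zero>" using xy i by algebra
    ultimately show "\<exists>w\<in>carrier (?Q). z \<otimes>\<^bsub>?Q\<^esub> w = \<one>\<^bsub>?Q\<^esub>"
      using xy i N by (intro bexI[of _ "(x \<otimes> inv N, \<ominus> (y \<otimes> inv N))"]) (auto simp: quad_ring_def)
  qed
qed

end

text \<open>All that is used about \<open>S\<close> is phrased through the basis 1,
  \<open>\<omega>\<close> over the image of \<open>R\<close>, so the pairs of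
  \<open>quad_ring\<close> can be forgotten and \<open>S\<close> may have any type.\<close>

locale quad_extension = odd_finite_field R + S: finite_field S for R (structure) and S +
  fixes \<iota> :: "'a \<Rightarrow> 'c" and \<delta> \<omega>
  assumes hom: "\<iota> \<in> ring_hom R S"
    and nonsquare: "\<delta> \<in> carrier R" "nsqrt \<delta> = 0"
    and root: "\<omega> \<in> carrier S" "\<omega> \<otimes>\<^bsub>S\<^esub> \<omega> = \<iota> \<delta>"
    and bij: "bij_betw (\<lambda>(x, y). \<iota> x \<oplus>\<^bsub>S\<^esub> \<iota> y \<otimes>\<^bsub>S\<^esub> \<omega>) (carrier R \<times> carrier R) (carrier S)"

text \<open>Pairs would put each field of a tower into a new type and rule out an induction over it.
  An injection of the finite carrier into \<open>nat\<close> transports the structure to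
  \<open>nat ring\<close>.\<close>

lemma (in odd_finite_field) quad_extension_exists:
  "\<exists>(S :: nat ring) \<iota> \<delta> \<omega>. quad_extension R S \<iota> \<delta> \<omega>"
proof -
  obtain \<delta> where \<delta>: "\<delta> \<in> carrier R" "nsqrt \<delta> = 0" using nonsquare_exists by blast
  define Q where "Q = quad_ring R \<delta>"
  interpret Q: field Q unfolding Q_def using \<delta> by (rule quad_ring_field)
  have cQ: "carrier Q = carrier R \<times> carrier R" by (simp add: Q_def quad_ring_def)
  then have fin: "finite (carrier Q)" by simp
  then obtain f :: "'a \<times> 'a \<Rightarrow> nat" where f: "inj_on f (carrier Q)" using finite_imp_inj_to_nat_seg by blast
  define S where "S = image_ring f Q"
  interpret S: field S unfolding S_def using f by (rule Q.inj_imp_image_ring_is_field)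
  have "f \<in> ring_iso Q S" unfolding S_def using f by (rule inj_imp_image_ring_iso)
  then have iso: "f \<in> ring_hom Q S" "bij_betw f (carrier Q) (carrier S)" by (auto simp: ring_iso_def)
  have "ring_hom_cring Q S f" using iso(1)
    by (intro ring_hom_cringI) unfold_locales
  then interpret f: ring_hom_cring Q S f .
  have \<iota>: "(\<lambda>x. f (x, \<zero>)) \<in> ring_hom R S"
  proof (rule ring_hom_memI)
    fix x y assume xy: "x \<in> carrier R" "y \<in> carrier R"
    show "f (x, \<zero>) \<in> carrier S" using xy by (simp add: cQ)
    have "(x \<otimes> y, \<zero>) = (x, \<zero>) \<otimes>\<^bsub>Q\<^esub> (y, \<zero>)" using xy \<delta> by (simp add: Q_def quad_ring_def)
    then show "f (x \<otimes> y, \<zero>) = f (x, \<zero>) \<otimes>\<^bsub>S\<^esub> f (y, \<zero>)" using xy by (simp add: cQ)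
    have "(x \<oplus> y, \<zero>) = (x, \<zero>) \<oplus>\<^bsub>Q\<^esub> (y, \<zero>)" using xy \<delta> by (simp add: Q_def quad_ring_def)
    then show "f (x \<oplus> y, \<zero>) = f (x, \<zero>) \<oplus>\<^bsub>S\<^esub> f (y, \<zero>)" using xy by (simp add: cQ)
  next
    have "(\<one>, \<zero>) = \<one>\<^bsub>Q\<^esub>" by (simp add: Q_def quad_ring_def)
    then show "f (\<one>, \<zero>) = \<one>\<^bsub>S\<^esub>" by simp
  qed
  have "quad_extension R S (\<lambda>x. f (x, \<zero>)) \<delta> (f (\<zero>, \<one>))"
  proof (unfold_locales)
    show "finite (carrier S)" using iso(2) fin bij_betw_finite by blast
    show "(\<lambda>x. f (x, \<zero>)) \<in> ring_hom R S" by (rule \<iota>)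
    show "f (\<zero>, \<one>) \<in> carrier S" by (simp add: cQ)
    have "(\<zero>, \<one>) \<otimes>\<^bsub>Q\<^esub> (\<zero>, \<one>) = (\<delta>, \<zero>)" using \<delta> by (simp add: Q_def quad_ring_def)
    then show "f (\<zero>, \<one>) \<otimes>\<^bsub>S\<^esub> f (\<zero>, \<one>) = f (\<delta>, \<zero>)" using f.hom_mult[of "(\<zero>, \<one>)" "(\<zero>, \<one>)"] by (simp add: cQ)
    have "f (x, \<zero>) \<oplus>\<^bsub>S\<^esub> f (y, \<zero>) \<otimes>\<^bsub>S\<^esub> f (\<zero>, \<one>) = f (x, y)" if "x \<in> carrier R" "y \<in> carrier R" for x y
    proof -
      have "(x, y) = (x, \<zero>) \<oplus>\<^bsub>Q\<^esub> (y, \<zero>) \<otimes>\<^bsub>Q\<^esub> (\<zero>, \<one>)" using that \<delta> by (simp add: Q_def quad_ring_def)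
      then have "f (x, y) = f ((x, \<zero>) \<oplus>\<^bsub>Q\<^esub> (y, \<zero>) \<otimes>\<^bsub>Q\<^esub> (\<zero>, \<one>))" by simp
      also have "\<dots> = f (x, \<zero>) \<oplus>\<^bsub>S\<^esub> f (y, \<zero>) \<otimes>\<^bsub>S\<^esub> f (\<zero>, \<one>)"
        using f.hom_add[of "(x, \<zero>)" "(y, \<zero>) \<otimes>\<^bsub>Q\<^esub> (\<zero>, \<one>)"] f.hom_mult[of "(y, \<zero>)" "(\<zero>, \<one>)"]
          Q.m_closed[of "(y, \<zero>)" "(\<zero>, \<one>)"] that by (auto simp: cQ)
      finally show ?thesis by simp
    qed
    then show "bij_betw (\<lambda>(x, y). f (x, \<zero>) \<oplus>\<^bsub>S\<^esub> f (y, \<zero>) \<otimes>\<^bsub>S\<^esub> f (\<zero>, \<one>)) (carrier R \<times> carrier R) (carrier S)"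
      using iso(2) unfolding cQ by (subst bij_betw_cong[where g = f]) auto
  qed (use \<delta> in auto)
  then show ?thesis by blast
qed

section \<open>The square of a Kloosterman sum and its twist by a nonsquare\<close>

locale odd_field_character = odd_finite_field R + field_character R \<chi> for R (structure) and \<chi>
begin

text \<open>With \<open>v = x + y\<close>, \<open>w = x - y\<close> the exponent of the product of two Kloosterman summands is
  \<open>2 (a x + b x / (x^2 - y^2))\<close>; over the quadratic extension \<open>y^2\<close> is replaced by \<open>\<delta> y^2\<close>, and
  every element of the field is twice of the form \<open>y^2\<close> or \<open>\<delta> y^2\<close>.\<close>

definition kl_term :: "'a \<Rightarrow> 'a \<Rightarrow> 'a \<Rightarrow> 'a \<Rightarrow> complex" where
  "kl_term a b x \<nu> = (if \<nu> = \<zero> then 0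
     else \<chi> ((a \<otimes> x \<oplus> b \<otimes> (x \<otimes> inv \<nu>)) \<oplus> (a \<otimes> x \<oplus> b \<otimes> (x \<otimes> inv \<nu>))))"

lemma kloosterman_squared:
  assumes ab: "a \<in> carrier R" "b \<in> carrier R"
  shows "(kloosterman R \<chi> a b)\<^sup>2 = (\<Sum>(x, y)\<in>carrier R \<times> carrier R. kl_term a b x (x \<otimes> x \<ominus> y \<otimes> y))"
proof -
  let ?f = "\<lambda>x. \<chi> (a \<otimes> x \<oplus> b \<otimes> inv x)" and ?U = "carrier R - {\<zero>}"
  let ?P = "{(x, y) \<in> carrier R \<times> carrier R. x \<otimes> x \<ominus> y \<otimes> y \<noteq> \<zero>}"
  have fac: "(x \<oplus> y) \<otimes> (x \<ominus> y) = x \<otimes> x \<ominus> y \<otimes> y" if "x \<in> carrier R" "y \<in> carrier R" for x y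
    using that by algebra
  have bij: "bij_betw (\<lambda>(x, y). (x \<oplus> y, x \<ominus> y)) ?P (?U \<times> ?U)"
  proof (rule bij_betw_byWitness[where f' = "\<lambda>(v, w). (half (v \<oplus> w), half (v \<ominus> w))"])
    show "\<forall>p\<in>?P. (\<lambda>(v, w). (half (v \<oplus> w), half (v \<ominus> w))) ((\<lambda>(x, y). (x \<oplus> y, x \<ominus> y)) p) = p"
    proof
      fix p assume "p \<in> ?P"
      then obtain x y where p: "p = (x, y)" and c: "x \<in> carrier R" "y \<in> carrier R" by auto
      have "x \<oplus> x = (x \<oplus> y) \<oplus> (x \<ominus> y)" "y \<oplus> y = (x \<oplus> y) \<ominus> (x \<ominus> y)" using c by algebra+
      then have "half ((x \<oplus> y) \<oplus> (x \<ominus> y)) = x" "half ((x \<oplus> y) \<ominus> (x \<ominus> y)) = y"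
        using c by (auto intro!: half_unique)
      then show "(\<lambda>(v, w). (half (v \<oplus> w), half (v \<ominus> w))) ((\<lambda>(x, y). (x \<oplus> y, x \<ominus> y)) p) = p" unfolding p by simp
    qed
    have rec: "half (v \<oplus> w) \<oplus> half (v \<ominus> w) = v" "half (v \<oplus> w) \<ominus> half (v \<ominus> w) = w"
      if c: "v \<in> carrier R" "w \<in> carrier R" for v w
    proof -
      define h g where "h = half (v \<oplus> w)" and "g = half (v \<ominus> w)"
      have hg: "h \<in> carrier R" "g \<in> carrier R" "h \<oplus> h = v \<oplus> w" "g \<oplus> g = v \<ominus> w"
        unfolding h_def g_def using c by auto
      have "(h \<oplus> g) \<oplus> (h \<oplus> g) = (h \<oplus> h) \<oplus> (g \<oplus> g)" using hg(1,2) by algebra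
      also have "\<dots> = v \<oplus> v" unfolding hg using c by algebra
      finally have "half (v \<oplus> v) = h \<oplus> g" using c hg by (intro half_unique) auto
      moreover have "half (v \<oplus> v) = v" using c by (intro half_unique) auto
      ultimately show "half (v \<oplus> w) \<oplus> half (v \<ominus> w) = v" unfolding h_def g_def by simp
      have "(h \<ominus> g) \<oplus> (h \<ominus> g) = (h \<oplus> h) \<ominus> (g \<oplus> g)" using hg(1,2) by algebra
      also have "\<dots> = w \<oplus> w" unfolding hg using c by algebra
      finally have "half (w \<oplus> w) = h \<ominus> g" using c hg by (intro half_unique) auto
      moreover have "half (w \<oplus> w) = w" using c by (intro half_unique) auto
      ultimately show "half (v \<oplus> w) \<ominus> half (v \<ominus> w) = w" unfolding h_def g_def by simp
    qed
    then show "\<forall>p\<in>?U \<times> ?U. (\<lambda>(x, y). (x \<oplus> y, x \<ominus> y)) ((\<lambda>(v, w). (half (v \<oplus> w), half (v \<ominus> w))) p) = p"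
      by auto
    show "(\<lambda>(x, y). (x \<oplus> y, x \<ominus> y)) ` ?P \<subseteq> ?U \<times> ?U"
    proof (rule image_subsetI)
      fix p assume "p \<in> ?P"
      then obtain x y where p: "p = (x, y)" and c: "x \<in> carrier R" "y \<in> carrier R" "x \<otimes> x \<ominus> y \<otimes> y \<noteq> \<zero>"
        by auto
      have "(x \<oplus> y) \<otimes> (x \<ominus> y) \<noteq> \<zero>" unfolding fac[OF c(1,2)] by (rule c(3))
      then have "x \<oplus> y \<noteq> \<zero>" "x \<ominus> y \<noteq> \<zero>" using c(1,2) mult_eq_zero_iff[of "x \<oplus> y" "x \<ominus> y"] by blast+
      then show "(\<lambda>(x, y). (x \<oplus> y, x \<ominus> y)) p \<in> ?U \<times> ?U" unfolding p using c(1,2) by simp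
    qed
    show "(\<lambda>(v, w). (half (v \<oplus> w), half (v \<ominus> w))) ` (?U \<times> ?U) \<subseteq> ?P"
    proof (rule image_subsetI)
      fix p assume "p \<in> ?U \<times> ?U"
      then obtain v w where p: "p = (v, w)" and c: "v \<in> carrier R" "w \<in> carrier R" "v \<noteq> \<zero>" "w \<noteq> \<zero>"
        by auto
      have "half (v \<oplus> w) \<otimes> half (v \<oplus> w) \<ominus> half (v \<ominus> w) \<otimes> half (v \<ominus> w) = v \<otimes> w"
        using fac[of "half (v \<oplus> w)" "half (v \<ominus> w)"] rec[OF c(1,2)] c by simp
      then show "(\<lambda>(v, w). (half (v \<oplus> w), half (v \<ominus> w))) p \<in> ?P" unfolding p using c by simp
    qed
  qed
  have "(kloosterman R \<chi> a b)\<^sup>2 = (\<Sum>(v, w)\<in>?U \<times> ?U. ?f v * ?f w)"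
    unfolding kloosterman_def power2_eq_square by (simp add: sum_product sum.cartesian_product)
  also have "\<dots> = (\<Sum>(x, y)\<in>?P. ?f (x \<oplus> y) * ?f (x \<ominus> y))"
    by (subst sum.reindex_bij_betw[OF bij, symmetric]) (auto simp: case_prod_unfold)
  also have "\<dots> = (\<Sum>(x, y)\<in>?P. kl_term a b x (x \<otimes> x \<ominus> y \<otimes> y))"
  proof (rule sum.cong[OF refl], clarify)
    fix x y assume c: "x \<in> carrier R" "y \<in> carrier R" and ne: "x \<otimes> x \<ominus> y \<otimes> y \<noteq> \<zero>"
    define v w where "v = x \<oplus> y" and "w = x \<ominus> y"
    have vw: "v \<in> carrier R" "w \<in> carrier R" unfolding v_def w_def using c by auto
    have prod: "v \<otimes> w = x \<otimes> x \<ominus> y \<otimes> y" unfolding v_def w_def by (rule fac[OF c])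
    then have ne': "v \<noteq> \<zero>" "w \<noteq> \<zero>" using ne vw by auto
    define i j where "i = inv v" and "j = inv w"
    have ij: "i \<in> carrier R" "j \<in> carrier R" "v \<otimes> i = \<one>" "w \<otimes> j = \<one>"
      unfolding i_def j_def using vw ne' by auto
    have inv: "inv (x \<otimes> x \<ominus> y \<otimes> y) = i \<otimes> j"
      unfolding prod[symmetric] i_def j_def by (rule inv_mult_distrib[OF vw(1) ne'(1) vw(2) ne'(2)])
    \<comment> \<open>This is 1/v + 1/w = (v + w) / (v w) together with v + w = 2 x.\<close>
    have "x \<otimes> (i \<otimes> j) \<oplus> x \<otimes> (i \<otimes> j) = (v \<oplus> w) \<otimes> (i \<otimes> j)"
      unfolding v_def w_def using c ij(1,2) by algebra
    also have "\<dots> = (v \<otimes> i) \<otimes> j \<oplus> (w \<otimes> j) \<otimes> i" using vw ij(1,2) by algebra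
    also have "\<dots> = i \<oplus> j" unfolding ij using ij(1,2) by algebra
    finally have sum: "i \<oplus> j = x \<otimes> (i \<otimes> j) \<oplus> x \<otimes> (i \<otimes> j)" by simp
    have "(a \<otimes> v \<oplus> b \<otimes> i) \<oplus> (a \<otimes> w \<oplus> b \<otimes> j) = a \<otimes> (v \<oplus> w) \<oplus> b \<otimes> (i \<oplus> j)"
      using ab vw ij(1,2) by algebra
    also have "\<dots> = (a \<otimes> x \<oplus> b \<otimes> (x \<otimes> (i \<otimes> j))) \<oplus> (a \<otimes> x \<oplus> b \<otimes> (x \<otimes> (i \<otimes> j)))"
      unfolding sum unfolding v_def w_def using ab c ij(1,2) by algebra
    finally have *: "(a \<otimes> v \<oplus> b \<otimes> i) \<oplus> (a \<otimes> w \<oplus> b \<otimes> j) =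
      (a \<otimes> x \<oplus> b \<otimes> (x \<otimes> (i \<otimes> j))) \<oplus> (a \<otimes> x \<oplus> b \<otimes> (x \<otimes> (i \<otimes> j)))" .
    have "?f v * ?f w = \<chi> ((a \<otimes> v \<oplus> b \<otimes> i) \<oplus> (a \<otimes> w \<oplus> b \<otimes> j))"
      unfolding i_def[symmetric] j_def[symmetric] using ab vw ij by (simp add: char_add)
    then have "?f v * ?f w = kl_term a b x (x \<otimes> x \<ominus> y \<otimes> y)"
      unfolding * kl_term_def inv using ne by simp
    then show "?f (x \<oplus> y) * ?f (x \<ominus> y) = kl_term a b x (x \<otimes> x \<ominus> y \<otimes> y)" unfolding v_def w_def .
  qed
  also have "\<dots> = (\<Sum>(x, y)\<in>carrier R \<times> carrier R. kl_term a b x (x \<otimes> x \<ominus> y \<otimes> y))"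
    by (rule sum.mono_neutral_left) (auto simp: kl_term_def)
  finally show ?thesis .
qed

text \<open>Summed over \<open>x\<close> first, the exponent 2 (a + b / \<nu>) x is linear in
  \<open>x\<close>: only \<nu> = -b / a survives, and it contributes |R|.\<close>

lemma sum_kl_term:
  assumes ab: "a \<in> carrier R" "b \<in> carrier R" "a \<noteq> \<zero>" "b \<noteq> \<zero>"
  shows "(\<Sum>x\<in>carrier R. \<Sum>\<nu>\<in>carrier R. kl_term a b x \<nu>) = of_nat (order R)"
proof -
  have "(\<Sum>x\<in>carrier R. kl_term a b x \<nu>) = (if \<nu> = \<ominus> (b \<otimes> inv a) then of_nat (order R) else 0)"
    if \<nu>: "\<nu> \<in> carrier R" for \<nu>
  proof (cases "\<nu> = \<zero>")
    case True
    have "b \<otimes> inv a \<noteq> \<zero>" using ab by simp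
    then have "\<zero> \<noteq> \<ominus> (b \<otimes> inv a)" using ab by (metis a_inv_closed inv_closed' m_closed minus_minus minus_zero)
    then show ?thesis using True by (simp add: kl_term_def)
  next
    case False
    define c where "c = a \<oplus> b \<otimes> inv \<nu>"
    have c: "c \<in> carrier R" using ab \<nu> False by (simp add: c_def)
    have "kl_term a b x \<nu> = \<chi> ((c \<oplus> c) \<otimes> x)" if x: "x \<in> carrier R" for x
    proof -
      have "(a \<otimes> x \<oplus> b \<otimes> (x \<otimes> inv \<nu>)) \<oplus> (a \<otimes> x \<oplus> b \<otimes> (x \<otimes> inv \<nu>)) = (c \<oplus> c) \<otimes> x"
        unfolding c_def using ab x \<nu> inv_closed'[OF \<nu> False] by algebra
      then show ?thesis using False by (simp add: kl_term_def)
    qed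
    then have "(\<Sum>x\<in>carrier R. kl_term a b x \<nu>) = (\<Sum>x\<in>carrier R. \<chi> ((c \<oplus> c) \<otimes> x))" by simp
    also have "\<dots> = (if c = \<zero> then of_nat (order R) else 0)" using c by (simp add: sum_char_mult)
    also have "c = \<zero> \<longleftrightarrow> \<nu> = \<ominus> (b \<otimes> inv a)"
    proof -
      have i: "inv \<nu> \<in> carrier R" "inv \<nu> \<otimes> \<nu> = \<one>" "inv a \<in> carrier R" "inv a \<otimes> a = \<one>" using \<nu> False ab by auto
      have "inv a \<otimes> (c \<otimes> \<nu>) = (inv a \<otimes> a) \<otimes> \<nu> \<oplus> (inv \<nu> \<otimes> \<nu>) \<otimes> (b \<otimes> inv a)"
        unfolding c_def using ab(1,2) \<nu> i(1,3) by algebra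
      then have "inv a \<otimes> (c \<otimes> \<nu>) = \<nu> \<oplus> b \<otimes> inv a" unfolding i using ab \<nu> i by simp
      moreover have "c = \<zero> \<longleftrightarrow> inv a \<otimes> (c \<otimes> \<nu>) = \<zero>"
        using mult_eq_zero_iff[of "inv a" "c \<otimes> \<nu>"] mult_eq_zero_iff[OF c \<nu>] c \<nu> i(3) False
          inv_nonzero[OF ab(1,3)] by fast
      ultimately have "c = \<zero> \<longleftrightarrow> \<nu> \<oplus> b \<otimes> inv a = \<zero>" by (rule back_subst[of "\<lambda>t. c = \<zero> \<longleftrightarrow> t = \<zero>", rotated])
      also have "\<dots> \<longleftrightarrow> \<nu> = \<ominus> (b \<otimes> inv a)" using \<nu> ab i by (intro add_eq_zero_iff) auto
      finally show ?thesis .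
    qed
    finally show ?thesis .
  qed
  then have "(\<Sum>\<nu>\<in>carrier R. \<Sum>x\<in>carrier R. kl_term a b x \<nu>) = of_nat (order R)"
    using ab by simp
  then show ?thesis by (subst sum.swap)
qed

text \<open>This sum and the one in \<open>kloosterman_squared\<close> run over
  \<open>kl_term\<close> at x^2 - u with u = \<delta> y^2 and u = y^2 respectively. Together they
  reach each u twice, so they add up to twice \<open>sum_kl_term\<close>.\<close>

lemma kloosterman_twist:
  assumes ab: "a \<in> carrier R" "b \<in> carrier R" "a \<noteq> \<zero>" "b \<noteq> \<zero>" and \<delta>: "\<delta> \<in> carrier R" "nsqrt \<delta> = 0"
  shows "(\<Sum>(x, y)\<in>carrier R \<times> carrier R. kl_term a b x (x \<otimes> x \<ominus> \<delta> \<otimes> (y \<otimes> y))) =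
    2 * of_nat (order R) - (kloosterman R \<chi> a b)\<^sup>2"
proof -
  have d0: "\<delta> \<noteq> \<zero>" using \<delta> nsqrt_zero by auto
  let ?i = "inv \<delta>"
  have i: "?i \<in> carrier R" "?i \<noteq> \<zero>" "\<delta> \<otimes> ?i = \<one>" using \<delta> d0 by auto
  have nsq: "nsqrt u + nsqrt (?i \<otimes> u) = 2" if u: "u \<in> carrier R" for u
  proof -
    have "nsqrt (?i \<otimes> u) + nsqrt (\<delta> \<otimes> (?i \<otimes> u)) = 2" using nsqrt_nonsquare_mult[OF \<delta>] i u by simp
    moreover have "\<delta> \<otimes> (?i \<otimes> u) = u" using i u \<delta> by (simp add: m_assoc[symmetric])
    ultimately show ?thesis by simp
  qed
  have 1: "(\<Sum>y\<in>carrier R. kl_term a b x (x \<otimes> x \<ominus> \<delta> \<otimes> (y \<otimes> y))) + (\<Sum>y\<in>carrier R. kl_term a b x (x \<otimes> x \<ominus> y \<otimes> y))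
     = 2 * (\<Sum>\<nu>\<in>carrier R. kl_term a b x \<nu>)" if x: "x \<in> carrier R" for x
  proof -
    let ?g = "\<lambda>u. kl_term a b x (x \<otimes> x \<ominus> u)"
    have "(\<Sum>y\<in>carrier R. ?g (\<delta> \<otimes> (y \<otimes> y))) = (\<Sum>u\<in>carrier R. of_nat (nsqrt u) * ?g (\<delta> \<otimes> u))"
      by (rule sum_nsqrt)
    also have "\<dots> = (\<Sum>u\<in>carrier R. of_nat (nsqrt (?i \<otimes> u)) * ?g (\<delta> \<otimes> (?i \<otimes> u)))"
      using sum.reindex_bij_betw[OF bij_mult[OF i(1,2)], of "\<lambda>u. of_nat (nsqrt u) * ?g (\<delta> \<otimes> u)"] by simp
    also have "\<dots> = (\<Sum>u\<in>carrier R. of_nat (nsqrt (?i \<otimes> u)) * ?g u)"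
      by (rule sum.cong) (use i \<delta> in \<open>auto simp: m_assoc[symmetric]\<close>)
    finally have "(\<Sum>y\<in>carrier R. ?g (\<delta> \<otimes> (y \<otimes> y))) + (\<Sum>y\<in>carrier R. ?g (y \<otimes> y))
        = (\<Sum>u\<in>carrier R. of_nat (nsqrt u + nsqrt (?i \<otimes> u)) * ?g u)"
      unfolding sum_nsqrt[of ?g] by (simp add: sum.distrib[symmetric] algebra_simps)
    also have "\<dots> = 2 * (\<Sum>u\<in>carrier R. ?g u)"
      unfolding sum_distrib_left using nsq by (intro sum.cong) auto
    also have "(\<Sum>u\<in>carrier R. ?g u) = (\<Sum>\<nu>\<in>carrier R. kl_term a b x \<nu>)"
    proof (rule sum.reindex_bij_betw)
      show "bij_betw (\<lambda>u. x \<otimes> x \<ominus> u) (carrier R) (carrier R)"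
        by (rule bij_betw_byWitness[where f' = "\<lambda>u. x \<otimes> x \<ominus> u"]) (use x in \<open>auto simp: diff_diff\<close>)
    qed
    finally show ?thesis .
  qed
  have "(\<Sum>(x, y)\<in>carrier R \<times> carrier R. kl_term a b x (x \<otimes> x \<ominus> \<delta> \<otimes> (y \<otimes> y))) + (kloosterman R \<chi> a b)\<^sup>2
    = (\<Sum>x\<in>carrier R. (\<Sum>y\<in>carrier R. kl_term a b x (x \<otimes> x \<ominus> \<delta> \<otimes> (y \<otimes> y))) + (\<Sum>y\<in>carrier R. kl_term a b x (x \<otimes> x \<ominus> y \<otimes> y)))"
    unfolding kloosterman_squared[OF ab(1,2)] sum.cartesian_product[symmetric] sum.distrib ..
  also have "\<dots> = 2 * of_nat (order R)"
    using 1 sum_kl_term[OF ab] by (simp add: sum_distrib_left[symmetric])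
  finally show ?thesis by (simp add: eq_diff_eq)
qed

end

section \<open>Trace and Frobenius map of the quadratic extension\<close>

context quad_extension
begin

sublocale h: ring_hom_cring R S \<iota>
  by (intro ring_hom_cringI hom) unfold_locales

definition emb :: "'a \<Rightarrow> 'a \<Rightarrow> 'c" where
  "emb x y = \<iota> x \<oplus>\<^bsub>S\<^esub> \<iota> y \<otimes>\<^bsub>S\<^esub> \<omega>"

definition re :: "'c \<Rightarrow> 'a" where
  "re z = fst (inv_into (carrier R \<times> carrier R) (\<lambda>(x, y). emb x y) z)"

text \<open>The trace from \<open>S\<close> to \<open>R\<close>; \<open>hom_tr\<close> identifies it
  with z + z^|R|.\<close>

definition tr :: "'c \<Rightarrow> 'a" where
  "tr z = re z \<oplus> re z"

lemma bij_emb: "bij_betw (\<lambda>(x, y). emb x y) (carrier R \<times> carrier R) (carrier S)"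
  using bij unfolding emb_def .

lemma emb_closed [simp]: "x \<in> carrier R \<Longrightarrow> y \<in> carrier R \<Longrightarrow> emb x y \<in> carrier S"
  unfolding emb_def using root by simp

lemma emb_cases:
  assumes "z \<in> carrier S"
  obtains x y where "x \<in> carrier R" "y \<in> carrier R" "z = emb x y"
proof -
  have "z \<in> (\<lambda>(x, y). emb x y) ` (carrier R \<times> carrier R)"
    unfolding bij_betw_imp_surj_on[OF bij_emb] by (rule assms)
  then show thesis using that by auto
qed

lemma re_emb [simp]: "x \<in> carrier R \<Longrightarrow> y \<in> carrier R \<Longrightarrow> re (emb x y) = x"
  using bij_betw_inv_into_left[OF bij_emb, of "(x, y)"] unfolding re_def case_prod_conv by force

lemma emb_inj: "x \<in> carrier R \<Longrightarrow> y \<in> carrier R \<Longrightarrow> u \<in> carrier R \<Longrightarrow> v \<in> carrier R \<Longrightarrow>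
    emb x y = emb u v \<longleftrightarrow> x = u \<and> y = v"
  using inj_on_eq_iff[OF bij_betw_imp_inj_on[OF bij_emb], of "(x, y)" "(u, v)"] by simp

lemma emb_zero_right: "x \<in> carrier R \<Longrightarrow> emb x \<zero> = \<iota> x"
  unfolding emb_def using root by simp

lemma hom_inj: "x \<in> carrier R \<Longrightarrow> y \<in> carrier R \<Longrightarrow> \<iota> x = \<iota> y \<longleftrightarrow> x = y"
  using emb_inj[of x \<zero> y \<zero>] by (simp add: emb_zero_right)

lemma hom_nonzero: "x \<in> carrier R \<Longrightarrow> \<iota> x = \<zero>\<^bsub>S\<^esub> \<longleftrightarrow> x = \<zero>"
  using hom_inj[of x \<zero>] by simp

lemma order_S: "order S = (order R)\<^sup>2"
  using bij_betw_same_card[OF bij_emb] by (simp add: order_def card_cartesian_product power2_eq_square)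

lemma emb_add:
  assumes "x \<in> carrier R" "y \<in> carrier R" "u \<in> carrier R" "v \<in> carrier R"
  shows "emb x y \<oplus>\<^bsub>S\<^esub> emb u v = emb (x \<oplus> u) (y \<oplus> v)"
proof -
  have c: "\<iota> x \<in> carrier S" "\<iota> y \<in> carrier S" "\<iota> u \<in> carrier S" "\<iota> v \<in> carrier S" using assms by auto
  have "(\<iota> x \<oplus>\<^bsub>S\<^esub> \<iota> y \<otimes>\<^bsub>S\<^esub> \<omega>) \<oplus>\<^bsub>S\<^esub> (\<iota> u \<oplus>\<^bsub>S\<^esub> \<iota> v \<otimes>\<^bsub>S\<^esub> \<omega>) =
      (\<iota> x \<oplus>\<^bsub>S\<^esub> \<iota> u) \<oplus>\<^bsub>S\<^esub> (\<iota> y \<oplus>\<^bsub>S\<^esub> \<iota> v) \<otimes>\<^bsub>S\<^esub> \<omega>"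
    using c root(1) by algebra
  then show ?thesis unfolding emb_def using assms by simp
qed

lemma emb_mult:
  assumes "x \<in> carrier R" "y \<in> carrier R" "u \<in> carrier R" "v \<in> carrier R"
  shows "emb x y \<otimes>\<^bsub>S\<^esub> emb u v = emb (x \<otimes> u \<oplus> \<delta> \<otimes> (y \<otimes> v)) (x \<otimes> v \<oplus> y \<otimes> u)"
proof -
  have c: "\<iota> x \<in> carrier S" "\<iota> y \<in> carrier S" "\<iota> u \<in> carrier S" "\<iota> v \<in> carrier S" using assms by auto
  have "(\<iota> x \<oplus>\<^bsub>S\<^esub> \<iota> y \<otimes>\<^bsub>S\<^esub> \<omega>) \<otimes>\<^bsub>S\<^esub> (\<iota> u \<oplus>\<^bsub>S\<^esub> \<iota> v \<otimes>\<^bsub>S\<^esub> \<omega>) =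
      (\<iota> x \<otimes>\<^bsub>S\<^esub> \<iota> u \<oplus>\<^bsub>S\<^esub> (\<omega> \<otimes>\<^bsub>S\<^esub> \<omega>) \<otimes>\<^bsub>S\<^esub> (\<iota> y \<otimes>\<^bsub>S\<^esub> \<iota> v)) \<oplus>\<^bsub>S\<^esub>
      (\<iota> x \<otimes>\<^bsub>S\<^esub> \<iota> v \<oplus>\<^bsub>S\<^esub> \<iota> y \<otimes>\<^bsub>S\<^esub> \<iota> u) \<otimes>\<^bsub>S\<^esub> \<omega>"
    using c root(1) by algebra
  then show ?thesis unfolding emb_def root(2) using assms nonsquare by simp
qed

lemma tr_closed [simp]: "z \<in> carrier S \<Longrightarrow> tr z \<in> carrier R"
  by (erule emb_cases) (simp add: tr_def)

lemma tr_add: "z \<in> carrier S \<Longrightarrow> w \<in> carrier S \<Longrightarrow> tr (z \<oplus>\<^bsub>S\<^esub> w) = tr z \<oplus> tr w"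
  by (elim emb_cases) (simp add: tr_def emb_add a_ac)

text \<open>The image of \<open>R\<close> supplies the |R| fixed points required by
  \<open>power_additive\<close>.\<close>

lemma frobenius_add:
  assumes "x \<in> carrier S" "y \<in> carrier S"
  shows "(x \<oplus>\<^bsub>S\<^esub> y) [^]\<^bsub>S\<^esub> order R = x [^]\<^bsub>S\<^esub> order R \<oplus>\<^bsub>S\<^esub> y [^]\<^bsub>S\<^esub> order R"
proof (rule S.power_additive[where S = "\<iota> ` carrier R"])
  show "card (\<iota> ` carrier R) = order R"
    using hom_inj by (simp add: card_image inj_on_def order_def)
  fix c assume "c \<in> \<iota> ` carrier R"
  then obtain x where x: "x \<in> carrier R" "c = \<iota> x" by auto
  show "c [^]\<^bsub>S\<^esub> order R = c" unfolding x(2) using x(1) power_order by (simp flip: h.hom_pow)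
  have "c \<oplus>\<^bsub>S\<^esub> \<one>\<^bsub>S\<^esub> = \<iota> (x \<oplus> \<one>)" using x by simp
  moreover have "\<iota> (x \<oplus> \<one>) [^]\<^bsub>S\<^esub> order R = \<iota> (x \<oplus> \<one>)"
    using x(1) power_order[of "x \<oplus> \<one>"] h.hom_pow[of "x \<oplus> \<one>" "order R"] by simp
  ultimately show "(c \<oplus>\<^bsub>S\<^esub> \<one>\<^bsub>S\<^esub>) [^]\<^bsub>S\<^esub> order R = c \<oplus>\<^bsub>S\<^esub> \<one>\<^bsub>S\<^esub>" by simp
qed (use assms order_pos in auto)

lemma hom_power_order: "x \<in> carrier R \<Longrightarrow> \<iota> x [^]\<^bsub>S\<^esub> order R = \<iota> x"
  using h.hom_pow[of x "order R"] power_order[of x] by simp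

text \<open>\<open>\<omega>^|R|\<close> is a square root of \<open>\<delta>\<close>; it cannot be \<open>\<omega>\<close>, as \<open>z^|R| = z\<close> has at most \<open>|R|\<close> solutions.\<close>

lemma power_root: "\<omega> [^]\<^bsub>S\<^esub> order R = \<ominus>\<^bsub>S\<^esub> \<omega>"
proof -
  let ?Q = "order R"
  have "\<omega> [^]\<^bsub>S\<^esub> ?Q \<otimes>\<^bsub>S\<^esub> \<omega> [^]\<^bsub>S\<^esub> ?Q = (\<omega> \<otimes>\<^bsub>S\<^esub> \<omega>) [^]\<^bsub>S\<^esub> ?Q"
    using root(1) by (simp add: S.nat_pow_distrib)
  also have "\<dots> = \<omega> \<otimes>\<^bsub>S\<^esub> \<omega>" unfolding root(2) using nonsquare by (simp add: hom_power_order)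
  finally have "\<omega> [^]\<^bsub>S\<^esub> ?Q = \<omega> \<or> \<omega> [^]\<^bsub>S\<^esub> ?Q = \<ominus>\<^bsub>S\<^esub> \<omega>"
    using S.square_eq_iff root(1) by simp
  moreover have "\<omega> [^]\<^bsub>S\<^esub> ?Q \<noteq> \<omega>"
  proof
    assume w: "\<omega> [^]\<^bsub>S\<^esub> ?Q = \<omega>"
    have fixed: "z [^]\<^bsub>S\<^esub> ?Q = z" if z: "z \<in> carrier S" for z
    proof -
      obtain x y where xy: "x \<in> carrier R" "y \<in> carrier R" "z = emb x y" by (rule emb_cases[OF z])
      then show ?thesis using root(1)
        by (simp add: emb_def frobenius_add S.nat_pow_distrib hom_power_order w)
    qed
    have "{\<zero>, \<one>} \<subseteq> carrier R" by simp
    then have "card {\<zero>, \<one>} \<le> ?Q" unfolding order_def by (intro card_mono) auto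
    then have Q: "1 < ?Q" by simp
    have x: "S.poly_le 1 (\<lambda>z. \<ominus>\<^bsub>S\<^esub> z)"
      by (rule S.poly_le_minus, rule S.poly_le_cong[OF S.poly_le_power]) auto
    have "S.poly_eq ?Q (\<lambda>z. z [^]\<^bsub>S\<^esub> ?Q \<oplus>\<^bsub>S\<^esub> \<ominus>\<^bsub>S\<^esub> z)"
      by (rule S.poly_eq_add_le[OF S.poly_eq_power x Q])
    then have "card {z \<in> carrier S. z [^]\<^bsub>S\<^esub> ?Q \<oplus>\<^bsub>S\<^esub> \<ominus>\<^bsub>S\<^esub> z = \<zero>\<^bsub>S\<^esub>} \<le> ?Q" by (rule S.poly_eq_roots)
    moreover have "{z \<in> carrier S. z [^]\<^bsub>S\<^esub> ?Q \<oplus>\<^bsub>S\<^esub> \<ominus>\<^bsub>S\<^esub> z = \<zero>\<^bsub>S\<^esub>} = carrier S"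
      using fixed by (auto simp: S.r_neg)
    ultimately have "?Q\<^sup>2 \<le> ?Q" using order_S by (simp add: order_def)
    then show False using Q by (simp add: power2_eq_square)
  qed
  ultimately show ?thesis by blast
qed

text \<open>The |R|-th power acts as conjugation, taking x + y \<omega> to x - y \<omega>. In this
  form the trace can be composed with traces given by sums of powers.\<close>

lemma hom_tr:
  assumes z: "z \<in> carrier S"
  shows "\<iota> (tr z) = z \<oplus>\<^bsub>S\<^esub> z [^]\<^bsub>S\<^esub> order R"
proof -
  obtain x y where xy: "x \<in> carrier R" "y \<in> carrier R" "z = emb x y" by (rule emb_cases[OF z])
  have c: "\<iota> x \<in> carrier S" "\<iota> y \<in> carrier S" using xy by auto
  have "z [^]\<^bsub>S\<^esub> order R = \<iota> x \<oplus>\<^bsub>S\<^esub> \<iota> y \<otimes>\<^bsub>S\<^esub> \<ominus>\<^bsub>S\<^esub> \<omega>"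
    using xy root(1) by (simp add: emb_def frobenius_add S.nat_pow_distrib hom_power_order power_root)
  then have "z \<oplus>\<^bsub>S\<^esub> z [^]\<^bsub>S\<^esub> order R = (\<iota> x \<oplus>\<^bsub>S\<^esub> \<iota> y \<otimes>\<^bsub>S\<^esub> \<omega>) \<oplus>\<^bsub>S\<^esub> (\<iota> x \<oplus>\<^bsub>S\<^esub> \<iota> y \<otimes>\<^bsub>S\<^esub> \<ominus>\<^bsub>S\<^esub> \<omega>)"
    using xy by (simp add: emb_def)
  also have "\<dots> = \<iota> x \<oplus>\<^bsub>S\<^esub> \<iota> x" using c root(1) by algebra
  also have "\<dots> = \<iota> (tr z)" using xy by (simp add: tr_def)
  finally show ?thesis by simp
qed

lemma inv_emb:
  assumes xy: "x \<in> carrier R" "y \<in> carrier R" and N: "N = x \<otimes> x \<ominus> \<delta> \<otimes> (y \<otimes> y)" "N \<noteq> \<zero>"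
  shows "inv\<^bsub>S\<^esub> (emb x y) = emb (x \<otimes> inv N) (\<ominus> (y \<otimes> inv N))"
proof (rule S.inv_eqI)
  have Nc: "N \<in> carrier R" using xy nonsquare by (simp add: N)
  then have i: "inv N \<in> carrier R" using N by simp
  have "x \<otimes> (x \<otimes> inv N) \<oplus> \<delta> \<otimes> (y \<otimes> (\<ominus> (y \<otimes> inv N))) = (x \<otimes> x \<ominus> \<delta> \<otimes> (y \<otimes> y)) \<otimes> inv N"
    using xy nonsquare(1) i by algebra
  then have 1: "x \<otimes> (x \<otimes> inv N) \<oplus> \<delta> \<otimes> (y \<otimes> (\<ominus> (y \<otimes> inv N))) = \<one>" using N Nc by simp
  have 2: "x \<otimes> (\<ominus> (y \<otimes> inv N)) \<oplus> y \<otimes> (x \<otimes> inv N) = \<zero>" using xy i by algebra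
  show "emb x y \<otimes>\<^bsub>S\<^esub> emb (x \<otimes> inv N) (\<ominus> (y \<otimes> inv N)) = \<one>\<^bsub>S\<^esub>"
    using xy i by (simp add: emb_mult 1 2 emb_zero_right)
  show "emb x y \<in> carrier S" "emb (x \<otimes> inv N) (\<ominus> (y \<otimes> inv N)) \<in> carrier S" using xy i by auto
qed

end

locale quad_extension_character = quad_extension R S \<iota> \<delta> \<omega> + odd_field_character R \<chi>
  for R (structure) and S and \<iota> :: "'a \<Rightarrow> 'c" and \<delta> \<omega> and \<chi>
begin

lemma character_tr: "nontrivial_additive_character S (\<lambda>z. \<chi> (tr z))"
proof -
  obtain c where c: "c \<in> carrier R" "\<chi> c \<noteq> 1"
    using character unfolding nontrivial_additive_character_def by blast
  have "tr (emb (half c) \<zero>) = c" using c by (simp add: tr_def)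
  then have "\<exists>z\<in>carrier S. \<chi> (tr z) \<noteq> 1" using c by (intro bexI[of _ "emb (half c) \<zero>"]) auto
  then show ?thesis unfolding nontrivial_additive_character_def
    by (simp add: norm_char tr_add char_add)
qed

text \<open>The trace removes the second coordinate: the exponent at x + y \<omega> becomes 2 (a x +
  b x / N) with the norm N = x^2 - \<delta> y^2, which is the summand of
  \<open>kloosterman_twist\<close>.\<close>

lemma kloosterman_tr:
  assumes ab: "a \<in> carrier R" "b \<in> carrier R" "a \<noteq> \<zero>" "b \<noteq> \<zero>"
  shows "kloosterman S (\<lambda>z. \<chi> (tr z)) (\<iota> a) (\<iota> b) = 2 * of_nat (order R) - (kloosterman R \<chi> a b)\<^sup>2"
proof -
  let ?f = "\<lambda>z. if z = \<zero>\<^bsub>S\<^esub> then 0 else \<chi> (tr (\<iota> a \<otimes>\<^bsub>S\<^esub> z \<oplus>\<^bsub>S\<^esub> \<iota> b \<otimes>\<^bsub>S\<^esub> inv\<^bsub>S\<^esub> z))"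
  have "kloosterman S (\<lambda>z. \<chi> (tr z)) (\<iota> a) (\<iota> b) = (\<Sum>z\<in>carrier S. ?f z)"
    unfolding kloosterman_def by (rule sum.mono_neutral_cong_left) auto
  also have "\<dots> = (\<Sum>(x, y)\<in>carrier R \<times> carrier R. ?f (emb x y))"
    by (subst sum.reindex_bij_betw[OF bij_emb, symmetric]) (rule sum.cong, auto)
  also have "\<dots> = (\<Sum>(x, y)\<in>carrier R \<times> carrier R. kl_term a b x (x \<otimes> x \<ominus> \<delta> \<otimes> (y \<otimes> y)))"
  proof (rule sum.cong[OF refl], clarify)
    fix x y assume xy: "x \<in> carrier R" "y \<in> carrier R"
    define N where "N = x \<otimes> x \<ominus> \<delta> \<otimes> (y \<otimes> y)"
    have Nc: "N \<in> carrier R" using xy nonsquare by (simp add: N_def)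
    have z: "emb x y = \<zero>\<^bsub>S\<^esub> \<longleftrightarrow> x = \<zero> \<and> y = \<zero>"
      using emb_inj[of x y \<zero> \<zero>] emb_zero_right[of \<zero>] xy by simp
    show "?f (emb x y) = kl_term a b x (x \<otimes> x \<ominus> \<delta> \<otimes> (y \<otimes> y))"
    proof (cases "x = \<zero> \<and> y = \<zero>")
      case True
      then show ?thesis using nonsquare z by (simp add: kl_term_def minus_eq)
    next
      case False
      then have N0: "N \<noteq> \<zero>" unfolding N_def using norm_form_nonzero[OF nonsquare xy] by blast
      then have i: "inv N \<in> carrier R" using Nc by simp
      have "\<iota> a \<otimes>\<^bsub>S\<^esub> emb x y \<oplus>\<^bsub>S\<^esub> \<iota> b \<otimes>\<^bsub>S\<^esub> inv\<^bsub>S\<^esub> (emb x y) =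
          emb (a \<otimes> x \<oplus> b \<otimes> (x \<otimes> inv N)) (a \<otimes> y \<oplus> b \<otimes> (\<ominus> (y \<otimes> inv N)))"
        unfolding inv_emb[OF xy N_def N0] using ab xy i nonsquare
        by (simp add: emb_zero_right[symmetric] emb_mult emb_add)
      then have "tr (\<iota> a \<otimes>\<^bsub>S\<^esub> emb x y \<oplus>\<^bsub>S\<^esub> \<iota> b \<otimes>\<^bsub>S\<^esub> inv\<^bsub>S\<^esub> (emb x y)) =
          (a \<otimes> x \<oplus> b \<otimes> (x \<otimes> inv N)) \<oplus> (a \<otimes> x \<oplus> b \<otimes> (x \<otimes> inv N))"
        using ab xy i by (simp add: tr_def)
      moreover have "emb x y \<noteq> \<zero>\<^bsub>S\<^esub>" using False z by blast
      ultimately show ?thesis using N0 unfolding N_def[symmetric] by (simp add: kl_term_def)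
    qed
  qed
  also have "\<dots> = 2 * of_nat (order R) - (kloosterman R \<chi> a b)\<^sup>2"
    by (rule kloosterman_twist[OF ab nonsquare])
  finally show ?thesis .
qed

end

text \<open>A field with \<open>q^n\<close> elements over its subfield with \<open>q\<close> elements, together with a character
  that factors through the trace to the subfield.\<close>

locale frobenius_field = odd_field_character R \<chi> for R (structure) and \<chi> +
  fixes q n :: nat and a b
  assumes order_eq: "order R = q ^ n" and n_pos: "0 < n"
    and card_fixed: "card {x \<in> carrier R. x [^] q = x} = q"
    and fixed_add_one: "\<And>x. x \<in> carrier R \<Longrightarrow> x [^] q = x \<Longrightarrow> (x \<oplus> \<one>) [^] q = x \<oplus> \<one>"
    and coeffs: "a \<in> carrier R" "b \<in> carrier R" "a \<noteq> \<zero>" "b \<noteq> \<zero>" "a [^] q = a" "b [^] q = b"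
    and char_trace: "\<And>z w. z \<in> carrier R \<Longrightarrow> w \<in> carrier R \<Longrightarrow>
      (\<Oplus>l\<in>{..<n}. z [^] (q ^ l)) = (\<Oplus>l\<in>{..<n}. w [^] (q ^ l)) \<Longrightarrow> \<chi> z = \<chi> w"
begin

lemma q_ge: "3 \<le> q"
proof -
  have "card {\<zero>, \<one>} \<le> order R" unfolding order_def by (intro card_mono) auto
  then have "2 \<le> q ^ n" by (simp add: order_eq)
  then have "q \<noteq> 0" "q \<noteq> 1" using n_pos power_0_left[of n, where ?'a = nat] power_one[of n, where ?'a = nat]
    by (intro notI; simp)+
  moreover have "odd q" using odd_order n_pos by (simp add: order_eq)
  ultimately show ?thesis by (cases "q = 2") auto
qed

lemma frob_add: "x \<in> carrier R \<Longrightarrow> y \<in> carrier R \<Longrightarrow> (x \<oplus> y) [^] q = x [^] q \<oplus> y [^] q"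
  by (rule power_additive[where S = "{x \<in> carrier R. x [^] q = x}"])
     (use card_fixed fixed_add_one q_ge in auto)

lemma frob_pow_add:
  "x \<in> carrier R \<Longrightarrow> y \<in> carrier R \<Longrightarrow> (x \<oplus> y) [^] (q ^ m) = x [^] (q ^ m) \<oplus> y [^] (q ^ m)"
  by (induction m) (simp_all add: power_Suc2 frob_add flip: nat_pow_pow del: power_Suc)

lemma frob_pow_sum:
  assumes "finite A" "f \<in> A \<rightarrow> carrier R"
  shows "(\<Oplus>i\<in>A. f i) [^] (q ^ m) = (\<Oplus>i\<in>A. f i [^] (q ^ m))"
  using assms
proof (induction A)
  case empty
  have "q ^ m \<noteq> 0" using q_ge by simp
  then show ?case by (simp add: nat_pow_zero)
next
  case (insert i A)
  then show ?case by (simp add: frob_pow_add Pi_def)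
qed

definition trace :: "'a \<Rightarrow> 'a" where
  "trace z = (\<Oplus>l\<in>{..<n}. z [^] (q ^ l))"

lemma trace_closed [simp]: "z \<in> carrier R \<Longrightarrow> trace z \<in> carrier R"
  unfolding trace_def by (intro finsum_closed) auto

lemma trace_add: "z \<in> carrier R \<Longrightarrow> w \<in> carrier R \<Longrightarrow> trace (z \<oplus> w) = trace z \<oplus> trace w"
  unfolding trace_def by (simp add: frob_pow_add finsum_addf Pi_def)

lemma fixed_pow: "x \<in> carrier R \<Longrightarrow> x [^] q = x \<Longrightarrow> x [^] (q ^ m) = x"
  by (induction m) (simp_all add: power_Suc2 flip: nat_pow_pow del: power_Suc)

text \<open>The new character is \<open>\<chi>\<close> composed with the trace. The order
  \<open>q\<close> of the bottom field stays fixed while \<open>n\<close> doubles, so that a bound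
  in terms of \<open>q\<close> alone is uniform along the tower.\<close>

theorem quadratic_step:
  "\<exists>(S :: nat ring) \<psi> a' b'. frobenius_field S \<psi> q (2 * n) a' b' \<and>
     kloosterman S \<psi> a' b' = 2 * of_nat (order R) - (kloosterman R \<chi> a b)\<^sup>2"
proof -
  obtain S :: "nat ring" and \<iota> \<delta> \<omega> where "quad_extension R S \<iota> \<delta> \<omega>" using quad_extension_exists by blast
  then interpret E: quad_extension R S \<iota> \<delta> \<omega> .
  interpret E: quad_extension_character R S \<iota> \<delta> \<omega> \<chi> by unfold_locales
  let ?F = "{x \<in> carrier S. x [^]\<^bsub>S\<^esub> q = x}" and ?I = "\<iota> ` {x \<in> carrier R. x [^] q = x}"
  have I: "?I \<subseteq> ?F" using E.h.hom_pow by (auto simp flip: E.h.hom_pow)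
  have cI: "card ?I = q" using E.hom_inj card_fixed by (subst card_image) (auto intro!: inj_onI)
  have add: "(x \<oplus>\<^bsub>S\<^esub> y) [^]\<^bsub>S\<^esub> q = x [^]\<^bsub>S\<^esub> q \<oplus>\<^bsub>S\<^esub> y [^]\<^bsub>S\<^esub> q" if "x \<in> carrier S" "y \<in> carrier S" for x y
  proof (rule E.S.power_additive[where S = ?I])
    fix c assume "c \<in> ?I"
    then obtain x where x: "x \<in> carrier R" "x [^] q = x" "c = \<iota> x" by auto
    show "c [^]\<^bsub>S\<^esub> q = c" using I \<open>c \<in> ?I\<close> by blast
    have "c \<oplus>\<^bsub>S\<^esub> \<one>\<^bsub>S\<^esub> = \<iota> (x \<oplus> \<one>)" using x by simp
    moreover have "\<iota> (x \<oplus> \<one>) [^]\<^bsub>S\<^esub> q = \<iota> (x \<oplus> \<one>)"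
      using x fixed_add_one[of x] E.h.hom_pow[of "x \<oplus> \<one>" q] by simp
    ultimately show "(c \<oplus>\<^bsub>S\<^esub> \<one>\<^bsub>S\<^esub>) [^]\<^bsub>S\<^esub> q = c \<oplus>\<^bsub>S\<^esub> \<one>\<^bsub>S\<^esub>" by simp
  qed (use I cI q_ge that in auto)
  have add_pow: "(x \<oplus>\<^bsub>S\<^esub> y) [^]\<^bsub>S\<^esub> (q ^ m) = x [^]\<^bsub>S\<^esub> (q ^ m) \<oplus>\<^bsub>S\<^esub> y [^]\<^bsub>S\<^esub> (q ^ m)"
    if "x \<in> carrier S" "y \<in> carrier S" for x y m
    using that by (induction m) (simp_all add: power_Suc2 add flip: E.S.nat_pow_pow del: power_Suc)
  \<comment> \<open>The image of the fixed points of \<open>R\<close> gives \<open>q\<close> fixed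
    points; there are no more, as z^q - z has degree \<open>q\<close>.\<close>
  have "E.S.poly_eq q (\<lambda>z. z [^]\<^bsub>S\<^esub> q \<oplus>\<^bsub>S\<^esub> \<ominus>\<^bsub>S\<^esub> z)"
    by (rule E.S.poly_eq_add_le[OF E.S.poly_eq_power, of 1], rule E.S.poly_le_minus,
        rule E.S.poly_le_cong[OF E.S.poly_le_power]) (use q_ge in auto)
  then have "card {z \<in> carrier S. z [^]\<^bsub>S\<^esub> q \<oplus>\<^bsub>S\<^esub> \<ominus>\<^bsub>S\<^esub> z = \<zero>\<^bsub>S\<^esub>} \<le> q" by (rule E.S.poly_eq_roots)
  moreover have "?F \<subseteq> {z \<in> carrier S. z [^]\<^bsub>S\<^esub> q \<oplus>\<^bsub>S\<^esub> \<ominus>\<^bsub>S\<^esub> z = \<zero>\<^bsub>S\<^esub>}" by (auto simp: E.S.r_neg)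
  then have "card ?F \<le> card {z \<in> carrier S. z [^]\<^bsub>S\<^esub> q \<oplus>\<^bsub>S\<^esub> \<ominus>\<^bsub>S\<^esub> z = \<zero>\<^bsub>S\<^esub>}" by (intro card_mono) auto
  moreover have "q \<le> card ?F" using card_mono[OF _ I] cI by simp
  ultimately have cF: "card ?F = q" by simp
  \<comment> \<open>Transitivity of the trace: exponents l and l + n are paired, and z^(q^l) +
    z^(q^(l+n)) is the q^l-th power of z + z^|R|.\<close>
  have trace_S: "(\<Oplus>\<^bsub>S\<^esub>l\<in>{..<2 * n}. z [^]\<^bsub>S\<^esub> (q ^ l)) = \<iota> (trace (E.tr z))" if z: "z \<in> carrier S" for z
  proof -
    have "(\<Oplus>\<^bsub>S\<^esub>l\<in>{..<2 * n}. z [^]\<^bsub>S\<^esub> (q ^ l)) = (\<Oplus>\<^bsub>S\<^esub>l\<in>{..<n} \<union> {n..<2 * n}. z [^]\<^bsub>S\<^esub> (q ^ l))"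
      by (rule arg_cong[where f = "finsum S _"]) auto
    also have "\<dots> = (\<Oplus>\<^bsub>S\<^esub>l\<in>{..<n}. z [^]\<^bsub>S\<^esub> (q ^ l)) \<oplus>\<^bsub>S\<^esub> (\<Oplus>\<^bsub>S\<^esub>l\<in>{n..<2 * n}. z [^]\<^bsub>S\<^esub> (q ^ l))"
      using z by (intro E.S.finsum_Un_disjoint) auto
    also have "{n..<2 * n} = (\<lambda>l. l + n) ` {..<n}"
      using image_add_atLeastLessThan'[of n 0 n] by (simp add: lessThan_atLeast0 mult_2)
    also have "(\<Oplus>\<^bsub>S\<^esub>l\<in>(\<lambda>l. l + n) ` {..<n}. z [^]\<^bsub>S\<^esub> (q ^ l)) = (\<Oplus>\<^bsub>S\<^esub>l\<in>{..<n}. z [^]\<^bsub>S\<^esub> (q ^ (l + n)))"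
      using z by (intro E.S.finsum_reindex) auto
    also have "(\<Oplus>\<^bsub>S\<^esub>l\<in>{..<n}. z [^]\<^bsub>S\<^esub> (q ^ l)) \<oplus>\<^bsub>S\<^esub> \<dots> =
        (\<Oplus>\<^bsub>S\<^esub>l\<in>{..<n}. z [^]\<^bsub>S\<^esub> (q ^ l) \<oplus>\<^bsub>S\<^esub> z [^]\<^bsub>S\<^esub> (q ^ (l + n)))"
      using z by (intro E.S.finsum_addf[symmetric]) auto
    also have "\<dots> = (\<Oplus>\<^bsub>S\<^esub>l\<in>{..<n}. \<iota> (E.tr z [^] (q ^ l)))"
    proof (rule E.S.finsum_cong'[OF refl])
      show "(\<lambda>l. \<iota> (E.tr z [^] (q ^ l))) \<in> {..<n} \<rightarrow> carrier S" using z by simp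
      fix l assume "l \<in> {..<n}"
      have "z [^]\<^bsub>S\<^esub> (q ^ (l + n)) = (z [^]\<^bsub>S\<^esub> order R) [^]\<^bsub>S\<^esub> (q ^ l)"
        using z by (simp add: order_eq E.S.nat_pow_pow power_add mult.commute)
      then have "z [^]\<^bsub>S\<^esub> (q ^ l) \<oplus>\<^bsub>S\<^esub> z [^]\<^bsub>S\<^esub> (q ^ (l + n)) = \<iota> (E.tr z) [^]\<^bsub>S\<^esub> (q ^ l)"
        unfolding E.hom_tr[OF z] using z by (simp add: add_pow)
      then show "z [^]\<^bsub>S\<^esub> (q ^ l) \<oplus>\<^bsub>S\<^esub> z [^]\<^bsub>S\<^esub> (q ^ (l + n)) = \<iota> (E.tr z [^] (q ^ l))"
        using z by simp
    qed
    also have "\<dots> = \<iota> (trace (E.tr z))" unfolding trace_def using z by (simp add: o_def Pi_def)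
    finally show ?thesis .
  qed
  have "frobenius_field S (\<lambda>z. \<chi> (E.tr z)) q (2 * n) (\<iota> a) (\<iota> b)"
  proof (intro frobenius_field.intro odd_field_character.intro odd_finite_field.intro
      odd_finite_field_axioms.intro field_character.intro field_character_axioms.intro
      frobenius_field_axioms.intro E.S.finite_field_axioms E.character_tr)
    show "odd (order S)" using odd_order by (simp add: E.order_S)
    show "order S = q ^ (2 * n)" by (simp add: E.order_S order_eq power_mult mult.commute)
    show "0 < 2 * n" using n_pos by simp
    show "card ?F = q" by (rule cF)
    show "(x \<oplus>\<^bsub>S\<^esub> \<one>\<^bsub>S\<^esub>) [^]\<^bsub>S\<^esub> q = x \<oplus>\<^bsub>S\<^esub> \<one>\<^bsub>S\<^esub>" if "x \<in> carrier S" "x [^]\<^bsub>S\<^esub> q = x" for x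
      using that by (simp add: add)
    show "\<iota> a [^]\<^bsub>S\<^esub> q = \<iota> a" "\<iota> b [^]\<^bsub>S\<^esub> q = \<iota> b" using coeffs by (simp_all flip: E.h.hom_pow)
    show "\<iota> a \<noteq> \<zero>\<^bsub>S\<^esub>" "\<iota> b \<noteq> \<zero>\<^bsub>S\<^esub>" using coeffs E.hom_nonzero by auto
    fix z w assume zw: "z \<in> carrier S" "w \<in> carrier S"
      and "(\<Oplus>\<^bsub>S\<^esub>l\<in>{..<2 * n}. z [^]\<^bsub>S\<^esub> (q ^ l)) = (\<Oplus>\<^bsub>S\<^esub>l\<in>{..<2 * n}. w [^]\<^bsub>S\<^esub> (q ^ l))"
    then have "trace (E.tr z) = trace (E.tr w)" using E.hom_inj by (simp add: trace_S)
    then show "\<chi> (E.tr z) = \<chi> (E.tr w)" using char_trace zw unfolding trace_def by simp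
  qed (use coeffs in auto)
  moreover have "kloosterman S (\<lambda>z. \<chi> (E.tr z)) (\<iota> a) (\<iota> b) = 2 * of_nat (order R) - (kloosterman R \<chi> a b)\<^sup>2"
    using coeffs by (intro E.kloosterman_tr) auto
  ultimately show ?thesis by blast
qed

end

section \<open>Stepanov's method\<close>

context finite_field
begin

interpretation UP: UP_domain R "UP R" by unfold_locales simp

lemma poly_le_coeffs:
  assumes "poly_le n g"
  shows "\<exists>d\<in>{..n} \<rightarrow>\<^sub>E carrier R. \<forall>x\<in>carrier R. g x = (\<Oplus>i\<in>{..n}. d i \<otimes> x [^] i)"
proof -
  from assms obtain p where p: "p \<in> carrier (UP R)" "deg R p \<le> n"
    "\<forall>x\<in>carrier R. g x = UnivPoly.eval R R id x p" unfolding poly_le_def by blast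
  let ?d = "restrict (UnivPoly.coeff (UP R) p) {..n}"
  show ?thesis
  proof (intro bexI[of _ ?d] ballI)
    show "?d \<in> {..n} \<rightarrow>\<^sub>E carrier R" using p by auto
    fix x assume x: "x \<in> carrier R"
    have "g x = (\<Oplus>i\<in>{..deg R p}. UnivPoly.coeff (UP R) p i \<otimes> x [^] i)"
      using p x by (simp add: UP.eval_on_carrier)
    also have "\<dots> = (\<Oplus>i\<in>{..n}. ?d i \<otimes> x [^] i)"
      using p x UP.deg_aboveD[OF _ p(1)]
      by (intro add.finprod_mono_neutral_cong_left) (auto simp: Pi_def)
    finally show "g x = (\<Oplus>i\<in>{..n}. ?d i \<otimes> x [^] i)" .
  qed
qed

text \<open>The target count for the pigeonhole argument in \<open>card_Z\<close>, which takes the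
  place of a comparison of dimensions.\<close>

lemma card_poly_le:
  shows "finite {restrict g (carrier R) | g. poly_le n g}" (is "finite ?A")
    and "card {restrict g (carrier R) | g. poly_le n g} \<le> order R ^ Suc n"
proof -
  let ?C = "{..n} \<rightarrow>\<^sub>E carrier R" and ?F = "\<lambda>d. restrict (\<lambda>x. \<Oplus>i\<in>{..n}. d i \<otimes> x [^] i) (carrier R)"
  have sub: "?A \<subseteq> ?F ` ?C"
  proof
    fix f assume "f \<in> ?A"
    then obtain g where g: "f = restrict g (carrier R)" "poly_le n g" by auto
    obtain d where d: "d \<in> ?C" "\<forall>x\<in>carrier R. g x = (\<Oplus>i\<in>{..n}. d i \<otimes> x [^] i)"
      using poly_le_coeffs[OF g(2)] by auto
    have "f = ?F d" unfolding g(1) using d(2) by (intro restrict_ext) auto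
    then show "f \<in> ?F ` ?C" using d(1) by blast
  qed
  have fin: "finite ?C" by (intro finite_PiE) auto
  show "finite ?A" by (rule finite_subset[OF sub]) (use fin in simp)
  have "card ?A \<le> card (?F ` ?C)" by (rule card_mono[OF _ sub]) (use fin in simp)
  also have "\<dots> \<le> card ?C" by (rule card_image_le[OF fin])
  also have "\<dots> = order R ^ Suc n" by (simp add: card_PiE order_def)
  finally show "card ?A \<le> order R ^ Suc n" .
qed

lemma pow_nonzero: "x \<in> carrier R \<Longrightarrow> x \<noteq> \<zero> \<Longrightarrow> x [^] (k::nat) \<noteq> \<zero>"
  by (induction k) auto

lemma pow_inv_cancel:
  assumes "x \<in> carrier R" "x \<noteq> \<zero>" "k \<le> m"
  shows "x [^] m \<otimes> (inv x) [^] (k::nat) = x [^] (m - k)"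
proof -
  have "x [^] m \<otimes> (inv x) [^] k = x [^] (m - k) \<otimes> (x [^] k \<otimes> (inv x) [^] k)"
    using assms by (simp add: nat_pow_mult flip: m_assoc)
  also have "x [^] k \<otimes> (inv x) [^] k = \<one>"
    using assms by (simp flip: nat_pow_distrib)
  finally show ?thesis using assms by simp
qed

end

text \<open>Stepanov's method for the equation \<open>Tr (a x + b / x) = u\<close>. With \<open>r\<^sup>2 = |R|\<close> and \<open>T\<close> the lower
  half of the trace, the equation reads \<open>T x + (T x)^r = u\<close>. The functions \<open>\<phi> e\<close>,
  indexed by \<open>e = i + m (l + q j)\<close> with \<open>i < m\<close> and \<open>l < q\<close>, are \<open>x^(i + r j) (T x)^l\<close>, multiplied
  by a power of \<open>x\<close> to clear the denominators; this makes their degrees distinct. On the solutions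
  \<open>x^(r r) = x\<close>, so their \<open>r\<close>-th powers agree with the functions \<open>\<theta> e\<close>, \<open>x^(r i + j) (u - T x)^l\<close>,
  which span a space of smaller dimension: \<open>J\<close> is chosen so that \<open>r m + J + r + 1 < r J\<close>.\<close>

locale stepanov = frobenius_field R \<chi> q n a b for R (structure) and \<chi> and q n :: nat and a b +
  fixes h :: nat and u
  assumes n_eq: "n = 2 * h" and u: "u \<in> carrier R"
begin

definition m :: nat where "m = q ^ (h - 1)"
definition r :: nat where "r = q ^ h"
definition J :: nat where "J = m + 3"

lemma h_pos: "0 < h" using n_pos n_eq by simp
lemma r_eq: "r = q * m" unfolding r_def m_def using h_pos by (cases h) auto
lemma m_pos: "0 < m" unfolding m_def using q_ge by simp
lemma order_r: "order R = r * r" by (simp add: order_eq n_eq r_def mult_2 power_add)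
lemma m_le: "l < h \<Longrightarrow> q ^ l \<le> m" unfolding m_def using q_ge by (intro power_increasing) auto
lemma m_less: "l < h - 1 \<Longrightarrow> q ^ l < m" unfolding m_def using q_ge by (intro power_strict_increasing) auto

lemma pow_rr: "x \<in> carrier R \<Longrightarrow> (x [^] r) [^] r = x"
  using power_order[of x] by (simp add: order_r nat_pow_pow)

definition f :: "'a \<Rightarrow> 'a" where "f x = a \<otimes> x \<oplus> b \<otimes> inv x"
definition T :: "'a \<Rightarrow> 'a" where "T x = (\<Oplus>l\<in>{..<h}. f x [^] (q ^ l))"
text \<open>The polynomial that equals x^m T x off 0. The factor x^m clears all denominators since
  q^l <= m for l < h, and \<open>a\<close>, \<open>b\<close> keep their place because they are fixed
  by the q-th power.\<close>

definition Y :: "'a \<Rightarrow> 'a" where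
  "Y x = (\<Oplus>l\<in>{..<h}. a \<otimes> x [^] (m + q ^ l) \<oplus> b \<otimes> x [^] (m - q ^ l))"
text \<open>The digit l of e = i + m (l + q j); the other two are \<open>e mod m\<close> and
  \<open>e div r\<close>.\<close>

definition ll :: "nat \<Rightarrow> nat" where "ll e = (e div m) mod q"
text \<open>For \<open>x\<close> nonzero the last two factors amount to x^(m (q-1)) (T x)^l. The
  clearing power is thus the same for every \<open>e\<close>, and it can be cancelled at the
  end.\<close>

definition \<phi> :: "nat \<Rightarrow> 'a \<Rightarrow> 'a" where
  "\<phi> e x = x [^] (e mod m + r * (e div r)) \<otimes> x [^] (m * (q - 1 - ll e)) \<otimes> Y x [^] ll e"
definition \<theta> :: "nat \<Rightarrow> 'a \<Rightarrow> 'a" where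
  "\<theta> e x = x [^] (r * (e mod m) + e div r) \<otimes> x [^] (m * (q - 1 - ll e)) \<otimes> (u \<otimes> x [^] m \<ominus> Y x) [^] ll e"
definition Z :: "'a set" where
  "Z = {x \<in> carrier R - {\<zero>}. trace (f x) = u}"

lemma f_closed [simp]: "x \<in> carrier R \<Longrightarrow> x \<noteq> \<zero> \<Longrightarrow> f x \<in> carrier R"
  unfolding f_def using coeffs by simp

lemma T_closed [simp]: "x \<in> carrier R \<Longrightarrow> x \<noteq> \<zero> \<Longrightarrow> T x \<in> carrier R"
  unfolding T_def by (intro finsum_closed) auto

lemma Y_closed [simp]: "x \<in> carrier R \<Longrightarrow> Y x \<in> carrier R"
  unfolding Y_def using coeffs by (intro finsum_closed) auto

lemma ll_less: "ll e < q" unfolding ll_def using q_ge by simp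

text \<open>Raising the lower half of the trace to the power r = q^h yields the upper half.\<close>

lemma trace_f:
  assumes x: "x \<in> carrier R" "x \<noteq> \<zero>"
  shows "trace (f x) = T x \<oplus> T x [^] r"
proof -
  have "{..<n} = {..<h} \<union> {h..<2 * h}" using n_eq by auto
  then have "trace (f x) = (\<Oplus>l\<in>{..<h} \<union> {h..<2 * h}. f x [^] (q ^ l))"
    unfolding trace_def by simp
  also have "\<dots> = T x \<oplus> (\<Oplus>l\<in>{h..<2 * h}. f x [^] (q ^ l))"
    unfolding T_def using x by (intro finsum_Un_disjoint) auto
  also have "{h..<2 * h} = (\<lambda>l. l + h) ` {..<h}"
    using image_add_atLeastLessThan'[of h 0 h] by (simp add: lessThan_atLeast0 mult_2)
  also have "(\<Oplus>l\<in>(\<lambda>l. l + h) ` {..<h}. f x [^] (q ^ l)) = (\<Oplus>l\<in>{..<h}. f x [^] (q ^ (l + h)))"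
    using x by (intro finsum_reindex) auto
  also have "\<dots> = (\<Oplus>l\<in>{..<h}. (f x [^] (q ^ l)) [^] (q ^ h))"
    using x by (simp add: nat_pow_pow power_add)
  also have "\<dots> = T x [^] r" unfolding T_def r_def using x by (intro frob_pow_sum[symmetric]) auto
  finally show ?thesis .
qed

lemma Y_eq:
  assumes x: "x \<in> carrier R" "x \<noteq> \<zero>"
  shows "Y x = x [^] m \<otimes> T x"
proof -
  have "x [^] m \<otimes> T x = (\<Oplus>l\<in>{..<h}. x [^] m \<otimes> f x [^] (q ^ l))"
    unfolding T_def using x by (intro finsum_rdistr) auto
  also have "\<dots> = Y x"
    unfolding Y_def
  proof (rule finsum_cong'[OF refl])
    show "(\<lambda>l. a \<otimes> x [^] (m + q ^ l) \<oplus> b \<otimes> x [^] (m - q ^ l)) \<in> {..<h} \<rightarrow> carrier R" using x coeffs by simp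
    fix l assume "l \<in> {..<h}"
    then have l: "q ^ l \<le> m" using m_le by simp
    have i: "inv x \<in> carrier R" using x by simp
    have "f x [^] (q ^ l) = a \<otimes> x [^] (q ^ l) \<oplus> b \<otimes> inv x [^] (q ^ l)"
      unfolding f_def using coeffs x by (simp add: frob_pow_add nat_pow_distrib fixed_pow)
    moreover have "v \<otimes> (a \<otimes> w \<oplus> b \<otimes> z) = a \<otimes> (v \<otimes> w) \<oplus> b \<otimes> (v \<otimes> z)"
      if "v \<in> carrier R" "w \<in> carrier R" "z \<in> carrier R" for v w z
      using that coeffs(1,2) by algebra
    ultimately have "x [^] m \<otimes> f x [^] (q ^ l) =
        a \<otimes> (x [^] m \<otimes> x [^] (q ^ l)) \<oplus> b \<otimes> (x [^] m \<otimes> inv x [^] (q ^ l))"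
      using x i by simp
    then show "x [^] m \<otimes> f x [^] (q ^ l) = a \<otimes> x [^] (m + q ^ l) \<oplus> b \<otimes> x [^] (m - q ^ l)"
      using x l by (simp add: nat_pow_mult pow_inv_cancel)
  qed
  finally show ?thesis by simp
qed

text \<open>The leading term comes from l = h - 1, where q^l = m; all smaller l have q^l <
  m.\<close>

lemma poly_eq_Y: "poly_eq (2 * m) Y"
proof -
  let ?g = "\<lambda>l x. a \<otimes> x [^] (m + q ^ l) \<oplus> b \<otimes> x [^] (m - q ^ l)"
  let ?rest = "\<lambda>x. b \<otimes> x [^] (0::nat) \<oplus> (\<Oplus>l\<in>{..<h - 1}. ?g l x)"
  have "poly_le (2 * m - 1) ?rest"
  proof (intro poly_le_add poly_le_sum)
    show "poly_le (2 * m - 1) (\<lambda>x. b \<otimes> x [^] (0::nat))"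
      using coeffs by (intro poly_le_mono[OF poly_le_monom]) auto
    fix l assume "l \<in> {..<h - 1}"
    then have l: "q ^ l < m" using m_less by simp
    show "poly_le (2 * m - 1) (\<lambda>x. a \<otimes> x [^] (m + q ^ l))" "poly_le (2 * m - 1) (\<lambda>x. b \<otimes> x [^] (m - q ^ l))"
      using coeffs l by (auto intro!: poly_le_mono[OF poly_le_monom])
  qed simp
  then have "poly_eq (2 * m) (\<lambda>x. a \<otimes> x [^] (2 * m) \<oplus> ?rest x)"
    using coeffs m_pos by (intro poly_eq_add_le[OF poly_eq_monom]) auto
  then show ?thesis
  proof (rule poly_eq_cong)
    fix x assume x: "x \<in> carrier R"
    have h: "{..<h} = insert (h - 1) {..<h - 1}" using h_pos by auto
    have "Y x = ?g (h - 1) x \<oplus> (\<Oplus>l\<in>{..<h - 1}. ?g l x)"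
      unfolding Y_def h using x coeffs by (subst finsum_insert) (auto simp: Pi_def)
    also have "?g (h - 1) x = a \<otimes> x [^] (2 * m) \<oplus> b \<otimes> x [^] (0::nat)"
      unfolding m_def[symmetric] by (simp add: mult_2)
    finally show "Y x = a \<otimes> x [^] (2 * m) \<oplus> ?rest x"
      using x coeffs by (simp add: a_assoc)
  qed
qed

text \<open>A factor \<open>Y\<close> has degree 2 m, of which only m belongs to the clearing power.
  The surplus m l, together with i and r j, reassembles \<open>e\<close> from its digits.\<close>

lemma poly_eq_\<phi>: "poly_eq (e + m * (q - 1)) (\<phi> e)"
proof -
  have "poly_eq (e mod m + r * (e div r) + m * (q - 1 - ll e) + 2 * m * ll e) (\<phi> e)"
    unfolding \<phi>_def by (intro poly_eq_mult poly_eq_power poly_eq_pow poly_eq_Y)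
  moreover have "e mod m + r * (e div r) + m * (q - 1 - ll e) + 2 * m * ll e = e + m * (q - 1)"
  proof -
    have "e div r = (e div m) div q" by (metis r_eq div_mult2_eq mult.commute)
    then have "e div m = ll e + q * (e div r)" unfolding ll_def by simp
    then have "e = e mod m + m * (ll e + q * (e div r))" by (metis mod_mult_div_eq)
    moreover have "m * (q - 1 - ll e) + m * ll e = m * (q - 1)"
      using ll_less[of e] by (simp flip: distrib_left)
    ultimately show ?thesis by (simp add: r_eq algebra_simps)
  qed
  ultimately show ?thesis by simp
qed

lemma poly_le_\<theta>:
  assumes e: "e < r * J"
  shows "poly_le (r * m + J + r) (\<theta> e)"
proof -
  have Y: "poly_le (2 * m) (\<lambda>x. u \<otimes> x [^] m \<ominus> Y x)"
    using u poly_eq_le[OF poly_eq_Y] by (intro poly_le_diff poly_le_mono[OF poly_le_monom]) auto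
  have "poly_le (r * (e mod m) + e div r + m * (q - 1 - ll e) + 2 * m * ll e) (\<theta> e)"
    unfolding \<theta>_def by (intro poly_le_mult poly_le_power poly_le_pow Y)
  then show ?thesis
  proof (rule poly_le_mono)
    \<comment> \<open>The digit \<open>e mod m\<close> is at most m - 1. This saves one
      \<open>r\<close> and pays for half of the 2 r that the last two factors of
      \<open>\<theta> e\<close> may cost.\<close>
    have "r * (e mod m) + r = r * Suc (e mod m)" by simp
    also have "\<dots> \<le> r * m" using m_pos by (intro mult_le_mono2) (simp add: Suc_leI)
    finally have 1: "r * (e mod m) + r \<le> r * m" .
    have 2: "e div r < J" using e by (simp add: less_mult_imp_div_less mult.commute)
    have "m * (q - 1 - ll e) + m * ll e = m * (q - 1)"
      using ll_less[of e] by (simp flip: distrib_left)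
    then have "m * (q - 1 - ll e) + 2 * m * ll e = m * (q - 1 + ll e)" by (simp add: distrib_left)
    also have "\<dots> \<le> m * (2 * q)" using ll_less[of e] by (intro mult_le_mono2) simp
    also have "\<dots> = 2 * r" by (simp add: r_eq)
    finally show "r * (e mod m) + e div r + m * (q - 1 - ll e) + 2 * m * ll e \<le> r * m + J + r"
      using 1 2 by linarith
  qed
qed

text \<open>On \<open>Z\<close> one has (T x)^r = u - T x and x^(r r) = x, so the r-th power
  exchanges the exponents i and r j for r i and j. The extra powers of x balance the two sides,
  because the clearing power gets raised to \<open>r\<close> in \<open>\<phi>\<close> but not in
  \<open>\<theta>\<close>.\<close>

lemma \<phi>_pow:
  assumes x: "x \<in> Z"
  shows "\<phi> e x [^] r \<otimes> x [^] (m * (q - 1)) = \<theta> e x \<otimes> (x [^] r) [^] (m * (q - 1))"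
proof -
  have x: "x \<in> carrier R" "x \<noteq> \<zero>" and tr: "T x \<oplus> T x [^] r = u"
    using x trace_f unfolding Z_def by auto
  define t where "t = u \<ominus> T x"
  have t: "t \<in> carrier R" unfolding t_def using u x by simp
  have Tr: "T x [^] r = t"
  proof -
    have "t = (T x \<oplus> T x [^] r) \<ominus> T x" unfolding t_def tr ..
    also have "\<dots> = T x [^] r"
    proof -
      have "(w \<oplus> z) \<ominus> w = z" if "w \<in> carrier R" "z \<in> carrier R" for w z using that by algebra
      then show ?thesis using x by simp
    qed
    finally show ?thesis by simp
  qed
  let ?i = "e mod m" and ?j = "e div r" and ?l = "ll e" and ?y = "x [^] r"
  have y: "?y \<in> carrier R" using x by simp
  have exp: "m * (q - 1 - ?l) + m * ?l = m * (q - 1)"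
    using ll_less[of e] by (simp flip: distrib_left)
  have "\<phi> e x [^] r = ?y [^] (?i + r * ?j) \<otimes> ?y [^] (m * (q - 1 - ?l)) \<otimes> (?y [^] m \<otimes> t) [^] ?l"
  proof -
    have "(v [^] k) [^] r = (v [^] r) [^] k" if "v \<in> carrier R" for v and k :: nat
      using that by (simp add: nat_pow_pow mult.commute)
    then show ?thesis unfolding \<phi>_def Y_eq[OF x] using x t by (simp add: nat_pow_distrib Tr)
  qed
  also have "\<dots> = ?y [^] (?i + r * ?j) \<otimes> (?y [^] (m * (q - 1 - ?l)) \<otimes> ?y [^] (m * ?l)) \<otimes> t [^] ?l"
    using y t by (simp add: nat_pow_distrib nat_pow_pow m_assoc)
  also have "\<dots> = ?y [^] (?i + r * ?j) \<otimes> ?y [^] (m * (q - 1)) \<otimes> t [^] ?l"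
    by (simp only: nat_pow_mult[OF y] exp)
  also have "?y [^] (?i + r * ?j) = x [^] (r * ?i) \<otimes> (?y [^] r) [^] ?j"
    using x by (simp add: nat_pow_pow nat_pow_mult distrib_left mult.assoc)
  also have "\<dots> = x [^] (r * ?i + ?j)" using x by (simp add: pow_rr nat_pow_mult)
  finally have \<phi>: "\<phi> e x [^] r = x [^] (r * ?i + ?j) \<otimes> ?y [^] (m * (q - 1)) \<otimes> t [^] ?l" .
  have "u \<otimes> x [^] m \<ominus> Y x = x [^] m \<otimes> t"
  proof -
    have "u \<otimes> v \<ominus> v \<otimes> w = v \<otimes> (u \<ominus> w)" if "v \<in> carrier R" "w \<in> carrier R" for v w
      using that u by algebra
    then show ?thesis unfolding Y_eq[OF x] t_def using x by simp
  qed
  then have "\<theta> e x = x [^] (r * ?i + ?j) \<otimes> x [^] (m * (q - 1 - ?l)) \<otimes> (x [^] m \<otimes> t) [^] ?l"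
    unfolding \<theta>_def by simp
  also have "\<dots> = x [^] (r * ?i + ?j) \<otimes> (x [^] (m * (q - 1 - ?l)) \<otimes> x [^] (m * ?l)) \<otimes> t [^] ?l"
    using x t by (simp add: nat_pow_distrib nat_pow_pow m_assoc)
  also have "\<dots> = x [^] (r * ?i + ?j) \<otimes> x [^] (m * (q - 1)) \<otimes> t [^] ?l"
    by (simp only: nat_pow_mult[OF x(1)] exp)
  finally have \<theta>: "\<theta> e x = x [^] (r * ?i + ?j) \<otimes> x [^] (m * (q - 1)) \<otimes> t [^] ?l" .
  have "(c \<otimes> d \<otimes> g) \<otimes> k = (c \<otimes> k \<otimes> g) \<otimes> d"
    if "c \<in> carrier R" "d \<in> carrier R" "g \<in> carrier R" "k \<in> carrier R" for c d g k
    using that by algebra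
  then show ?thesis unfolding \<phi> \<theta> using x y t by simp
qed

text \<open>There are |R|^(r J) coefficient vectors but at most |R|^(r m + J + r + 1) functions of
  the degree of \<open>\<theta>\<close>, so two vectors collide. Their difference gives a
  combination of the \<open>\<phi> e\<close> of known exact degree that vanishes on
  \<open>Z\<close>. The result is the expected count r m = |R| / q plus 4 sqrt |R|.\<close>

lemma card_Z: "card Z \<le> r * m + 4 * r"
proof -
  let ?C = "{..<r * J} \<rightarrow>\<^sub>E carrier R"
  \<comment> \<open>The coefficients are raised to the power \<open>r\<close>, so that on
    \<open>Z\<close> this is, up to powers of x, the r-th power of the combination of the
    \<open>\<phi> e\<close> with coefficients \<open>c\<close>.\<close>
  let ?\<Theta> = "\<lambda>c x. \<Oplus>e\<in>{..<r * J}. c e [^] r \<otimes> \<theta> e x"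
  let ?F = "\<lambda>c. restrict (?\<Theta> c) (carrier R)"
  let ?P = "{restrict g (carrier R) | g. poly_le (r * m + J + r) g}"
  have "\<not> inj_on ?F ?C"
  proof
    assume "inj_on ?F ?C"
    then have "card ?C = card (?F ` ?C)" by (simp add: card_image)
    also have "\<dots> \<le> card ?P"
    proof (rule card_mono[OF card_poly_le(1)], clarify)
      fix c assume c: "c \<in> ?C"
      have "poly_le (r * m + J + r) (?\<Theta> c)"
      proof (rule poly_le_sum)
        fix e assume "e \<in> {..<r * J}"
        then have "poly_le (0 + (r * m + J + r)) (\<lambda>x. c e [^] r \<otimes> \<theta> e x)"
          using c by (intro poly_le_mult poly_le_const poly_le_\<theta>) auto
        then show "poly_le (r * m + J + r) (\<lambda>x. c e [^] r \<otimes> \<theta> e x)" by simp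
      qed simp
      then show "\<exists>g. ?F c = restrict g (carrier R) \<and> poly_le (r * m + J + r) g" by blast
    qed
    also have "\<dots> \<le> order R ^ Suc (r * m + J + r)" by (rule card_poly_le(2))
    finally have "order R ^ (r * J) \<le> order R ^ Suc (r * m + J + r)" by (simp add: card_PiE order_def)
    moreover have "1 < order R"
      unfolding order_eq using q_ge n_pos by (intro one_less_power) auto
    ultimately have "r * J \<le> Suc (r * m + J + r)" using power_le_imp_le_exp by blast
    \<comment> \<open>The contradiction is 2 r >= 6 m >= m + 5 > J + 1.\<close>
    moreover have "r * J = r * m + 3 * r" by (simp add: J_def algebra_simps)
    moreover have "3 * m \<le> r" unfolding r_eq using q_ge by simp
    ultimately show False using m_pos unfolding J_def by linarith
  qed
  then obtain c c' where c: "c \<in> ?C" "c' \<in> ?C" "c \<noteq> c'" "?F c = ?F c'" by (auto simp: inj_on_def)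
  have cc: "c e \<in> carrier R" "c' e \<in> carrier R" if "e < r * J" for e using c that by auto
  have cl: "\<phi> e x \<in> carrier R" "\<theta> e x \<in> carrier R" if "x \<in> carrier R" for e x
    using that u unfolding \<phi>_def \<theta>_def by auto
  let ?d = "\<lambda>e. c e \<ominus> c' e"
  have "\<exists>e<r * J. c e \<noteq> c' e" using c(1-3) by (meson PiE_ext lessThan_iff)
  then have "\<exists>e<r * J. ?d e \<noteq> \<zero>" using cc by auto
  then obtain e where e: "e < r * J" "poly_eq (e + m * (q - 1)) (\<lambda>x. \<Oplus>i\<in>{..<r * J}. ?d i \<otimes> \<phi> i x)"
    using poly_eq_sum_nonzero[of "r * J" "m * (q - 1)" \<phi> ?d] poly_eq_\<phi> cc m_pos q_ge by auto
  have pow: "(\<Oplus>e\<in>{..<r * J}. k e \<otimes> \<phi> e x) [^] r \<otimes> x [^] (m * (q - 1)) = ?\<Theta> k x \<otimes> (x [^] r) [^] (m * (q - 1))"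
    if k: "\<And>e. e < r * J \<Longrightarrow> k e \<in> carrier R" and xZ: "x \<in> Z" for k x
  proof -
    have x: "x \<in> carrier R" using xZ by (simp add: Z_def)
    have "(\<Oplus>e\<in>{..<r * J}. k e \<otimes> \<phi> e x) [^] r = (\<Oplus>e\<in>{..<r * J}. (k e \<otimes> \<phi> e x) [^] r)"
      using k cl x by (intro frob_pow_sum[where m = h, folded r_def]) auto
    then have "(\<Oplus>e\<in>{..<r * J}. k e \<otimes> \<phi> e x) [^] r \<otimes> x [^] (m * (q - 1)) =
        (\<Oplus>e\<in>{..<r * J}. (k e \<otimes> \<phi> e x) [^] r \<otimes> x [^] (m * (q - 1)))"
      using k cl x by (simp add: finsum_ldistr Pi_def)
    also have "\<dots> = (\<Oplus>e\<in>{..<r * J}. (k e [^] r \<otimes> \<theta> e x) \<otimes> (x [^] r) [^] (m * (q - 1)))"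
    proof (rule finsum_cong'[OF refl])
      show "(\<lambda>e. (k e [^] r \<otimes> \<theta> e x) \<otimes> (x [^] r) [^] (m * (q - 1))) \<in> {..<r * J} \<rightarrow> carrier R"
        using k cl x by simp
      fix e assume "e \<in> {..<r * J}"
      then have "k e \<in> carrier R" using k by simp
      then show "(k e \<otimes> \<phi> e x) [^] r \<otimes> x [^] (m * (q - 1)) = (k e [^] r \<otimes> \<theta> e x) \<otimes> (x [^] r) [^] (m * (q - 1))"
        using cl[OF x] x \<phi>_pow[OF xZ, of e] by (simp add: nat_pow_distrib m_assoc)
    qed
    also have "\<dots> = ?\<Theta> k x \<otimes> (x [^] r) [^] (m * (q - 1))"
      using k cl x by (simp add: finsum_ldistr Pi_def)
    finally show ?thesis .
  qed
  have "Z \<subseteq> {x \<in> carrier R. (\<Oplus>i\<in>{..<r * J}. ?d i \<otimes> \<phi> i x) = \<zero>}"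
  proof
    fix x assume xZ: "x \<in> Z"
    then have x: "x \<in> carrier R" "x \<noteq> \<zero>" by (auto simp: Z_def)
    let ?A = "\<Oplus>e\<in>{..<r * J}. c e \<otimes> \<phi> e x" and ?B = "\<Oplus>e\<in>{..<r * J}. c' e \<otimes> \<phi> e x"
    have AB: "?A \<in> carrier R" "?B \<in> carrier R" using cc cl x by (auto intro!: finsum_closed)
    have "?\<Theta> c x = ?\<Theta> c' x" using fun_cong[OF c(4), of x] x by simp
    then have "?A [^] r \<otimes> x [^] (m * (q - 1)) = ?B [^] r \<otimes> x [^] (m * (q - 1))"
      using pow[OF _ xZ, of c] pow[OF _ xZ, of c'] cc by simp
    moreover have "x [^] (m * (q - 1)) \<noteq> \<zero>" using x by (intro pow_nonzero)
    ultimately have "?A [^] r = ?B [^] r" using AB x m_rcancel by simp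
    \<comment> \<open>The r-th power map is an involution, since r r = |R|; hence it is
      injective.\<close>
    then have "(?A [^] r) [^] r = (?B [^] r) [^] r" by simp
    then have "?A = ?B" using AB by (simp add: pow_rr)
    have "(\<Oplus>i\<in>{..<r * J}. ?d i \<otimes> \<phi> i x) \<oplus> ?B = (\<Oplus>i\<in>{..<r * J}. ?d i \<otimes> \<phi> i x \<oplus> c' i \<otimes> \<phi> i x)"
      using cc cl x by (intro finsum_addf[symmetric]) auto
    also have "\<dots> = ?A"
    proof (rule finsum_cong'[OF refl])
      show "(\<lambda>i. c i \<otimes> \<phi> i x) \<in> {..<r * J} \<rightarrow> carrier R" using cc cl x by simp
      fix i assume "i \<in> {..<r * J}"
      then have "c i \<in> carrier R" "c' i \<in> carrier R" using cc by auto
      moreover have "\<phi> i x \<in> carrier R" using cl x by simp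
      ultimately show "?d i \<otimes> \<phi> i x \<oplus> c' i \<otimes> \<phi> i x = c i \<otimes> \<phi> i x" by algebra
    qed
    finally have "(\<Oplus>i\<in>{..<r * J}. ?d i \<otimes> \<phi> i x) \<oplus> ?B = \<zero> \<oplus> ?B" using \<open>?A = ?B\<close> AB by simp
    moreover have "(\<Oplus>i\<in>{..<r * J}. ?d i \<otimes> \<phi> i x) \<in> carrier R" using cc cl x by (intro finsum_closed) auto
    ultimately have "(\<Oplus>i\<in>{..<r * J}. ?d i \<otimes> \<phi> i x) = \<zero>" using AB add.r_cancel by blast
    then show "x \<in> {x \<in> carrier R. (\<Oplus>i\<in>{..<r * J}. ?d i \<otimes> \<phi> i x) = \<zero>}" using x by simp
  qed
  then have "card Z \<le> card {x \<in> carrier R. (\<Oplus>i\<in>{..<r * J}. ?d i \<otimes> \<phi> i x) = \<zero>}"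
    by (intro card_mono) auto
  also have "\<dots> \<le> e + m * (q - 1)" by (rule poly_eq_roots[OF e(2)])
  also have "\<dots> \<le> r * J + r" using e(1) by (simp add: r_eq algebra_simps)
  also have "\<dots> = r * m + 4 * r" by (simp add: J_def algebra_simps)
  finally show ?thesis .
qed

end

section \<open>The bound for Kloosterman sums\<close>

context frobenius_field
begin

text \<open>The q-th power permutes the summands of a trace cyclically, so every trace is a root of
  z^q - z.\<close>

lemma card_trace_image: "card (trace ` carrier R) \<le> q"
proof -
  have "poly_eq q (\<lambda>z. z [^] q \<oplus> \<ominus> z)"
    by (rule poly_eq_add_le[OF poly_eq_power, of 1], rule poly_le_minus,
        rule poly_le_cong[OF poly_le_power]) (use q_ge in auto)
  then have "card {z \<in> carrier R. z [^] q \<oplus> \<ominus> z = \<zero>} \<le> q" by (rule poly_eq_roots)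
  moreover have "trace ` carrier R \<subseteq> {z \<in> carrier R. z [^] q \<oplus> \<ominus> z = \<zero>}"
  proof (rule image_subsetI)
    fix z assume z: "z \<in> carrier R"
    have "trace z [^] q = (\<Oplus>l\<in>{..<n}. (z [^] (q ^ l)) [^] q)"
      unfolding trace_def using frob_pow_sum[of "{..<n}" "\<lambda>l. z [^] (q ^ l)" 1] z by simp
    also have "\<dots> = (\<Oplus>l\<in>{..<n}. z [^] (q ^ Suc l))"
      using z by (simp add: nat_pow_pow mult.commute)
    also have "\<dots> = (\<Oplus>l\<in>Suc ` {..<n}. z [^] (q ^ l))"
      using z by (intro finsum_reindex[symmetric]) auto
    also have "Suc ` {..<n} = insert n {1..<n}" using n_pos by (auto simp: image_Suc_lessThan)
    also have "(\<Oplus>l\<in>insert n {1..<n}. z [^] (q ^ l)) = z [^] (q ^ n) \<oplus> (\<Oplus>l\<in>{1..<n}. z [^] (q ^ l))"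
      using z by (intro finsum_insert) auto
    also have "z [^] (q ^ n) = z [^] (q ^ (0::nat))" using z power_order[OF z] by (simp add: order_eq)
    also have "z [^] (q ^ (0::nat)) \<oplus> (\<Oplus>l\<in>{1..<n}. z [^] (q ^ l)) = (\<Oplus>l\<in>insert 0 {1..<n}. z [^] (q ^ l))"
      using z by (intro finsum_insert[symmetric]) auto
    also have "insert 0 {1..<n} = {..<n}" using n_pos by auto
    finally have "trace z [^] q = trace z" unfolding trace_def .
    then show "trace z \<in> {z \<in> carrier R. z [^] q \<oplus> \<ominus> z = \<zero>}" using z by (simp add: r_neg)
  qed
  then have "card (trace ` carrier R) \<le> card {z \<in> carrier R. z [^] q \<oplus> \<ominus> z = \<zero>}"
    by (intro card_mono) auto
  ultimately show ?thesis by simp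
qed

text \<open>Stepanov's method bounds the fibre sizes \<open>N u\<close> from above only. As the
  values \<open>g u\<close> sum to 0, each \<open>N u\<close> may be replaced by
  \<open>N u - M\<close>, which has constant sign, and the total deficit is at most q M - (|R| - 1)
  = 4 q r + 1.\<close>

lemma kloosterman_stepanov:
  assumes n: "n = 2 * h"
  shows "cmod (kloosterman R \<chi> a b) \<le> 4 * real q * real q ^ h + 1"
proof -
  let ?U = "trace ` carrier R" and ?D = "carrier R - {\<zero>}"
  let ?f = "\<lambda>x. a \<otimes> x \<oplus> b \<otimes> inv x"
  \<comment> \<open>\<open>\<chi>\<close> as a function of the trace; \<open>char_trace\<close>
    makes the choice of \<open>z\<close> irrelevant.\<close>
  define g where "g = (\<lambda>u. \<chi> (SOME z. z \<in> carrier R \<and> trace z = u))"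
  define N where "N = (\<lambda>u. card {x \<in> ?D. trace (?f x) = u})"
  define r where "r = q ^ h"
  define m where "m = q ^ (h - 1)"
  define M where "M = r * m + 4 * r"
  have h: "0 < h" using n n_pos by simp
  have rm: "r = q * m" unfolding r_def m_def using h by (cases h) auto
  have fc: "?f x \<in> carrier R" if "x \<in> ?D" for x using that coeffs by auto
  have g: "g (trace z) = \<chi> z" if z: "z \<in> carrier R" for z
  proof -
    let ?w = "SOME w. w \<in> carrier R \<and> trace w = trace z"
    have "?w \<in> carrier R \<and> trace ?w = trace z" by (rule someI[of _ z]) (use z in simp)
    then show ?thesis unfolding g_def using char_trace z unfolding trace_def by blast
  qed
  \<comment> \<open>The interpretation below shadows the names \<open>r_def\<close> and
    \<open>m_def\<close>; these copies keep the local definitions accessible.\<close>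
  note rm_defs = r_def m_def
  have NM: "N u \<le> M" if u: "u \<in> ?U" for u
  proof -
    have "u \<in> carrier R" using u by auto
    then interpret stepanov R \<chi> q n a b h u by unfold_locales (rule n)
    show ?thesis using card_Z unfolding N_def M_def Z_def f_def r_def m_def rm_defs by simp
  qed
  have K: "kloosterman R \<chi> a b = (\<Sum>u\<in>?U. of_nat (N u) * g u)"
  proof -
    have "kloosterman R \<chi> a b = (\<Sum>x\<in>?D. g (trace (?f x)))"
      unfolding kloosterman_def using fc g by (intro sum.cong) auto
    also have "\<dots> = (\<Sum>u\<in>?U. \<Sum>x | x \<in> ?D \<and> trace (?f x) = u. g (trace (?f x)))"
      using fc by (intro sum.group[symmetric]) auto
    also have "\<dots> = (\<Sum>u\<in>?U. of_nat (N u) * g u)"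
      by (intro sum.cong) (simp_all add: N_def)
    finally show ?thesis .
  qed
  have sum0: "(\<Sum>u\<in>?U. g u) = 0"
  proof -
    obtain c where c: "c \<in> carrier R" "\<chi> c \<noteq> 1"
      using character unfolding nontrivial_additive_character_def by blast
    \<comment> \<open>Translation by \<open>trace c\<close> permutes the traces and multiplies
      \<open>g\<close> by \<open>\<chi> c\<close>, which is not 1.\<close>
    have bij: "bij_betw (\<lambda>u. u \<oplus> trace c) ?U ?U"
    proof (rule bij_betw_byWitness[where f' = "\<lambda>u. u \<oplus> trace (\<ominus> c)"])
      have "trace c \<oplus> trace (\<ominus> c) = trace \<zero>" using c by (simp add: r_neg flip: trace_add)
      moreover have "trace \<zero> = \<zero>"
      proof -
        have "trace \<zero> \<oplus> trace \<zero> = trace \<zero>" using trace_add[of \<zero> \<zero>] by simp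
        then show ?thesis by (metis add.l_cancel_one trace_closed zero_closed)
      qed
      ultimately have *: "trace c \<oplus> trace (\<ominus> c) = \<zero>" by simp
      have **: "trace (\<ominus> c) \<oplus> trace c = \<zero>" using * c by (simp add: a_comm)
      show "\<forall>u\<in>?U. u \<oplus> trace c \<oplus> trace (\<ominus> c) = u" using c * by (auto simp: a_assoc)
      show "\<forall>u\<in>?U. u \<oplus> trace (\<ominus> c) \<oplus> trace c = u" using c ** by (auto simp: a_assoc)
      show "(\<lambda>u. u \<oplus> trace c) ` ?U \<subseteq> ?U" "(\<lambda>u. u \<oplus> trace (\<ominus> c)) ` ?U \<subseteq> ?U"
        using c by (auto simp flip: trace_add)
    qed
    have "(\<Sum>u\<in>?U. g u) = (\<Sum>u\<in>?U. g (u \<oplus> trace c))"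
      using sum.reindex_bij_betw[OF bij, of g] by simp
    also have "\<dots> = (\<Sum>u\<in>?U. g u * \<chi> c)"
      using c by (intro sum.cong) (auto simp: g char_add simp flip: trace_add)
    also have "\<dots> = (\<Sum>u\<in>?U. g u) * \<chi> c" by (rule sum_distrib_right[symmetric])
    finally have "(\<Sum>u\<in>?U. g u) = (\<Sum>u\<in>?U. g u) * \<chi> c" .
    then show ?thesis using c(2) by (metis mult.right_neutral mult_left_cancel)
  qed
  have "kloosterman R \<chi> a b = (\<Sum>u\<in>?U. (of_nat (N u) - of_nat M) * g u)"
    unfolding K using sum0 by (simp add: left_diff_distrib sum_subtractf flip: sum_distrib_left)
  then have "cmod (kloosterman R \<chi> a b) \<le> (\<Sum>u\<in>?U. cmod ((of_nat (N u) - of_nat M) * g u))"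
    by (simp add: norm_sum)
  also have "\<dots> = (\<Sum>u\<in>?U. real M - real (N u))"
  proof (rule sum.cong[OF refl])
    fix u assume u: "u \<in> ?U"
    then have "cmod (g u) = 1" using g norm_char by auto
    moreover have "cmod (of_nat (N u) - of_nat M) = real M - real (N u)"
      using NM[OF u] by (metis norm_minus_commute norm_of_nat of_nat_diff)
    ultimately show "cmod ((of_nat (N u) - of_nat M) * g u) = real M - real (N u)" by (simp add: norm_mult)
  qed
  also have "\<dots> = real (card ?U) * real M - real (\<Sum>u\<in>?U. N u)" by (simp add: sum_subtractf)
  also have "(\<Sum>u\<in>?U. N u) = card ?D"
  proof -
    have "card ?D = (\<Sum>x\<in>?D. 1)" by simp
    also have "\<dots> = (\<Sum>u\<in>?U. \<Sum>x | x \<in> ?D \<and> trace (?f x) = u. 1)"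
      using fc by (intro sum.group[symmetric]) auto
    finally show ?thesis by (simp add: N_def)
  qed
  also have "card ?D = order R - 1" by (simp add: order_def)
  also have "real (card ?U) * real M \<le> real q * real M" using card_trace_image by (intro mult_right_mono) auto
  also have "real q * real M = real (order R) + 4 * real q * real r"
  proof -
    have "order R = r * r" by (simp add: order_eq n r_def power_add mult_2)
    then have "q * M = order R + 4 * q * r" unfolding M_def rm by (simp add: algebra_simps)
    then show ?thesis by (metis of_nat_add of_nat_mult of_nat_numeral)
  qed
  finally have "cmod (kloosterman R \<chi> a b) \<le> 4 * real q * real r + 1" using order_pos by simp
  then show ?thesis by (simp add: r_def)
qed

section \<open>The normalised Kloosterman sum along the tower\<close>

definition kl_ratio :: real where
  "kl_ratio = cmod (kloosterman R \<chi> a b) / sqrt (real (order R))"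

text \<open>Dividing by q^h removes \<open>n\<close> from the bound, which makes it uniform along
  the tower.\<close>

lemma kl_ratio_le:
  assumes "even n"
  shows "kl_ratio \<le> 4 * real q + 1"
proof -
  obtain h where h: "n = 2 * h" using assms by auto
  have r: "sqrt (real (order R)) = real q ^ h" by (simp add: order_eq h real_sqrt_power power_mult real_sqrt_abs2 power2_eq_square)
  have "1 \<le> real q ^ h" using q_ge by (intro one_le_power) auto
  then have "cmod (kloosterman R \<chi> a b) \<le> (4 * real q + 1) * real q ^ h"
    using kloosterman_stepanov[OF h] by (simp add: algebra_simps)
  then show ?thesis unfolding kl_ratio_def r using q_ge by (simp add: divide_le_eq)
qed

text \<open>From |2 Q - K^2| >= |K|^2 - 2 Q the new ratio is at least x^2 - 2, and (2 +
  \<epsilon>)^2 - 2 >= 2 + 4 \<epsilon>: the excess over 2 grows at least fourfold.\<close>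

lemma kl_ratio_step:
  assumes \<epsilon>: "2 + \<epsilon> \<le> kl_ratio" "0 \<le> \<epsilon>"
  shows "\<exists>(S :: nat ring) \<psi> a' b'. frobenius_field S \<psi> q (2 * n) a' b' \<and>
     2 + 4 * \<epsilon> \<le> frobenius_field.kl_ratio S \<psi> a' b'"
proof -
  obtain S :: "nat ring" and \<psi> a' b' where S: "frobenius_field S \<psi> q (2 * n) a' b'"
    and K: "kloosterman S \<psi> a' b' = 2 * of_nat (order R) - (kloosterman R \<chi> a b)\<^sup>2"
    using quadratic_step by blast
  interpret S: frobenius_field S \<psi> q "2 * n" a' b' by (rule S)
  define Q where "Q = real (order R)"
  have Q: "0 < Q" unfolding Q_def using order_pos by simp
  have "sqrt (real (order S)) = Q"
    by (simp add: S.order_eq order_eq Q_def power_mult_distrib real_sqrt_mult mult_2 power_add)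
  moreover have "(cmod (kloosterman R \<chi> a b))\<^sup>2 - 2 * Q \<le> cmod (kloosterman S \<psi> a' b')"
    unfolding K using norm_triangle_ineq2[of "(kloosterman R \<chi> a b)\<^sup>2" "2 * of_nat (order R)"]
    by (simp add: norm_minus_commute norm_power norm_mult Q_def)
  moreover have "(cmod (kloosterman R \<chi> a b))\<^sup>2 = kl_ratio\<^sup>2 * Q"
    unfolding kl_ratio_def using Q by (simp add: power_divide Q_def)
  ultimately have "kl_ratio\<^sup>2 - 2 \<le> S.kl_ratio"
    unfolding S.kl_ratio_def using Q by (simp add: le_divide_eq algebra_simps)
  moreover have "(2 + \<epsilon>)\<^sup>2 \<le> kl_ratio\<^sup>2" using \<epsilon> by (intro power_mono) auto
  moreover have "(2 + \<epsilon>)\<^sup>2 = 4 + 4 * \<epsilon> + \<epsilon>\<^sup>2" by (simp add: power2_eq_square algebra_simps)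
  ultimately have "2 + 4 * \<epsilon> \<le> S.kl_ratio" by (smt (verit) zero_le_power2)
  then show ?thesis using S by blast
qed

end

lemma kl_ratio_iterate:
  fixes R :: "nat ring"
  assumes "frobenius_field R \<chi> q n a b" "even n" "2 + \<epsilon> \<le> frobenius_field.kl_ratio R \<chi> a b" "0 \<le> \<epsilon>"
  shows "2 + 4 ^ j * \<epsilon> \<le> 4 * real q + 1"
  using assms
proof (induction j arbitrary: R \<chi> n a b \<epsilon>)
  case 0
  then interpret frobenius_field R \<chi> q n a b by simp
  show ?case using kl_ratio_le 0 by simp
next
  case (Suc j)
  then interpret frobenius_field R \<chi> q n a b by simp
  obtain S :: "nat ring" and \<psi> a' b' where "frobenius_field S \<psi> q (2 * n) a' b'"
    "2 + 4 * \<epsilon> \<le> frobenius_field.kl_ratio S \<psi> a' b'" using kl_ratio_step Suc.prems by blast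
  from Suc.IH[OF this(1) _ this(2)] Suc.prems(4) show ?case by (simp add: mult.assoc mult.left_commute)
qed

theorem (in odd_field_character) kloosterman_bound:
  assumes ab: "a \<in> carrier R" "b \<in> carrier R" "a \<noteq> \<zero>" "b \<noteq> \<zero>"
  shows "cmod (kloosterman R \<chi> a b) \<le> 2 * sqrt (real (order R))"
proof (rule ccontr)
  \<comment> \<open>With \<open>n = 1\<close> the field is its own bottom field and the trace is the
    identity, so every character is admissible.\<close>
  interpret F: frobenius_field R \<chi> "order R" 1 a b
  proof unfold_locales
    have "{x \<in> carrier R. x [^] order R = x} = carrier R" using power_order by auto
    then show "card {x \<in> carrier R. x [^] order R = x} = order R" by (simp add: order_def)
  qed (use ab power_order in \<open>auto simp: lessThan_Suc\<close>)
  assume "\<not> ?thesis"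
  then have "2 < F.kl_ratio" unfolding F.kl_ratio_def using order_pos by (simp add: less_divide_eq)
  then obtain \<epsilon> where \<epsilon>: "0 < \<epsilon>" "2 + \<epsilon> \<le> F.kl_ratio" by (metis add_diff_cancel_left' diff_gt_0_iff_gt le_add_diff_inverse less_eq_real_def)
  \<comment> \<open>The first extension is taken separately: it moves an arbitrary field into
    \<open>nat ring\<close> and makes \<open>n\<close> even, as \<open>kl_ratio_iterate\<close>
    requires.\<close>
  obtain S :: "nat ring" and \<psi> a' b' where S: "frobenius_field S \<psi> (order R) (2 * 1) a' b'"
    "2 + 4 * \<epsilon> \<le> frobenius_field.kl_ratio S \<psi> a' b'" using F.kl_ratio_step[of \<epsilon>] \<epsilon> by auto
  have *: "2 + 4 ^ j * (4 * \<epsilon>) \<le> 4 * real (order R) + 1" for j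
    by (rule kl_ratio_iterate[OF S(1) _ S(2)]) (use \<epsilon> in auto)
  obtain j where "(4 * real (order R) + 1) / (4 * \<epsilon>) < 4 ^ j" using real_arch_pow[of 4] by auto
  then have "4 * real (order R) + 1 < 4 ^ j * (4 * \<epsilon>)" using \<epsilon> by (simp add: divide_less_eq)
  then show False using *[of j] by simp
qed

section \<open>Gauss and Salie sums\<close>

context odd_field_character
begin

text \<open>The quadratic character of the field, extended by 0 at 0.\<close>

definition \<eta> :: "'a \<Rightarrow> complex" where "\<eta> x = of_nat (nsqrt x) - 1"

definition gauss :: complex where "gauss = (\<Sum>x\<in>carrier R. \<chi> (x \<otimes> x))"

lemma \<eta>_zero [simp]: "\<eta> \<zero> = 0"
  by (simp add: \<eta>_def nsqrt_zero)

lemma \<eta>_square: "x \<in> carrier R \<Longrightarrow> x \<noteq> \<zero> \<Longrightarrow> \<eta> (x \<otimes> x) = 1"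
  by (simp add: \<eta>_def nsqrt_square)

lemma \<eta>_nonsquare: "nsqrt x = 0 \<Longrightarrow> \<eta> x = -1"
  by (simp add: \<eta>_def)

lemma \<eta>_mult:
  assumes x: "x \<in> carrier R" and y: "y \<in> carrier R"
  shows "\<eta> (x \<otimes> y) = \<eta> x * \<eta> y"
proof (cases "x = \<zero>")
  case True
  then show ?thesis using y by simp
next
  case x0: False
  show ?thesis
  proof (cases "nsqrt x = 0")
    case True
    then have "nsqrt y + nsqrt (x \<otimes> y) = 2" using nsqrt_nonsquare_mult x y by blast
    then have "of_nat (nsqrt y) + of_nat (nsqrt (x \<otimes> y)) = (2 :: complex)" by (metis of_nat_add of_nat_numeral)
    then have "of_nat (nsqrt (x \<otimes> y)) = (2 :: complex) - of_nat (nsqrt y)" by (simp add: eq_diff_eq add.commute)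
    then show ?thesis using True by (simp add: \<eta>_def)
  next
    case False
    then obtain z where z: "z \<in> carrier R" "x = z \<otimes> z" using nsqrt_pos_iff by auto
    then have "z \<noteq> \<zero>" using x0 by auto
    then show ?thesis using z y by (simp add: \<eta>_def nsqrt_mult_square nsqrt_square)
  qed
qed

lemma \<eta>_cases:
  assumes "x \<in> carrier R" "x \<noteq> \<zero>"
  shows "\<eta> x = 1 \<or> \<eta> x = -1"
proof (cases "nsqrt x = 0")
  case False
  then obtain z where "z \<in> carrier R" "x = z \<otimes> z" using nsqrt_pos_iff by auto
  moreover then have "z \<noteq> \<zero>" using assms by auto
  ultimately show ?thesis by (simp add: \<eta>_square)
qed (simp add: \<eta>_nonsquare)

lemma \<eta>_inv: "x \<in> carrier R \<Longrightarrow> x \<noteq> \<zero> \<Longrightarrow> \<eta> (inv x) = \<eta> x"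
  using \<eta>_mult[of x "inv x"] \<eta>_square[of \<one>] \<eta>_cases[of x] by (auto simp: minus_equation_iff[of _ 1])

lemma sum_\<eta>: "(\<Sum>x\<in>carrier R. \<eta> x) = 0"
proof -
  have "(\<Sum>x\<in>carrier R. of_nat (nsqrt x)) = (of_nat (order R) :: complex)"
    using sum_nsqrt_card by (metis of_nat_sum)
  then show ?thesis by (simp add: \<eta>_def sum_subtractf order_def)
qed

lemma sum_\<eta>_nonzero: "(\<Sum>x\<in>carrier R - {\<zero>}. \<eta> x) = 0"
  using sum_\<eta> by (simp add: sum.remove[where x = \<zero>])

lemma sum_quadratic_\<eta>:
  assumes s: "s \<in> carrier R" "s \<noteq> \<zero>"
  shows "(\<Sum>x\<in>carrier R. \<chi> (s \<otimes> (x \<otimes> x))) = (\<Sum>x\<in>carrier R. \<eta> x * \<chi> (s \<otimes> x))"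
proof -
  have "(\<Sum>x\<in>carrier R. \<chi> (s \<otimes> (x \<otimes> x))) = (\<Sum>x\<in>carrier R. of_nat (nsqrt x) * \<chi> (s \<otimes> x))"
    by (rule sum_nsqrt)
  also have "\<dots> = (\<Sum>x\<in>carrier R. \<eta> x * \<chi> (s \<otimes> x) + \<chi> (s \<otimes> x))"
    by (simp add: \<eta>_def algebra_simps)
  finally show ?thesis using s by (simp add: sum.distrib sum_char_mult)
qed

lemma gauss_\<eta>: "gauss = (\<Sum>x\<in>carrier R. \<eta> x * \<chi> x)"
  using sum_quadratic_\<eta>[of \<one>] by (simp add: gauss_def)

lemma sum_\<eta>_char:
  assumes s: "s \<in> carrier R" "s \<noteq> \<zero>"
  shows "(\<Sum>x\<in>carrier R. \<eta> x * \<chi> (s \<otimes> x)) = \<eta> s * gauss"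
proof -
  have "\<eta> s * gauss = (\<Sum>x\<in>carrier R. \<eta> s * (\<eta> (s \<otimes> x) * \<chi> (s \<otimes> x)))"
    unfolding gauss_\<eta> sum_distrib_left
    using sum.reindex_bij_betw[OF bij_mult[OF s], of "\<lambda>x. \<eta> s * (\<eta> x * \<chi> x)"] by simp
  also have "\<dots> = (\<Sum>x\<in>carrier R. \<eta> x * \<chi> (s \<otimes> x))"
    using \<eta>_cases[OF s] s by (intro sum.cong) (auto simp: \<eta>_mult)
  finally show ?thesis by simp
qed

lemma sum_quadratic:
  assumes s: "s \<in> carrier R" "s \<noteq> \<zero>"
  shows "(\<Sum>x\<in>carrier R. \<chi> (s \<otimes> (x \<otimes> x))) = \<eta> s * gauss"
  using sum_quadratic_\<eta>[OF s] sum_\<eta>_char[OF s] by simp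

text \<open>Substituting x = t + y in the squared modulus makes the exponent t^2 + 2 t y linear in
  \<open>y\<close>, so only t = 0 survives.\<close>

lemma norm_gauss: "cmod gauss = sqrt (real (order R))"
proof -
  have "gauss * cnj gauss = (\<Sum>x\<in>carrier R. \<Sum>y\<in>carrier R. \<chi> (x \<otimes> x) * cnj (\<chi> (y \<otimes> y)))"
    unfolding gauss_def cnj_sum sum_product ..
  also have "\<dots> = (\<Sum>y\<in>carrier R. \<Sum>x\<in>carrier R. \<chi> (x \<otimes> x \<ominus> y \<otimes> y))"
    by (subst sum.swap) (simp add: char_diff)
  also have "\<dots> = (\<Sum>y\<in>carrier R. \<Sum>t\<in>carrier R. \<chi> ((t \<oplus> y) \<otimes> (t \<oplus> y) \<ominus> y \<otimes> y))"
  proof (rule sum.cong[OF refl])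
    fix y assume "y \<in> carrier R"
    from sum.reindex_bij_betw[OF bij_add[OF this], of "\<lambda>x. \<chi> (x \<otimes> x \<ominus> y \<otimes> y)"]
    show "(\<Sum>x\<in>carrier R. \<chi> (x \<otimes> x \<ominus> y \<otimes> y)) = (\<Sum>t\<in>carrier R. \<chi> ((t \<oplus> y) \<otimes> (t \<oplus> y) \<ominus> y \<otimes> y))"
      by simp
  qed
  also have "\<dots> = (\<Sum>t\<in>carrier R. \<Sum>y\<in>carrier R. \<chi> (t \<otimes> t) * \<chi> ((t \<oplus> t) \<otimes> y))"
  proof (subst sum.swap, intro sum.cong refl)
    fix t y assume ty: "t \<in> carrier R" "y \<in> carrier R"
    have "(t \<oplus> y) \<otimes> (t \<oplus> y) \<ominus> y \<otimes> y = t \<otimes> t \<oplus> (t \<oplus> t) \<otimes> y" using ty by algebra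
    then show "\<chi> ((t \<oplus> y) \<otimes> (t \<oplus> y) \<ominus> y \<otimes> y) = \<chi> (t \<otimes> t) * \<chi> ((t \<oplus> t) \<otimes> y)"
      using ty by (simp add: char_add)
  qed
  also have "\<dots> = (\<Sum>t\<in>carrier R. if t = \<zero> then of_nat (order R) else 0)"
    by (intro sum.cong) (auto simp: sum_char_mult simp flip: sum_distrib_left)
  finally have "gauss * cnj gauss = of_nat (order R)" by simp
  then have "of_real ((cmod gauss)\<^sup>2) = (of_nat (order R) :: complex)"
    by (simp only: complex_norm_square)
  then have "(cmod gauss)\<^sup>2 = real (order R)" by (metis of_real_eq_iff of_real_of_nat_eq)
  then show ?thesis by (metis norm_ge_zero real_sqrt_abs abs_of_nonneg)
qed

text \<open>Multiplying by a Gauss sum and completing the square linearises the exponent in \<open>s\<close>.\<close>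

lemma salie_bound:
  assumes AB: "A \<in> carrier R" "B \<in> carrier R" "A \<noteq> \<zero>" "B \<noteq> \<zero>"
  shows "cmod (\<Sum>s\<in>carrier R - {\<zero>}. \<eta> s * \<chi> (A \<otimes> s \<oplus> B \<otimes> inv s)) \<le> 2 * sqrt (real (order R))"
    (is "cmod ?T \<le> _")
proof (cases "nsqrt (B \<otimes> inv A) = 0")
  case True
  let ?D = "carrier R - {\<zero>}" and ?k = "B \<otimes> inv A"
  have k: "?k \<in> carrier R" "?k \<noteq> \<zero>" using AB by auto
  \<comment> \<open>If k = B / A is a nonsquare, s -> k / s swaps the two terms of the exponent and
    changes the sign of \<open>\<eta>\<close>; hence the sum equals its negative.\<close>
  have bij: "bij_betw (\<lambda>s. ?k \<otimes> inv s) ?D ?D"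
    using bij_betw_trans[OF bij_inv bij_mult_nonzero[OF k]] by (simp add: o_def)
  have "?T = (\<Sum>s\<in>?D. \<eta> (?k \<otimes> inv s) * \<chi> (A \<otimes> (?k \<otimes> inv s) \<oplus> B \<otimes> inv (?k \<otimes> inv s)))"
    using sum.reindex_bij_betw[OF bij, of "\<lambda>s. \<eta> s * \<chi> (A \<otimes> s \<oplus> B \<otimes> inv s)"] by simp
  also have "\<dots> = (\<Sum>s\<in>?D. - (\<eta> s * \<chi> (A \<otimes> s \<oplus> B \<otimes> inv s)))"
  proof (rule sum.cong[OF refl])
    fix s assume "s \<in> ?D"
    then have s: "s \<in> carrier R" "s \<noteq> \<zero>" by auto
    have "\<eta> (?k \<otimes> inv s) = - \<eta> s" using s k True by (simp add: \<eta>_mult \<eta>_inv \<eta>_nonsquare)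
    moreover have "A \<otimes> (?k \<otimes> inv s) = B \<otimes> inv s"
    proof -
      have "A \<otimes> (?k \<otimes> inv s) = (A \<otimes> inv A) \<otimes> (B \<otimes> inv s)"
        using AB(1,2) inv_closed'[OF AB(1,3)] inv_closed'[OF s] by algebra
      then show ?thesis using AB s by simp
    qed
    moreover have "B \<otimes> inv (?k \<otimes> inv s) = A \<otimes> s"
    proof -
      have "inv (?k \<otimes> inv s) = inv B \<otimes> A \<otimes> s"
        using AB s k by (simp add: inv_mult_distrib)
      then have "B \<otimes> inv (?k \<otimes> inv s) = (B \<otimes> inv B) \<otimes> (A \<otimes> s)"
        using AB s by (simp add: m_assoc del: r_inv')
      then show ?thesis using AB s by simp
    qed
    ultimately show "\<eta> (?k \<otimes> inv s) * \<chi> (A \<otimes> (?k \<otimes> inv s) \<oplus> B \<otimes> inv (?k \<otimes> inv s)) =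
        - (\<eta> s * \<chi> (A \<otimes> s \<oplus> B \<otimes> inv s))" using AB s by (simp add: a_comm)
  qed
  finally have "?T = - ?T" by (simp add: sum_negf)
  then have "?T = 0" by simp
  then show ?thesis by simp
next
  case False
  let ?D = "carrier R - {\<zero>}" and ?q = "of_nat (order R) :: complex"
  obtain c where c: "c \<in> carrier R" "c \<otimes> c = B \<otimes> inv A" using False nsqrt_pos_iff by auto
  have cA: "A \<otimes> (c \<otimes> c) = B" unfolding c(2) using AB m_lcomm[of A B "inv A"] by simp
  then have c0: "c \<noteq> \<zero>" using AB by auto
  let ?e = "\<ominus> (A \<otimes> c \<oplus> A \<otimes> c)"
  have e: "?e \<in> carrier R" "?e \<noteq> \<zero>" using AB c c0
    by (auto simp: add.inv_eq_1_iff)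
  have term_eq: "\<eta> s * (\<eta> (\<ominus> A) * gauss) * \<chi> (A \<otimes> s \<oplus> B \<otimes> inv s) =
      (\<Sum>y\<in>carrier R. \<chi> (?e \<otimes> y) * \<chi> ((A \<otimes> (\<one> \<ominus> y \<otimes> y)) \<otimes> s))" if "s \<in> ?D" for s
  proof -
    have s: "s \<in> carrier R" "s \<noteq> \<zero>" using that by auto
    have i: "inv s \<in> carrier R" "s \<otimes> inv s = \<one>" using s by auto
    have "\<ominus> A \<otimes> s \<noteq> \<zero>" using AB s by (simp add: add.inv_eq_1_iff)
    then have "\<eta> s * (\<eta> (\<ominus> A) * gauss) = (\<Sum>y\<in>carrier R. \<chi> (\<ominus> A \<otimes> s \<otimes> (y \<otimes> y)))"
      using sum_quadratic[of "\<ominus> A \<otimes> s"] AB s by (simp add: \<eta>_mult)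
    \<comment> \<open>Shifting y by c / s turns -A s y^2 + A s + B / s into -2 A c y + A (1 - y^2)
      s, because A c^2 = B.\<close>
    also have "\<dots> = (\<Sum>y\<in>carrier R. \<chi> (\<ominus> A \<otimes> s \<otimes> ((y \<oplus> c \<otimes> inv s) \<otimes> (y \<oplus> c \<otimes> inv s))))"
      using sum.reindex_bij_betw[OF bij_add[of "c \<otimes> inv s"], of "\<lambda>y. \<chi> (\<ominus> A \<otimes> s \<otimes> (y \<otimes> y))"] c i by simp
    finally have "\<eta> s * (\<eta> (\<ominus> A) * gauss) * \<chi> (A \<otimes> s \<oplus> B \<otimes> inv s) =
        (\<Sum>y\<in>carrier R. \<chi> (\<ominus> A \<otimes> s \<otimes> ((y \<oplus> c \<otimes> inv s) \<otimes> (y \<oplus> c \<otimes> inv s))) * \<chi> (A \<otimes> s \<oplus> B \<otimes> inv s))"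
      by (simp only: sum_distrib_right)
    also have "\<dots> = (\<Sum>y\<in>carrier R. \<chi> (?e \<otimes> y) * \<chi> ((A \<otimes> (\<one> \<ominus> y \<otimes> y)) \<otimes> s))"
    proof (rule sum.cong[OF refl])
      fix y assume y: "y \<in> carrier R"
      let ?j = "inv s"
      have "\<ominus> A \<otimes> s \<otimes> ((y \<oplus> c \<otimes> ?j) \<otimes> (y \<oplus> c \<otimes> ?j)) =
          \<ominus> (A \<otimes> s \<otimes> (y \<otimes> y)) \<ominus> (A \<otimes> c \<oplus> A \<otimes> c) \<otimes> y \<otimes> (s \<otimes> ?j) \<ominus> A \<otimes> (c \<otimes> c) \<otimes> (s \<otimes> ?j) \<otimes> ?j"
        using AB(1) s(1) y c(1) i(1) by algebra
      also have "\<dots> = \<ominus> (A \<otimes> s \<otimes> (y \<otimes> y)) \<ominus> (A \<otimes> c \<oplus> A \<otimes> c) \<otimes> y \<ominus> B \<otimes> ?j"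
        unfolding i(2) cA using AB s y c i(1) by simp
      finally have "\<ominus> A \<otimes> s \<otimes> ((y \<oplus> c \<otimes> ?j) \<otimes> (y \<oplus> c \<otimes> ?j)) \<oplus> (A \<otimes> s \<oplus> B \<otimes> ?j) =
         (\<ominus> (A \<otimes> s \<otimes> (y \<otimes> y)) \<ominus> (A \<otimes> c \<oplus> A \<otimes> c) \<otimes> y \<ominus> B \<otimes> ?j) \<oplus> (A \<otimes> s \<oplus> B \<otimes> ?j)" by simp
      also have "\<dots> = ?e \<otimes> y \<oplus> (A \<otimes> (\<one> \<ominus> y \<otimes> y)) \<otimes> s"
        using AB(1,2) s(1) y c(1) i(1) by algebra
      finally show "\<chi> (\<ominus> A \<otimes> s \<otimes> ((y \<oplus> c \<otimes> ?j) \<otimes> (y \<oplus> c \<otimes> ?j))) * \<chi> (A \<otimes> s \<oplus> B \<otimes> ?j) =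
          \<chi> (?e \<otimes> y) * \<chi> ((A \<otimes> (\<one> \<ominus> y \<otimes> y)) \<otimes> s)"
        using AB s y c i(1) by (simp flip: char_add)
    qed
    finally show ?thesis .
  qed
  have "?T * (\<eta> (\<ominus> A) * gauss) = (\<Sum>s\<in>?D. \<eta> s * (\<eta> (\<ominus> A) * gauss) * \<chi> (A \<otimes> s \<oplus> B \<otimes> inv s))"
    by (simp add: sum_distrib_right sum_distrib_left mult_ac)
  also have "\<dots> = (\<Sum>s\<in>?D. \<Sum>y\<in>carrier R. \<chi> (?e \<otimes> y) * \<chi> ((A \<otimes> (\<one> \<ominus> y \<otimes> y)) \<otimes> s))"
    using term_eq by (intro sum.cong) auto
  also have "\<dots> = (\<Sum>y\<in>carrier R. \<chi> (?e \<otimes> y) * (\<Sum>s\<in>?D. \<chi> ((A \<otimes> (\<one> \<ominus> y \<otimes> y)) \<otimes> s)))"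
    by (subst sum.swap) (simp add: sum_distrib_left)
  \<comment> \<open>The sum over nonzero s is |R| - 1 for y^2 = 1 and -1 otherwise. The
    contributions -1 cancel over all y since \<open>?e\<close> is nonzero, so at most two values of
    y remain.\<close>
  also have "\<dots> = (\<Sum>y\<in>carrier R. (if y \<otimes> y = \<one> then ?q * \<chi> (?e \<otimes> y) else 0) - \<chi> (?e \<otimes> y))"
  proof (rule sum.cong[OF refl])
    fix y assume y: "y \<in> carrier R"
    let ?c = "A \<otimes> (\<one> \<ominus> y \<otimes> y)"
    have c: "?c \<in> carrier R" "?c = \<zero> \<longleftrightarrow> y \<otimes> y = \<one>" using AB y by auto
    have "(\<Sum>s\<in>carrier R. \<chi> (?c \<otimes> s)) = \<chi> (?c \<otimes> \<zero>) + (\<Sum>s\<in>?D. \<chi> (?c \<otimes> s))"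
      by (rule sum.remove) auto
    then have S: "(\<Sum>s\<in>?D. \<chi> (?c \<otimes> s)) = (if y \<otimes> y = \<one> then ?q else 0) - 1"
      using sum_char_mult[OF c(1)] c by (simp add: eq_diff_eq add.commute)
    show "\<chi> (?e \<otimes> y) * (\<Sum>s\<in>?D. \<chi> (?c \<otimes> s)) = (if y \<otimes> y = \<one> then ?q * \<chi> (?e \<otimes> y) else 0) - \<chi> (?e \<otimes> y)"
      unfolding S by (cases "y \<otimes> y = \<one>") (simp_all add: right_diff_distrib)
  qed
  also have "\<dots> = (\<Sum>y\<in>carrier R. if y \<otimes> y = \<one> then ?q * \<chi> (?e \<otimes> y) else 0)"
    using sum_char_mult[OF e(1)] e(2) by (simp add: sum_subtractf)
  also have "\<dots> = (\<Sum>y | y \<in> carrier R \<and> y \<otimes> y = \<one>. ?q * \<chi> (?e \<otimes> y))"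
    by (simp add: sum.If_cases Int_def)
  finally have "cmod (?T * (\<eta> (\<ominus> A) * gauss)) \<le> (\<Sum>y | y \<in> carrier R \<and> y \<otimes> y = \<one>. cmod (?q * \<chi> (?e \<otimes> y)))"
    by (simp add: norm_sum)
  also have "\<dots> = real (nsqrt \<one>) * real (order R)"
    using e by (simp add: norm_mult norm_char nsqrt_def)
  also have "\<dots> \<le> 2 * real (order R)" using nsqrt_le[of \<one>] by (intro mult_right_mono) auto
  finally have "cmod (?T * (\<eta> (\<ominus> A) * gauss)) \<le> 2 * real (order R)" .
  moreover have "cmod (\<eta> (\<ominus> A)) = 1"
    using \<eta>_cases[of "\<ominus> A"] AB by (auto simp: add.inv_eq_1_iff)
  ultimately have "cmod ?T * sqrt (real (order R)) \<le> 2 * sqrt (real (order R)) * sqrt (real (order R))"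
    by (simp add: norm_mult norm_gauss mult.assoc)
  then show ?thesis using order_pos by (simp add: mult_le_cancel_right)
qed

text \<open>Collects the Kloosterman, Salie, Gauss and degenerate cases. For even \<open>d\<close>
  the condition on \<open>A\<close> keeps out A = B = 0, where the sum would be |R| - 1; with A = -t
  it becomes the exclusion of radius 0.\<close>

lemma twisted_kloosterman_bound:
  assumes AB: "A \<in> carrier R" "B \<in> carrier R" and A: "A \<noteq> \<zero> \<or> odd d"
  shows "cmod (\<Sum>s\<in>carrier R - {\<zero>}. \<eta> s ^ d * \<chi> (A \<otimes> s \<oplus> B \<otimes> inv s)) \<le> 2 * sqrt (real (order R))"
proof -
  let ?D = "carrier R - {\<zero>}"
  have sq: "1 \<le> sqrt (real (order R))" using order_pos by simp
  then have sq2: "1 \<le> 2 * sqrt (real (order R))" by linarith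
  have pow: "\<eta> s ^ d = (if even d then 1 else \<eta> s)" if "s \<in> ?D" for s
    using \<eta>_cases[of s] that by (auto simp: power_minus_odd)
  have split: "(\<Sum>s\<in>?D. \<eta> s * g s) = (\<Sum>s\<in>carrier R. \<eta> s * g s)" for g
    by (rule sum.mono_neutral_left) auto
  show ?thesis
  proof (cases "even d")
    case True
    then have A0: "A \<noteq> \<zero>" using A by simp
    have eq: "(\<Sum>s\<in>?D. \<eta> s ^ d * \<chi> (A \<otimes> s \<oplus> B \<otimes> inv s)) = kloosterman R \<chi> A B"
      unfolding kloosterman_def using pow True by (intro sum.cong) auto
    show ?thesis
    proof (cases "B = \<zero>")
      case True
      then have "kloosterman R \<chi> A B = (\<Sum>s\<in>?D. \<chi> (A \<otimes> s))"
        unfolding kloosterman_def using AB by (intro sum.cong) auto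
      then show ?thesis unfolding eq using sum_char_mult_nonzero[OF AB(1) A0] sq2 by simp
    next
      case False
      then show ?thesis unfolding eq using kloosterman_bound AB A0 by blast
    qed
  next
    case False
    have eq: "(\<Sum>s\<in>?D. \<eta> s ^ d * \<chi> (A \<otimes> s \<oplus> B \<otimes> inv s)) = (\<Sum>s\<in>?D. \<eta> s * \<chi> (A \<otimes> s \<oplus> B \<otimes> inv s))"
      using pow False by (intro sum.cong) auto
    have single: "cmod (\<Sum>s\<in>?D. \<eta> s * \<chi> (C \<otimes> s)) \<le> 2 * sqrt (real (order R))" if C: "C \<in> carrier R" for C
    proof (cases "C = \<zero>")
      case True
      have "(\<Sum>s\<in>?D. \<eta> s * \<chi> (C \<otimes> s)) = (\<Sum>s\<in>?D. \<eta> s)" using True by (intro sum.cong) auto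
      then show ?thesis using sum_\<eta>_nonzero by simp
    next
      case False
      then show ?thesis unfolding split sum_\<eta>_char[OF C False]
        using \<eta>_cases[OF C False] sq by (auto simp: norm_mult norm_gauss)
    qed
    show ?thesis
    proof (cases "A = \<zero>")
      case True
      have "(\<Sum>s\<in>?D. \<eta> s * \<chi> (A \<otimes> s \<oplus> B \<otimes> inv s)) = (\<Sum>s\<in>?D. \<eta> (inv s) * \<chi> (B \<otimes> inv s))"
        using AB True by (intro sum.cong) (auto simp: \<eta>_inv)
      also have "\<dots> = (\<Sum>s\<in>?D. \<eta> s * \<chi> (B \<otimes> s))"
        by (rule sum.reindex_bij_betw[OF bij_inv])
      finally show ?thesis unfolding eq using single[OF AB(2)] by simp
    next
      case A0: False
      show ?thesis
      proof (cases "B = \<zero>")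
        case True
        have "(\<Sum>s\<in>?D. \<eta> s * \<chi> (A \<otimes> s \<oplus> B \<otimes> inv s)) = (\<Sum>s\<in>?D. \<eta> s * \<chi> (A \<otimes> s))"
          using AB True by (intro sum.cong) auto
        then show ?thesis unfolding eq using single[OF AB(1)] by simp
      next
        case False
        then show ?thesis unfolding eq using salie_bound AB A0 by blast
      qed
    qed
  qed
qed

end

section \<open>The Fourier transform of spheres\<close>

locale vector_character = odd_field_character R \<chi> for R (structure) and \<chi> +
  fixes d :: nat
begin

abbreviation V :: "(nat \<Rightarrow> 'a) set" where "V \<equiv> vec_space R d"

definition vadd :: "(nat \<Rightarrow> 'a) \<Rightarrow> (nat \<Rightarrow> 'a) \<Rightarrow> nat \<Rightarrow> 'a" where
  "vadd x y = (\<lambda>i\<in>{..<d}. x i \<oplus> y i)"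

definition vsub :: "(nat \<Rightarrow> 'a) \<Rightarrow> (nat \<Rightarrow> 'a) \<Rightarrow> nat \<Rightarrow> 'a" where
  "vsub x y = (\<lambda>i\<in>{..<d}. x i \<ominus> y i)"

text \<open>Written as a product over coordinates so that sums over the space factor;
  \<open>\<psi>_dot\<close> connects it with the character of the dot product.\<close>

definition \<psi> :: "(nat \<Rightarrow> 'a) \<Rightarrow> (nat \<Rightarrow> 'a) \<Rightarrow> complex" where
  "\<psi> w x = (\<Prod>i<d. \<chi> (w i \<otimes> x i))"

lemma finite_V [simp]: "finite V"
  unfolding vec_space_def by (intro finite_PiE) auto

lemma V_closed: "x \<in> V \<Longrightarrow> i < d \<Longrightarrow> x i \<in> carrier R"
  unfolding vec_space_def by auto

lemma V_eqI: "x \<in> V \<Longrightarrow> y \<in> V \<Longrightarrow> (\<And>i. i < d \<Longrightarrow> x i = y i) \<Longrightarrow> x = y"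
  unfolding vec_space_def by (erule PiE_ext) auto

lemma zero_vec_V [simp]: "zero_vec R d \<in> V"
  unfolding vec_space_def zero_vec_def by auto

lemma vadd_V [simp]: "x \<in> V \<Longrightarrow> y \<in> V \<Longrightarrow> vadd x y \<in> V"
  unfolding vec_space_def vadd_def by (auto simp: PiE_iff)

lemma vsub_V [simp]: "x \<in> V \<Longrightarrow> y \<in> V \<Longrightarrow> vsub x y \<in> V"
  unfolding vec_space_def vsub_def by (auto simp: PiE_iff)

lemma vsub_vadd: "x \<in> V \<Longrightarrow> y \<in> V \<Longrightarrow> vsub (vadd x y) y = x"
  by (rule V_eqI[OF vsub_V[OF vadd_V]]) (auto simp: vsub_def vadd_def V_closed a_assoc minus_eq r_neg)

lemma sum_V_prod:
  fixes g :: "nat \<Rightarrow> 'a \<Rightarrow> complex"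
  shows "(\<Sum>x\<in>V. \<Prod>i<d. g i (x i)) = (\<Prod>i<d. \<Sum>a\<in>carrier R. g i a)"
  unfolding vec_space_def by (rule prod_sum_PiE[symmetric]) auto

lemma \<psi>_dot: "w \<in> V \<Longrightarrow> x \<in> V \<Longrightarrow> \<chi> (dot_prod R d w x) = \<psi> w x"
  unfolding dot_prod_def \<psi>_def using V_closed by (intro char_finsum) auto

lemma dot_closed: "w \<in> V \<Longrightarrow> x \<in> V \<Longrightarrow> dot_prod R d w x \<in> carrier R"
  unfolding dot_prod_def using V_closed by (intro finsum_closed) auto

lemma \<psi>_add:
  assumes "w \<in> V" "x \<in> V" "y \<in> V"
  shows "\<psi> w (vadd x y) = \<psi> w x * \<psi> w y"
  unfolding \<psi>_def vadd_def prod.distrib[symmetric]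
  using assms V_closed by (intro prod.cong) (auto simp: r_distr char_add)

lemma \<psi>_sub:
  assumes "w \<in> V" "x \<in> V" "y \<in> V"
  shows "\<psi> w (vsub x y) = \<psi> w x * cnj (\<psi> w y)"
proof -
  have "\<chi> (w i \<otimes> (x i \<ominus> y i)) = \<chi> (w i \<otimes> x i) * cnj (\<chi> (w i \<otimes> y i))" if "i < d" for i
  proof -
    have c: "w i \<in> carrier R" "x i \<in> carrier R" "y i \<in> carrier R" using assms V_closed that by auto
    have "w i \<otimes> (x i \<ominus> y i) = w i \<otimes> x i \<ominus> w i \<otimes> y i" using c by algebra
    then show ?thesis using c by (simp add: char_diff)
  qed
  then show ?thesis unfolding \<psi>_def vsub_def by (simp add: prod.distrib[symmetric])
qed

lemma \<psi>_zero_left [simp]: "x \<in> V \<Longrightarrow> \<psi> (zero_vec R d) x = 1"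
  unfolding \<psi>_def zero_vec_def using V_closed by (intro prod.neutral) auto

lemma sum_\<psi>:
  assumes x: "x \<in> V"
  shows "(\<Sum>w\<in>V. \<psi> w x) = (if x = zero_vec R d then of_nat (order R) ^ d else 0)"
proof -
  have *: "(\<Sum>a\<in>carrier R. \<chi> (a \<otimes> x i)) = (if x i = \<zero> then of_nat (order R) else 0)" if "i < d" for i
    using sum_char_mult[of "x i"] V_closed[OF x that] by (simp add: m_comm)
  have "(\<Sum>w\<in>V. \<psi> w x) = (\<Prod>i<d. \<Sum>a\<in>carrier R. \<chi> (a \<otimes> x i))"
    unfolding \<psi>_def by (rule sum_V_prod[of "\<lambda>i a. \<chi> (a \<otimes> x i)"])
  also have "\<dots> = (\<Prod>i<d. if x i = \<zero> then of_nat (order R) else 0)"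
    using * by (intro prod.cong) auto
  also have "\<dots> = (if x = zero_vec R d then of_nat (order R) ^ d else 0)"
  proof (cases "x = zero_vec R d")
    case False
    then obtain i where "i < d" "x i \<noteq> \<zero>"
      using V_eqI[OF x zero_vec_V] unfolding zero_vec_def by auto
    then show ?thesis using False by (auto intro!: prod_zero)
  qed (simp add: zero_vec_def)
  finally show ?thesis .
qed

lemma sq_norm_closed [simp]: "x \<in> V \<Longrightarrow> sq_norm R d x \<in> carrier R"
  unfolding sq_norm_def using V_closed by (intro finsum_closed) auto

lemma char_sq_norm:
  assumes "x \<in> V" "c \<in> carrier R"
  shows "\<chi> (c \<otimes> sq_norm R d x) = (\<Prod>i<d. \<chi> (c \<otimes> (x i \<otimes> x i)))"
proof -
  have "c \<otimes> sq_norm R d x = (\<Oplus>i\<in>{..<d}. c \<otimes> (x i [^] (2::nat)))"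
    unfolding sq_norm_def using assms V_closed by (intro finsum_rdistr) auto
  also have "\<dots> = (\<Oplus>i\<in>{..<d}. c \<otimes> (x i \<otimes> x i))"
    using assms V_closed by (intro finsum_cong') (auto simp: numeral_2_eq_2)
  finally show ?thesis using assms V_closed by (simp add: char_finsum Pi_def)
qed

text \<open>The shift of \<open>a\<close> by w / (2 s) leaves a quadratic Gauss sum and the constant
  exponent -w^2 / (4 s).\<close>

lemma complete_square:
  assumes s: "s \<in> carrier R" "s \<noteq> \<zero>" and w: "w \<in> carrier R"
  shows "(\<Sum>a\<in>carrier R. \<chi> (s \<otimes> (a \<otimes> a)) * cnj (\<chi> (w \<otimes> a))) =
    \<chi> (\<ominus> (half \<one> \<otimes> half \<one>) \<otimes> inv s \<otimes> (w \<otimes> w)) * (\<eta> s * gauss)"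
proof -
  define i where "i = half \<one>"
  define j where "j = inv s"
  have i: "i \<in> carrier R" "i \<oplus> i = \<one>" unfolding i_def by auto
  have j: "j \<in> carrier R" "s \<otimes> j = \<one>" unfolding j_def using s by auto
  let ?c = "i \<otimes> (w \<otimes> j)"
  have "(\<Sum>a\<in>carrier R. \<chi> (s \<otimes> (a \<otimes> a)) * cnj (\<chi> (w \<otimes> a))) = (\<Sum>a\<in>carrier R. \<chi> (s \<otimes> (a \<otimes> a) \<ominus> w \<otimes> a))"
    using s w by (intro sum.cong) (auto simp: char_diff)
  also have "\<dots> = (\<Sum>a\<in>carrier R. \<chi> (s \<otimes> ((a \<oplus> ?c) \<otimes> (a \<oplus> ?c)) \<ominus> w \<otimes> (a \<oplus> ?c)))"
    using sum.reindex_bij_betw[OF bij_add[of ?c], of "\<lambda>a. \<chi> (s \<otimes> (a \<otimes> a) \<ominus> w \<otimes> a)"] i j w by simp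
  also have "\<dots> = (\<Sum>a\<in>carrier R. \<chi> (\<ominus> (i \<otimes> i) \<otimes> j \<otimes> (w \<otimes> w)) * \<chi> (s \<otimes> (a \<otimes> a)))"
  proof (rule sum.cong[OF refl])
    fix a assume a: "a \<in> carrier R"
    have "s \<otimes> ((a \<oplus> ?c) \<otimes> (a \<oplus> ?c)) \<ominus> w \<otimes> (a \<oplus> ?c) =
        s \<otimes> (a \<otimes> a) \<oplus> ((i \<oplus> i) \<otimes> (s \<otimes> j) \<otimes> w \<otimes> a \<ominus> w \<otimes> a) \<oplus> (i \<otimes> i \<otimes> (s \<otimes> j) \<otimes> j \<otimes> (w \<otimes> w) \<ominus> i \<otimes> w \<otimes> (w \<otimes> j))"
      using s(1) w a i(1) j(1) by algebra
    also have "\<dots> = s \<otimes> (a \<otimes> a) \<oplus> (i \<otimes> i \<otimes> j \<otimes> (w \<otimes> w) \<ominus> (i \<oplus> i) \<otimes> i \<otimes> w \<otimes> (w \<otimes> j))"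
      unfolding i(2) j(2) using s(1) w a i(1) j(1) by algebra
    also have "\<dots> = s \<otimes> (a \<otimes> a) \<oplus> (\<ominus> (i \<otimes> i) \<otimes> j \<otimes> (w \<otimes> w))"
      using s(1) w a i(1) j(1) by algebra
    finally show "\<chi> (s \<otimes> ((a \<oplus> ?c) \<otimes> (a \<oplus> ?c)) \<ominus> w \<otimes> (a \<oplus> ?c)) =
        \<chi> (\<ominus> (i \<otimes> i) \<otimes> j \<otimes> (w \<otimes> w)) * \<chi> (s \<otimes> (a \<otimes> a))"
      using s(1) w a i(1) j(1) by (simp add: char_add)
  qed
  also have "\<dots> = \<chi> (\<ominus> (i \<otimes> i) \<otimes> j \<otimes> (w \<otimes> w)) * (\<eta> s * gauss)"
    using sum_quadratic[OF s] by (simp add: sum_distrib_left[symmetric])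
  finally show ?thesis unfolding i_def j_def .
qed

definition sphere_sum :: "'a \<Rightarrow> (nat \<Rightarrow> 'a) \<Rightarrow> complex" where
  "sphere_sum t w = (\<Sum>z | z \<in> V \<and> sq_norm R d z = t. cnj (\<psi> w z))"

text \<open>The equation |z|^2 = t is detected by averaging \<open>\<chi>\<close> at s (|z|^2 - t)
  over s. The value s = 0 gives the term at the zero frequency; for s nonzero the sum over z factors
  into one-dimensional Gauss sums.\<close>

lemma sphere_sum_eq:
  assumes w: "w \<in> V" and t: "t \<in> carrier R"
  shows "of_nat (order R) * sphere_sum t w = (if w = zero_vec R d then of_nat (order R) ^ d else 0) +
    gauss ^ d * (\<Sum>s\<in>carrier R - {\<zero>}. \<eta> s ^ d *
      \<chi> (\<ominus> t \<otimes> s \<oplus> (\<ominus> (half \<one> \<otimes> half \<one>) \<otimes> sq_norm R d w) \<otimes> inv s))"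
proof -
  let ?q = "of_nat (order R) :: complex" and ?D = "carrier R - {\<zero>}" and ?\<kappa> = "\<ominus> (half \<one> \<otimes> half \<one>)"
  let ?g = "\<lambda>s. \<Sum>z\<in>V. \<chi> (s \<otimes> (sq_norm R d z \<ominus> t)) * cnj (\<psi> w z)"
  have "?q * sphere_sum t w = (\<Sum>z\<in>V. (if sq_norm R d z = t then ?q else 0) * cnj (\<psi> w z))"
    unfolding sphere_sum_def by (simp add: if_distrib[of "\<lambda>x. x * _"] sum.If_cases Int_def sum_distrib_left)
  also have "\<dots> = (\<Sum>z\<in>V. (\<Sum>s\<in>carrier R. \<chi> (s \<otimes> (sq_norm R d z \<ominus> t))) * cnj (\<psi> w z))"
  proof (rule sum.cong[OF refl])
    fix z assume z: "z \<in> V"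
    then show "(if sq_norm R d z = t then ?q else 0) * cnj (\<psi> w z) =
        (\<Sum>s\<in>carrier R. \<chi> (s \<otimes> (sq_norm R d z \<ominus> t))) * cnj (\<psi> w z)"
      using sum_char_mult[of "sq_norm R d z \<ominus> t"] t by (simp add: m_comm)
  qed
  also have "\<dots> = (\<Sum>s\<in>carrier R. ?g s)"
    unfolding sum_distrib_right by (rule sum.swap)
  also have "\<dots> = ?g \<zero> + (\<Sum>s\<in>?D. ?g s)" by (rule sum.remove) auto
  also have "?g \<zero> = (if w = zero_vec R d then ?q ^ d else 0)"
  proof -
    have "?g \<zero> = cnj (\<Sum>z\<in>V. \<psi> w z)" using t by (simp add: cnj_sum)
    also have "(\<Sum>z\<in>V. \<psi> w z) = (\<Sum>z\<in>V. \<psi> z w)"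
      unfolding \<psi>_def using w V_closed by (intro sum.cong prod.cong) (auto simp: m_comm)
    finally show ?thesis using sum_\<psi>[OF w] by simp
  qed
  also have "(\<Sum>s\<in>?D. ?g s) = (\<Sum>s\<in>?D. gauss ^ d * (\<eta> s ^ d * \<chi> (\<ominus> t \<otimes> s \<oplus> (?\<kappa> \<otimes> sq_norm R d w) \<otimes> inv s)))"
  proof (rule sum.cong[OF refl])
    fix s assume "s \<in> ?D"
    then have s: "s \<in> carrier R" "s \<noteq> \<zero>" "inv s \<in> carrier R" by auto
    have "?g s = (\<Sum>z\<in>V. \<chi> (\<ominus> t \<otimes> s) * (\<Prod>i<d. \<chi> (s \<otimes> (z i \<otimes> z i)) * cnj (\<chi> (w i \<otimes> z i))))"
    proof (rule sum.cong[OF refl])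
      fix z assume z: "z \<in> V"
      have "s \<otimes> (n \<ominus> t) = \<ominus> t \<otimes> s \<oplus> s \<otimes> n" if "n \<in> carrier R" for n using that s t by algebra
      then have "\<chi> (s \<otimes> (sq_norm R d z \<ominus> t)) = \<chi> (\<ominus> t \<otimes> s) * \<chi> (s \<otimes> sq_norm R d z)"
        using z s t by (simp add: char_add)
      then show "\<chi> (s \<otimes> (sq_norm R d z \<ominus> t)) * cnj (\<psi> w z) =
          \<chi> (\<ominus> t \<otimes> s) * (\<Prod>i<d. \<chi> (s \<otimes> (z i \<otimes> z i)) * cnj (\<chi> (w i \<otimes> z i)))"
        using z s by (simp add: char_sq_norm \<psi>_def prod.distrib)
    qed
    also have "\<dots> = \<chi> (\<ominus> t \<otimes> s) * (\<Prod>i<d. \<Sum>a\<in>carrier R. \<chi> (s \<otimes> (a \<otimes> a)) * cnj (\<chi> (w i \<otimes> a)))"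
      unfolding sum_distrib_left[symmetric]
      using sum_V_prod[of "\<lambda>i a. \<chi> (s \<otimes> (a \<otimes> a)) * cnj (\<chi> (w i \<otimes> a))"] by simp
    also have "\<dots> = \<chi> (\<ominus> t \<otimes> s) * (\<Prod>i<d. \<chi> (?\<kappa> \<otimes> inv s \<otimes> (w i \<otimes> w i)) * (\<eta> s * gauss))"
      using complete_square[OF s(1,2)] V_closed[OF w] by simp
    also have "\<dots> = \<chi> (\<ominus> t \<otimes> s) * (\<chi> (?\<kappa> \<otimes> inv s \<otimes> sq_norm R d w) * (\<eta> s * gauss) ^ d)"
      using char_sq_norm[OF w, of "?\<kappa> \<otimes> inv s"] s by (simp add: prod.distrib)
    also have "?\<kappa> \<otimes> inv s \<otimes> sq_norm R d w = ?\<kappa> \<otimes> sq_norm R d w \<otimes> inv s"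
    proof -
      have "k \<otimes> l \<otimes> n = k \<otimes> n \<otimes> l" if "k \<in> carrier R" "l \<in> carrier R" "n \<in> carrier R" for k l n
        using that by algebra
      then show ?thesis using s w by simp
    qed
    finally show "?g s = gauss ^ d * (\<eta> s ^ d * \<chi> (\<ominus> t \<otimes> s \<oplus> (?\<kappa> \<otimes> sq_norm R d w) \<otimes> inv s))"
      using s t w by (simp add: char_add power_mult_distrib)
  qed
  finally show ?thesis by (simp add: sum_distrib_left)
qed

text \<open>The Gauss sums contribute |R|^(d/2) and the twisted Kloosterman sum at most 2 |R|^(1/2),
  all divided by |R|.\<close>

lemma sphere_sum_bound:
  assumes w: "w \<in> V" and t: "t \<in> carrier R" "t \<noteq> \<zero> \<or> odd d" and d: "1 \<le> d"
  shows "cmod (sphere_sum t w - (if w = zero_vec R d then of_nat (order R) ^ (d - 1) else 0))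
    \<le> 2 * sqrt (real (order R)) ^ (d - 1)"
proof -
  let ?q = "of_nat (order R) :: complex"
  let ?W = "\<Sum>s\<in>carrier R - {\<zero>}. \<eta> s ^ d *
      \<chi> (\<ominus> t \<otimes> s \<oplus> (\<ominus> (half \<one> \<otimes> half \<one>) \<otimes> sq_norm R d w) \<otimes> inv s)"
  let ?r = "sqrt (real (order R))"
  have r: "0 < ?r" "?r * ?r = real (order R)" using order_pos by auto
  have t': "\<ominus> t \<noteq> \<zero> \<or> odd d" using t by (auto simp: add.inv_eq_1_iff)
  have W: "cmod ?W \<le> 2 * ?r" using t w by (intro twisted_kloosterman_bound t') auto
  have "?q ^ d = ?q * ?q ^ (d - 1)" using d by (cases d) auto
  then have "?q * (sphere_sum t w - (if w = zero_vec R d then ?q ^ (d - 1) else 0)) = gauss ^ d * ?W"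
    using sphere_sum_eq[OF w t(1)] by (simp add: right_diff_distrib)
  from arg_cong[OF this, of cmod]
  have "real (order R) * cmod (sphere_sum t w - (if w = zero_vec R d then ?q ^ (d - 1) else 0)) = ?r ^ d * cmod ?W"
    by (simp only: norm_mult norm_of_nat norm_power norm_gauss)
  also have "\<dots> \<le> ?r ^ d * (2 * ?r)" using W by (intro mult_left_mono) auto
  also have "?r ^ d * (2 * ?r) = real (order R) * (2 * ?r ^ (d - 1))"
    using d r(2) by (cases d) (auto simp: algebra_simps)
  finally show ?thesis using order_pos by (simp add: mult_le_cancel_left)
qed

end

section \<open>Energies and the main theorem\<close>

context vector_character
begin

text \<open>Not normalised and with the opposite sign in the exponent compared to
  \<open>fourier\<close>, which keeps the counting identities free of factors;
  \<open>fourier_indicator\<close> translates.\<close>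

definition ehat :: "(nat \<Rightarrow> 'a) set \<Rightarrow> (nat \<Rightarrow> 'a) \<Rightarrow> complex" where
  "ehat A w = (\<Sum>x\<in>A. \<psi> w x)"

definition energy :: "(nat \<Rightarrow> 'a) set \<Rightarrow> nat \<Rightarrow> real" where
  "energy A l = (\<Sum>w\<in>V - {zero_vec R d}. cmod (ehat A w) ^ l)"

text \<open>Holds for products of exponential sums and their conjugates, whose transforms count
  representations. It is derived from closure under translation and summation, without setting up
  convolutions.\<close>

definition nonneg_hat :: "((nat \<Rightarrow> 'a) \<Rightarrow> complex) \<Rightarrow> bool" where
  "nonneg_hat G \<longleftrightarrow> (\<forall>x\<in>V. \<exists>r\<ge>0. (\<Sum>w\<in>V. \<psi> w x * G w) = of_real r)"

lemma ehat_zero: "A \<subseteq> V \<Longrightarrow> ehat A (zero_vec R d) = of_nat (card A)"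
  unfolding ehat_def using \<psi>_zero_left by (simp add: subset_iff)

lemma fourier_indicator:
  assumes "A \<subseteq> V" "w \<in> V"
  shows "fourier R d \<chi> (indicator A) w = 1 / of_nat (order R) ^ d * cnj (ehat A w)"
proof -
  have "(\<Sum>x\<in>V. \<chi> (\<ominus> dot_prod R d w x) * indicator A x) = (\<Sum>x\<in>V. if x \<in> A then cnj (\<psi> w x) else 0)"
    using assms by (intro sum.cong) (auto simp: char_minus dot_closed \<psi>_dot)
  also have "\<dots> = (\<Sum>x\<in>A. cnj (\<psi> w x))"
    using assms by (simp add: sum.If_cases Int_absorb1)
  finally show ?thesis unfolding fourier_def ehat_def by simp
qed

lemma nonneg_hat_one: "nonneg_hat (\<lambda>w. 1)"
  unfolding nonneg_hat_def
proof
  fix x assume "x \<in> V"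
  then show "\<exists>r\<ge>0. (\<Sum>w\<in>V. \<psi> w x * 1) = of_real r"
    by (intro exI[of _ "if x = zero_vec R d then real (order R) ^ d else 0"]) (simp add: sum_\<psi>)
qed

lemma nonneg_hat_char:
  assumes "nonneg_hat G" "y \<in> V"
  shows "nonneg_hat (\<lambda>w. \<psi> w y * G w)" "nonneg_hat (\<lambda>w. cnj (\<psi> w y) * G w)"
  unfolding nonneg_hat_def
proof (safe)
  fix x assume x: "x \<in> V"
  have "(\<Sum>w\<in>V. \<psi> w x * (\<psi> w y * G w)) = (\<Sum>w\<in>V. \<psi> w (vadd x y) * G w)"
    using x assms(2) by (intro sum.cong) (auto simp: \<psi>_add)
  then show "\<exists>r\<ge>0. (\<Sum>w\<in>V. \<psi> w x * (\<psi> w y * G w)) = of_real r"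
    using assms x unfolding nonneg_hat_def by simp
  have "(\<Sum>w\<in>V. \<psi> w x * (cnj (\<psi> w y) * G w)) = (\<Sum>w\<in>V. \<psi> w (vsub x y) * G w)"
    using x assms(2) by (intro sum.cong) (auto simp: \<psi>_sub)
  then show "\<exists>r\<ge>0. (\<Sum>w\<in>V. \<psi> w x * (cnj (\<psi> w y) * G w)) = of_real r"
    using assms x unfolding nonneg_hat_def by simp
qed

lemma nonneg_hat_sum:
  assumes "\<And>y. y \<in> A \<Longrightarrow> nonneg_hat (g y)"
  shows "nonneg_hat (\<lambda>w. \<Sum>y\<in>A. g y w)"
  unfolding nonneg_hat_def
proof
  fix x assume x: "x \<in> V"
  have "\<forall>y\<in>A. \<exists>r\<ge>0. (\<Sum>w\<in>V. \<psi> w x * g y w) = of_real r"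
    using assms x unfolding nonneg_hat_def by simp
  from bchoice[OF this]
  obtain r where r: "\<forall>y\<in>A. 0 \<le> r y \<and> (\<Sum>w\<in>V. \<psi> w x * g y w) = of_real (r y)" ..
  have "(\<Sum>w\<in>V. \<psi> w x * (\<Sum>y\<in>A. g y w)) = (\<Sum>y\<in>A. \<Sum>w\<in>V. \<psi> w x * g y w)"
    unfolding sum_distrib_left by (rule sum.swap)
  also have "\<dots> = of_real (\<Sum>y\<in>A. r y)" using r by simp
  finally show "\<exists>r\<ge>0. (\<Sum>w\<in>V. \<psi> w x * (\<Sum>y\<in>A. g y w)) = of_real r"
    using r by (intro exI[of _ "\<Sum>y\<in>A. r y"]) (auto intro: sum_nonneg)
qed

lemma nonneg_hat_ehat:
  assumes "nonneg_hat G" "A \<subseteq> V"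
  shows "nonneg_hat (\<lambda>w. ehat A w * G w)" "nonneg_hat (\<lambda>w. cnj (ehat A w) * G w)"
  using nonneg_hat_sum[of A "\<lambda>y w. \<psi> w y * G w"] nonneg_hat_sum[of A "\<lambda>y w. cnj (\<psi> w y) * G w"]
    nonneg_hat_char[OF assms(1)] assms(2)
  by (auto simp: ehat_def sum_distrib_right)

lemma sum_ehat_mult:
  "(\<Sum>w\<in>V. ehat A w * G w) = (\<Sum>x\<in>A. \<Sum>w\<in>V. \<psi> w x * G w)"
  unfolding ehat_def sum_distrib_right by (rule sum.swap)

text \<open>One of the factors \<open>ehat E\<close> is replaced by \<open>ehat A\<close>: the remaining product has a nonnegative
  transform, so enlarging \<open>E\<close> to \<open>A\<close> only increases the sum.\<close>

lemma energy_step: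
  assumes E: "E \<subseteq> A" "A \<subseteq> V" and \<kappa>: "\<And>w. w \<in> V - {zero_vec R d} \<Longrightarrow> cmod (ehat A w) \<le> \<kappa>"
  shows "energy E (2 * j + 2) \<le> real (card A) * real (card E) ^ (2 * j + 1) + \<kappa> * energy E (2 * j + 1)"
proof -
  let ?e = "ehat E"
  have EV: "E \<subseteq> V" using E by auto
  have fin: "finite A" using E(2) finite_V finite_subset by blast
  \<comment> \<open>The even power |ehat E|^(2 j + 2) with one factor \<open>ehat E\<close> taken
    out.\<close>
  define G where "G = (\<lambda>w. cnj (?e w) * (?e w * cnj (?e w)) ^ j)"
  have pow: "nonneg_hat (\<lambda>w. (?e w * cnj (?e w)) ^ j)"
  proof (induction j)
    case 0
    then show ?case using nonneg_hat_one by simp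
  next
    case (Suc j)
    from nonneg_hat_ehat(1)[OF nonneg_hat_ehat(2)[OF Suc EV] EV] show ?case
      by (simp add: mult.assoc)
  qed
  have G: "nonneg_hat G" unfolding G_def by (rule nonneg_hat_ehat(2)[OF pow EV])
  from bchoice[OF this[unfolded nonneg_hat_def]]
  obtain h where h: "\<forall>x\<in>V. 0 \<le> h x \<and> (\<Sum>w\<in>V. \<psi> w x * G w) = of_real (h x)" ..
  have sum_h: "(\<Sum>w\<in>V. ehat B w * G w) = of_real (\<Sum>x\<in>B. h x)" if "B \<subseteq> V" for B
    unfolding sum_ehat_mult using h that by (auto intro!: sum.cong)
  have eG: "?e w * G w = of_real (cmod (?e w) ^ (2 * j + 2))" for w
  proof -
    have "?e w * G w = (?e w * cnj (?e w)) ^ Suc j" unfolding G_def by (simp add: mult_ac)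
    also have "\<dots> = of_real (((cmod (?e w))\<^sup>2) ^ Suc j)"
      unfolding complex_norm_square[symmetric] by simp
    also have "((cmod (?e w))\<^sup>2) ^ Suc j = cmod (?e w) ^ (2 * Suc j)" by (rule power_mult[symmetric])
    also have "2 * Suc j = 2 * j + 2" by simp
    finally show ?thesis .
  qed
  have normG: "cmod (G w) = cmod (?e w) ^ (2 * j + 1)" for w
    unfolding G_def by (simp add: norm_mult norm_power power_mult power2_eq_square)
  have "energy E (2 * j + 2) \<le> (\<Sum>w\<in>V. cmod (?e w) ^ (2 * j + 2))"
    unfolding energy_def by (intro sum_mono2) auto
  also have "\<dots> = (\<Sum>x\<in>E. h x)"
  proof -
    have "of_real (\<Sum>w\<in>V. cmod (?e w) ^ (2 * j + 2)) = (\<Sum>w\<in>V. ?e w * G w)" by (simp add: eG)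
    also have "\<dots> = of_real (\<Sum>x\<in>E. h x)" by (rule sum_h[OF EV])
    finally show ?thesis by (simp only: of_real_eq_iff)
  qed
  also have "\<dots> \<le> (\<Sum>x\<in>A. h x)" using E h fin by (intro sum_mono2) auto
  also have "\<dots> \<le> cmod (\<Sum>w\<in>V. ehat A w * G w)" unfolding sum_h[OF E(2)] norm_of_real by (rule abs_ge_self)
  also have "\<dots> \<le> (\<Sum>w\<in>V. cmod (ehat A w) * cmod (?e w) ^ (2 * j + 1))"
    by (rule order_trans[OF norm_sum]) (simp add: norm_mult normG)
  also have "\<dots> = real (card A) * real (card E) ^ (2 * j + 1) +
      (\<Sum>w\<in>V - {zero_vec R d}. cmod (ehat A w) * cmod (?e w) ^ (2 * j + 1))"
    by (subst sum.remove[of _ "zero_vec R d"]) (simp_all add: ehat_zero EV E)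
  also have "(\<Sum>w\<in>V - {zero_vec R d}. cmod (ehat A w) * cmod (?e w) ^ (2 * j + 1)) \<le>
      (\<Sum>w\<in>V - {zero_vec R d}. \<kappa> * cmod (?e w) ^ (2 * j + 1))"
    using \<kappa> by (intro sum_mono mult_right_mono) auto
  finally show ?thesis by (simp add: energy_def sum_distrib_left)
qed

text \<open>Termwise, this is x <= (\<mu> x^2 + 1 / \<mu>) / 2 multiplied by x^(2 j), with a free
  weight \<open>\<mu>\<close>.\<close>

lemma energy_odd:
  assumes "0 < \<mu>"
  shows "energy E (2 * j + 1) \<le> (\<mu> * energy E (2 * j + 2) + energy E (2 * j) / \<mu>) / 2"
proof -
  have "x ^ (2 * j + 1) \<le> (\<mu> * x ^ (2 * j + 2) + x ^ (2 * j) / \<mu>) / 2" for x :: real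
  proof -
    have "0 \<le> x ^ (2 * j) * (\<mu> * x - 1)\<^sup>2 / \<mu>" using assms by (simp add: power_mult)
    also have "\<dots> = \<mu> * x ^ (2 * j + 2) + x ^ (2 * j) / \<mu> - 2 * x ^ (2 * j + 1)"
      using assms by (simp add: power2_eq_square field_simps)
    finally show ?thesis by simp
  qed
  then have "energy E (2 * j + 1) \<le> (\<Sum>w\<in>V - {zero_vec R d}.
      (\<mu> * cmod (ehat E w) ^ (2 * j + 2) + cmod (ehat E w) ^ (2 * j) / \<mu>) / 2)"
    unfolding energy_def by (intro sum_mono) blast
  then show ?thesis
    by (simp add: energy_def sum.distrib sum_distrib_left sum_divide_distrib[symmetric] flip: add_divide_distrib)
qed

text \<open>With the weight 1 / \<kappa> in \<open>energy_odd\<close>, the moment of order 2 j + 2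
  reappears with coefficient 1/2 and is absorbed on the left; this costs the factor 2.\<close>

lemma energy_recursion:
  assumes E: "E \<subseteq> A" "A \<subseteq> V" and \<kappa>: "\<And>w. w \<in> V - {zero_vec R d} \<Longrightarrow> cmod (ehat A w) \<le> \<kappa>" and "0 < \<kappa>"
  shows "energy E (2 * j + 2) \<le> 2 * real (card A) * real (card E) ^ (2 * j + 1) + \<kappa>\<^sup>2 * energy E (2 * j)"
proof -
  have "\<kappa> * energy E (2 * j + 1) \<le> \<kappa> * ((1 / \<kappa> * energy E (2 * j + 2) + energy E (2 * j) / (1 / \<kappa>)) / 2)"
    using energy_odd[of "1 / \<kappa>" E j] \<open>0 < \<kappa>\<close> by (intro mult_left_mono) auto
  also have "\<dots> = energy E (2 * j + 2) / 2 + \<kappa>\<^sup>2 * energy E (2 * j) / 2"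
    using \<open>0 < \<kappa>\<close> by (simp add: power2_eq_square field_simps)
  finally show ?thesis using energy_step[OF E \<kappa>, of j] by simp
qed

lemma vsub_zero_iff: "x \<in> V \<Longrightarrow> y \<in> V \<Longrightarrow> vsub x y = zero_vec R d \<longleftrightarrow> x = y"
proof
  assume xy: "x \<in> V" "y \<in> V" and eq: "vsub x y = zero_vec R d"
  show "x = y"
  proof (rule V_eqI[OF xy])
    fix i assume "i < d"
    then have "x i \<ominus> y i = \<zero>" using fun_cong[OF eq, of i] by (simp add: vsub_def zero_vec_def)
    then show "x i = y i" using xy V_closed \<open>i < d\<close> by simp
  qed
next
  assume "x \<in> V" "y \<in> V" "x = y"
  then show "vsub x y = zero_vec R d"
    by (intro V_eqI[OF vsub_V zero_vec_V]) (auto simp: vsub_def zero_vec_def V_closed minus_eq r_neg)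
qed

text \<open>Plancherel's identity with the zero frequency dropped.\<close>

lemma energy_two:
  assumes E: "E \<subseteq> V"
  shows "energy E 2 \<le> real (order R) ^ d * real (card E)"
proof -
  have fin: "finite E" using E finite_V finite_subset by blast
  have "of_real (\<Sum>w\<in>V. (cmod (ehat E w))\<^sup>2) = (\<Sum>w\<in>V. ehat E w * cnj (ehat E w))"
    by (simp only: of_real_sum complex_norm_square)
  also have "\<dots> = (\<Sum>x\<in>E. \<Sum>w\<in>V. \<psi> w x * cnj (ehat E w))" by (rule sum_ehat_mult)
  also have "\<dots> = (\<Sum>x\<in>E. of_nat (order R) ^ d)"
  proof (rule sum.cong[OF refl])
    fix x assume x: "x \<in> E"
    have "(\<Sum>w\<in>V. \<psi> w x * cnj (ehat E w)) = (\<Sum>y\<in>E. \<Sum>w\<in>V. \<psi> w x * cnj (\<psi> w y))"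
      unfolding ehat_def cnj_sum sum_distrib_left by (rule sum.swap)
    also have "\<dots> = (\<Sum>y\<in>E. \<Sum>w\<in>V. \<psi> w (vsub x y))"
      using x E by (intro sum.cong) (auto simp: \<psi>_sub subset_iff)
    also have "\<dots> = (\<Sum>y\<in>E. if x = y then of_nat (order R) ^ d else 0)"
    proof (rule sum.cong[OF refl])
      fix y assume "y \<in> E"
      then have "x \<in> V" "y \<in> V" using x E by auto
      then show "(\<Sum>w\<in>V. \<psi> w (vsub x y)) = (if x = y then of_nat (order R) ^ d else 0)"
        by (simp add: sum_\<psi> vsub_zero_iff)
    qed
    also have "\<dots> = of_nat (order R) ^ d" using x fin by simp
    finally show "(\<Sum>w\<in>V. \<psi> w x * cnj (ehat E w)) = of_nat (order R) ^ d" .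
  qed
  also have "\<dots> = of_real (real (order R) ^ d * real (card E))" by (simp add: mult.commute)
  finally have "(\<Sum>w\<in>V. (cmod (ehat E w))\<^sup>2) = real (order R) ^ d * real (card E)" by (simp only: of_real_eq_iff)
  moreover have "energy E 2 \<le> (\<Sum>w\<in>V. (cmod (ehat E w))\<^sup>2)" unfolding energy_def by (intro sum_mono2) auto
  ultimately show ?thesis by simp
qed

section \<open>Iterated differences and missing radii\<close>

fun reach :: "(nat \<Rightarrow> 'a) set \<Rightarrow> nat \<Rightarrow> (nat \<Rightarrow> 'a) set" where
  "reach E 0 = E"
| "reach E (Suc l) = {vsub a y | a y. a \<in> reach E l \<and> y \<in> E}"

text \<open>The sum is |R|^d times the number of ways to write \<open>z\<close> as x - y_1 - ... -
  y_l with all entries in \<open>E\<close>.\<close>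

lemma not_reach_zero:
  assumes E: "E \<subseteq> V"
  shows "z \<in> V \<Longrightarrow> z \<notin> reach E l \<Longrightarrow> (\<Sum>w\<in>V. cnj (\<psi> w z) * (ehat E w * cnj (ehat E w) ^ l)) = 0"
proof (induction l arbitrary: z)
  case 0
  have "(\<Sum>w\<in>V. cnj (\<psi> w z) * (ehat E w * cnj (ehat E w) ^ 0)) = (\<Sum>w\<in>V. ehat E w * cnj (\<psi> w z))"
    by (simp add: mult.commute)
  also have "\<dots> = (\<Sum>x\<in>E. \<Sum>w\<in>V. \<psi> w x * cnj (\<psi> w z))" by (rule sum_ehat_mult)
  also have "\<dots> = (\<Sum>x\<in>E. \<Sum>w\<in>V. \<psi> w (vsub x z))"
    using 0 E by (intro sum.cong) (auto simp: \<psi>_sub subset_iff)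
  also have "\<dots> = 0"
  proof (rule sum.neutral, rule ballI)
    fix x assume "x \<in> E"
    then have "x \<in> V" "x \<noteq> z" using 0 E by auto
    then show "(\<Sum>w\<in>V. \<psi> w (vsub x z)) = 0" using 0 by (simp add: sum_\<psi> vsub_zero_iff)
  qed
  finally show ?case .
next
  case (Suc l)
  let ?G = "\<lambda>w. ehat E w * cnj (ehat E w) ^ l"
  have "(\<Sum>w\<in>V. cnj (\<psi> w z) * (ehat E w * cnj (ehat E w) ^ Suc l)) =
      (\<Sum>w\<in>V. \<Sum>y\<in>E. cnj (\<psi> w y) * (cnj (\<psi> w z) * ?G w))"
    unfolding sum_distrib_right[symmetric] cnj_sum[symmetric] ehat_def[symmetric]
    by (intro sum.cong) (simp_all add: mult_ac)
  also have "\<dots> = (\<Sum>y\<in>E. \<Sum>w\<in>V. cnj (\<psi> w y) * (cnj (\<psi> w z) * ?G w))" by (rule sum.swap)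
  also have "\<dots> = 0"
  proof (rule sum.neutral, rule ballI)
    fix y assume y: "y \<in> E"
    then have yV: "y \<in> V" using E by auto
    have "vadd z y \<notin> reach E l"
    proof
      assume "vadd z y \<in> reach E l"
      then have "vsub (vadd z y) y \<in> reach E (Suc l)" using y by auto
      then show False using vsub_vadd[OF Suc.prems(1) yV] Suc.prems(2) by simp
    qed
    then have "(\<Sum>w\<in>V. cnj (\<psi> w (vadd z y)) * ?G w) = 0" using Suc.IH[of "vadd z y"] Suc.prems(1) yV by simp
    moreover have "(\<Sum>w\<in>V. cnj (\<psi> w y) * (cnj (\<psi> w z) * ?G w)) = (\<Sum>w\<in>V. cnj (\<psi> w (vadd z y)) * ?G w)"
      using Suc.prems(1) yV by (intro sum.cong) (auto simp: \<psi>_add)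
    ultimately show "(\<Sum>w\<in>V. cnj (\<psi> w y) * (cnj (\<psi> w z) * ?G w)) = 0" by simp
  qed
  finally show ?case .
qed

lemma reach_tuple:
  assumes E: "E \<subseteq> V"
  shows "z \<in> reach E l \<Longrightarrow>
    \<exists>x. (\<forall>j\<in>{1..Suc l}. x j \<in> E) \<and> z = (\<lambda>i\<in>{..<d}. x 1 i \<ominus> (\<Oplus>j\<in>{2..Suc l}. x j i))"
proof (induction l arbitrary: z)
  case 0
  then have z: "z \<in> E" "z \<in> V" using E by auto
  have "z = (\<lambda>i\<in>{..<d}. z i \<ominus> (\<Oplus>j\<in>{2..Suc 0}. z i))"
    using z(2) by (intro ext) (auto simp: V_closed minus_eq vec_space_def PiE_iff extensional_def)
  then show ?case using z by (intro exI[of _ "\<lambda>_. z"]) auto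
next
  case (Suc l)
  then obtain v y where vy: "v \<in> reach E l" "y \<in> E" "z = vsub v y" by auto
  then obtain x where x: "\<forall>j\<in>{1..Suc l}. x j \<in> E"
    "v = (\<lambda>i\<in>{..<d}. x 1 i \<ominus> (\<Oplus>j\<in>{2..Suc l}. x j i))" using Suc.IH by blast
  let ?x = "x(Suc (Suc l) := y)"
  have "x 1 i \<ominus> (\<Oplus>j\<in>{2..Suc l}. x j i) \<ominus> y i = ?x 1 i \<ominus> (\<Oplus>j\<in>{2..Suc (Suc l)}. ?x j i)" if i: "i < d" for i
  proof -
    have c: "x j i \<in> carrier R" if "j \<in> {1..Suc l}" for j using x(1) that E V_closed i by blast
    have y: "y i \<in> carrier R" using vy(2) E V_closed i by blast
    let ?s = "\<Oplus>j\<in>{2..Suc l}. x j i"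
    have s: "?s \<in> carrier R" using c by (intro finsum_closed) auto
    have "{2..Suc (Suc l)} = insert (Suc (Suc l)) {2..Suc l}" by auto
    then have "(\<Oplus>j\<in>{2..Suc (Suc l)}. ?x j i) = y i \<oplus> (\<Oplus>j\<in>{2..Suc l}. ?x j i)"
      using c y by (simp add: Pi_def)
    also have "(\<Oplus>j\<in>{2..Suc l}. ?x j i) = ?s" using c by (intro finsum_cong') auto
    finally have eq: "(\<Oplus>j\<in>{2..Suc (Suc l)}. ?x j i) = y i \<oplus> ?s" .
    have "u \<ominus> p \<ominus> r = u \<ominus> (r \<oplus> p)" if "u \<in> carrier R" "p \<in> carrier R" "r \<in> carrier R" for u p r
      using that by algebra
    then show ?thesis unfolding eq using c[of 1] s y by simp
  qed
  then have "z = (\<lambda>i\<in>{..<d}. ?x 1 i \<ominus> (\<Oplus>j\<in>{2..Suc (Suc l)}. ?x j i))"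
    unfolding vy(3) vsub_def x(2) by (intro restrict_ext) auto
  moreover have "\<forall>j\<in>{1..Suc (Suc l)}. ?x j \<in> E" using x(1) vy(2) by auto
  ultimately show ?case by blast
qed

text \<open>By Parseval, the pairing of the sphere transform with \<open>?G\<close> counts
  representations of points on the sphere, so it is 0 here. The zero frequency must then be
  cancelled by the others, where the sphere transform is at most 2 P.\<close>

lemma missing_distance:
  assumes E: "E \<subseteq> V" and t: "t \<in> carrier R" "t \<noteq> \<zero> \<or> odd d" and d: "1 \<le> d"
    and missing: "t \<notin> dist_set R d (Suc l) E"
    and P: "P = sqrt (real (order R)) ^ (d - 1)"
  shows "(P\<^sup>2 - 2 * P) * real (card E) ^ Suc l \<le> 2 * P * energy E (Suc l)"
proof -
  let ?G = "\<lambda>w. ehat E w * cnj (ehat E w) ^ l" and ?O = "zero_vec R d"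
  have P2: "P\<^sup>2 = real (order R) ^ (d - 1)"
    unfolding P by (simp flip: power_mult_distrib add: power2_eq_square)
  have "(\<Sum>w\<in>V. sphere_sum t w * ?G w) = (\<Sum>z | z \<in> V \<and> sq_norm R d z = t. \<Sum>w\<in>V. cnj (\<psi> w z) * ?G w)"
    unfolding sphere_sum_def sum_distrib_right by (rule sum.swap)
  also have "\<dots> = 0"
  proof (rule sum.neutral, rule ballI)
    fix z assume z: "z \<in> {z. z \<in> V \<and> sq_norm R d z = t}"
    have "z \<notin> reach E l"
    proof
      assume "z \<in> reach E l"
      from reach_tuple[OF E this] z have "t \<in> dist_set R d (Suc l) E" unfolding dist_set_def by blast
      then show False using missing by simp
    qed
    then show "(\<Sum>w\<in>V. cnj (\<psi> w z) * ?G w) = 0" using not_reach_zero[OF E] z by blast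
  qed
  finally have "sphere_sum t ?O * ?G ?O + (\<Sum>w\<in>V - {?O}. sphere_sum t w * ?G w) = 0"
    by (simp add: sum.remove[of _ ?O])
  then have eq: "cmod (sphere_sum t ?O * ?G ?O) = cmod (\<Sum>w\<in>V - {?O}. sphere_sum t w * ?G w)"
    unfolding add_eq_0_iff by (simp add: norm_minus_cancel)
  have bd: "cmod (sphere_sum t w - (if w = ?O then of_nat (order R) ^ (d - 1) else 0)) \<le> 2 * P" if "w \<in> V" for w
    unfolding P by (rule sphere_sum_bound[OF that t d])
  \<comment> \<open>At the zero frequency the transform is the number of points of the sphere, which
    differs from P^2 by at most 2 P.\<close>
  have "P\<^sup>2 - 2 * P \<le> cmod (sphere_sum t ?O)"
  proof -
    have "cmod (of_nat (order R) ^ (d - 1)) - cmod (sphere_sum t ?O) \<le> cmod (sphere_sum t ?O - of_nat (order R) ^ (d - 1))"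
      using norm_triangle_ineq2[of "of_nat (order R) ^ (d - 1)" "sphere_sum t ?O"] by (simp add: norm_minus_commute)
    then show ?thesis using bd[of ?O] by (simp add: norm_power P2)
  qed
  then have "(P\<^sup>2 - 2 * P) * real (card E) ^ Suc l \<le> cmod (sphere_sum t ?O) * real (card E) ^ Suc l"
    by (intro mult_right_mono) auto
  also have "\<dots> = cmod (sphere_sum t ?O * ?G ?O)" using ehat_zero[OF E] by (simp add: norm_mult norm_power)
  also have "\<dots> \<le> (\<Sum>w\<in>V - {?O}. cmod (sphere_sum t w * ?G w))" unfolding eq by (rule norm_sum)
  also have "\<dots> \<le> (\<Sum>w\<in>V - {?O}. 2 * P * cmod (ehat E w) ^ Suc l)"
  proof (rule sum_mono)
    fix w assume "w \<in> V - {?O}"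
    then have "cmod (sphere_sum t w) \<le> 2 * P" using bd[of w] by simp
    then show "cmod (sphere_sum t w * ?G w) \<le> 2 * P * cmod (ehat E w) ^ Suc l"
      by (simp add: norm_mult norm_power mult_right_mono)
  qed
  also have "\<dots> = 2 * P * energy E (Suc l)" by (simp add: energy_def sum_distrib_left)
  finally show ?thesis .
qed

end

text \<open>Measured against P N^(2 j + 2), the new term of the recursion has relative size 2 b / s,
  while the old bound is multiplied by (c P)^2 / N^2 = c^2 / s^2. So the start value q / s loses a
  factor s^2 per step and 1 / s persists. \<open>D\<close> absorbs both constants, and its summand 1
  ensures D >= 1.\<close>

lemma energy_estimate:
  fixes B :: "nat \<Rightarrow> real"
  assumes pos: "0 < b" "0 < P" "0 < N" "1 \<le> q" and D: "D = 2 * b + c\<^sup>2 + 1"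
    and s: "s = N / P" "1 \<le> s"
    and B2: "B 2 \<le> q * P\<^sup>2 * N"
    and rec: "\<And>j. B (2 * j + 2) \<le> 2 * (b * P\<^sup>2) * N ^ (2 * j + 1) + (c * P)\<^sup>2 * B (2 * j)"
  shows "B (2 * j + 2) \<le> D ^ Suc j * (P * N ^ (2 * j + 2)) * (1 / s + q / s ^ (2 * j + 1))"
proof -
  have N: "N = s * P" using s pos by simp
  have D1: "1 \<le> D" unfolding D using pos by simp
  show ?thesis
  proof (induction j)
    case 0
    have "B 2 \<le> P * N\<^sup>2 * (q / s)" using B2 s(2) unfolding N by (simp add: power2_eq_square field_simps)
    also have "\<dots> \<le> P * N\<^sup>2 * (1 / s + q / s)" using pos s(2) by (intro mult_left_mono) auto
    also have "\<dots> = 1 * (P * N\<^sup>2 * (1 / s + q / s))" by simp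
    also have "\<dots> \<le> D * (P * N\<^sup>2 * (1 / s + q / s))" using pos s(2) D1 by (intro mult_right_mono) auto
    finally show ?case by (simp add: mult.assoc numeral_2_eq_2)
  next
    case (Suc j)
    let ?X = "1 / s + q / s ^ (2 * j + 1)" and ?Y = "1 / s + q / s ^ (2 * j + 3)"
    have Dj: "1 \<le> D ^ Suc j" using D1 by (rule one_le_power)
    have "B (2 * Suc j + 2) \<le> 2 * (b * P\<^sup>2) * N ^ (2 * j + 3) + (c * P)\<^sup>2 * B (2 * j + 2)"
      using rec[of "Suc j"] by (simp add: eval_nat_numeral)
    also have "\<dots> \<le> 2 * (b * P\<^sup>2) * N ^ (2 * j + 3) + (c * P)\<^sup>2 * (D ^ Suc j * (P * N ^ (2 * j + 2)) * ?X)"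
      using Suc by (intro add_left_mono mult_left_mono) auto
    also have "2 * (b * P\<^sup>2) * N ^ (2 * j + 3) = P * N ^ (2 * j + 4) * (2 * b * (1 / s))"
      using s(2) unfolding N by (simp add: power2_eq_square field_simps eval_nat_numeral)
    also have "(c * P)\<^sup>2 * (D ^ Suc j * (P * N ^ (2 * j + 2)) * ?X) =
        P * N ^ (2 * j + 4) * (c\<^sup>2 * D ^ Suc j * (?X / s\<^sup>2))"
    proof -
      have "N ^ (2 * j + 4) = N ^ ((2 * j + 2) + 2)" by (rule arg_cong[of _ _ "power N"]) simp
      also have "\<dots> = N ^ (2 * j + 2) * N\<^sup>2" by (rule power_add)
      finally have "N ^ (2 * j + 4) = N ^ (2 * j + 2) * (s * P)\<^sup>2" unfolding N[symmetric] .
      then show ?thesis using s(2) by (simp add: power_mult_distrib)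
    qed
    also have "P * N ^ (2 * j + 4) * (2 * b * (1 / s)) + P * N ^ (2 * j + 4) * (c\<^sup>2 * D ^ Suc j * (?X / s\<^sup>2))
        \<le> P * N ^ (2 * j + 4) * (2 * b * D ^ Suc j * ?Y) + P * N ^ (2 * j + 4) * (c\<^sup>2 * D ^ Suc j * ?Y)"
    proof (intro add_mono mult_left_mono)
      have "1 / s \<le> D ^ Suc j * ?Y"
      proof -
        have "1 / s \<le> 1 * ?Y" using pos s(2) by simp
        also have "\<dots> \<le> D ^ Suc j * ?Y" using Dj pos s(2) by (intro mult_right_mono) auto
        finally show ?thesis .
      qed
      then show "2 * b * (1 / s) \<le> 2 * b * D ^ Suc j * ?Y"
        unfolding mult.assoc[of _ "D ^ Suc j"] using pos by (intro mult_left_mono) auto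
      have 1: "1 / s / s\<^sup>2 \<le> 1 / s / 1" using s(2) one_le_power[OF s(2), of 2] by (intro divide_left_mono) auto
      have 2: "q / s ^ (2 * j + 1) / s\<^sup>2 = q / s ^ (2 * j + 3)"
        by (simp add: power2_eq_square eval_nat_numeral mult_ac)
      show "?X / s\<^sup>2 \<le> ?Y" unfolding add_divide_distrib 2 using 1[unfolded div_by_1] by (rule add_right_mono)
    qed (use pos D1 in auto)
    also have "\<dots> = (P * N ^ (2 * j + 4) * D ^ Suc j * ?Y) * (2 * b + c\<^sup>2)"
    proof -
      have "x * (2 * b * y * z) + x * (c\<^sup>2 * y * z) = (x * y * z) * (2 * b + c\<^sup>2)" for x y z
        by (simp add: algebra_simps)
      then show ?thesis .
    qed
    also have "\<dots> \<le> (P * N ^ (2 * j + 4) * D ^ Suc j * ?Y) * D"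
      using pos s(2) D1 by (intro mult_left_mono) (auto simp: D)
    also have "\<dots> = D ^ Suc (Suc j) * (P * N ^ (2 * Suc j + 2)) * (1 / s + q / s ^ (2 * Suc j + 1))"
      by (simp add: eval_nat_numeral mult_ac)
    finally show ?case .
  qed
qed

text \<open>From s >= C \<rho> the leftover q / s^(k-1) of the second moment is at most C^(1-k), and
  k >= 3 makes this at most 1 / C^2. An even \<open>k\<close> is then read off from
  \<open>energy_estimate\<close>; for odd \<open>k\<close> the moment k - 1 carries an extra factor
  s, so the full 1 / C^2 is used.\<close>

lemma energy_threshold:
  fixes B :: "nat \<Rightarrow> real"
  assumes pos: "0 < b" "0 < P" "0 < N" "1 \<le> q" and D: "D = 2 * b + c\<^sup>2 + 1"
    and C: "1 \<le> C" "8 * D ^ k < C" and k: "3 \<le> k" and s: "s = N / P" and \<rho>: "1 \<le> \<rho>" "\<rho> ^ (k - 1) = q" "C * \<rho> \<le> s"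
    and B2: "B 2 \<le> q * P\<^sup>2 * N"
    and rec: "\<And>j. B (2 * j + 2) \<le> 2 * (b * P\<^sup>2) * N ^ (2 * j + 1) + (c * P)\<^sup>2 * B (2 * j)"
    and odd: "\<And>j \<mu>. 0 < \<mu> \<Longrightarrow> B (2 * j + 1) \<le> (\<mu> * B (2 * j + 2) + B (2 * j) / \<mu>) / 2"
  shows "4 * B k < P * N ^ k"
proof -
  have D1: "1 \<le> D" unfolding D using pos by simp
  have "C * 1 \<le> C * \<rho>" using C \<rho> by (intro mult_left_mono) auto
  then have sC: "C \<le> s" using \<rho> by simp
  then have s1: "1 \<le> s" using C by simp
  define \<xi> where "\<xi> = q / s ^ (k - 1)"
  have \<xi>0: "0 \<le> \<xi>" unfolding \<xi>_def using pos s1 by simp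
  have \<xi>C: "\<xi> \<le> 1 / C\<^sup>2"
  proof -
    have "C\<^sup>2 * q \<le> C ^ (k - 1) * \<rho> ^ (k - 1)"
      unfolding \<rho>(2) using C k pos by (intro mult_right_mono power_increasing) auto
    also have "\<dots> = (C * \<rho>) ^ (k - 1)" by (simp add: power_mult_distrib)
    also have "\<dots> \<le> s ^ (k - 1)" using C \<rho> by (intro power_mono) auto
    finally have "C\<^sup>2 * q \<le> s ^ (k - 1)" .
    then show ?thesis unfolding \<xi>_def using C s1 by (simp add: field_simps)
  qed
  have C2: "1 / C\<^sup>2 \<le> 1 / C" using C by (simp add: power2_eq_square field_simps)
  have inv_s: "1 / s \<le> 1 / C" using sC C by (simp add: frac_le)
  have est: "B (2 * j + 2) \<le> D ^ Suc j * (P * N ^ (2 * j + 2)) * (1 / s + q / s ^ (2 * j + 1))" for j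
    by (rule energy_estimate[OF pos D s s1 B2 rec])
  have PN: "0 < P * N ^ k" using pos by simp
  have "B k \<le> D ^ k * (P * N ^ k) * (2 / C)"
  proof (cases "even k")
    case True
    then obtain i where i: "k = 2 * i" by auto
    then obtain j where j: "k = 2 * j + 2" using k by (cases i) auto
    have "B k \<le> D ^ Suc j * (P * N ^ k) * (1 / s + \<xi>)" using est[of j] by (simp add: j \<xi>_def)
    also have "\<dots> \<le> D ^ k * (P * N ^ k) * (2 / C)"
    proof (intro mult_mono)
      show "D ^ Suc j \<le> D ^ k" using D1 j by (intro power_increasing) auto
      show "1 / s + \<xi> \<le> 2 / C" using inv_s \<xi>C C2 by simp
    qed (use pos D1 \<xi>0 s1 in auto)
    finally show ?thesis .
  next
    case False
    then obtain i where i: "k = 2 * i + 1" using oddE by blast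
    then obtain j where j: "k = 2 * j + 3" using k by (cases i) auto
    \<comment> \<open>This weight balances the bounds \<open>up\<close> and \<open>down\<close>:
      both terms become \<open>D ^ k * (P * N ^ k) * (2 / C)\<close>.\<close>
    define \<mu> where "\<mu> = s / (C * N)"
    have \<mu>: "0 < \<mu>" unfolding \<mu>_def using s1 C pos by simp
    have up: "B (2 * Suc j + 2) \<le> D ^ k * (P * N ^ (k + 1)) * (2 / s)"
    proof -
      have "B (2 * Suc j + 2) \<le> D ^ Suc (Suc j) * (P * N ^ (2 * Suc j + 2)) * (1 / s + q / s ^ (2 * Suc j + 1))"
        by (rule est)
      also have "\<dots> \<le> D ^ k * (P * N ^ (k + 1)) * (2 / s)"
      proof (intro mult_mono)
        show "D ^ Suc (Suc j) \<le> D ^ k" using D1 j by (intro power_increasing) auto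
        have "\<xi> \<le> 1" using \<xi>C C C2 by (smt (verit) divide_le_eq_1)
        moreover have "q / s ^ (2 * Suc j + 1) = \<xi> / s" unfolding \<xi>_def j by (simp add: eval_nat_numeral)
        ultimately have "q / s ^ (2 * Suc j + 1) \<le> 1 / s" using s1 by (simp add: divide_right_mono)
        then show "1 / s + q / s ^ (2 * Suc j + 1) \<le> 2 / s" by simp
      qed (use pos D1 s1 j in \<open>auto simp: eval_nat_numeral\<close>)
      finally show ?thesis .
    qed
    have down: "B (2 * j + 2) \<le> D ^ k * (P * N ^ (k - 1)) * (s * (2 / C\<^sup>2))"
    proof -
      have "B (2 * j + 2) \<le> D ^ Suc j * (P * N ^ (2 * j + 2)) * (1 / s + q / s ^ (2 * j + 1))"
        by (rule est)
      also have "\<dots> \<le> D ^ k * (P * N ^ (k - 1)) * (s * (2 / C\<^sup>2))"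
      proof (intro mult_mono)
        show "D ^ Suc j \<le> D ^ k" using D1 j by (intro power_increasing) auto
        have "C\<^sup>2 \<le> s\<^sup>2" using sC C by (intro power_mono) auto
        then have "1 / s\<^sup>2 \<le> 1 / C\<^sup>2" using C by (simp add: frac_le)
        then have "s * (1 / s\<^sup>2 + \<xi>) \<le> s * (2 / C\<^sup>2)" using \<xi>C s1 by (intro mult_left_mono) auto
        moreover have "s * (1 / s\<^sup>2 + \<xi>) = 1 / s + q / s ^ (2 * j + 1)"
          unfolding \<xi>_def j using s1 by (simp add: distrib_left power2_eq_square eval_nat_numeral)
        ultimately show "1 / s + q / s ^ (2 * j + 1) \<le> s * (2 / C\<^sup>2)" by simp
      qed (use pos D1 s1 j in auto)
      finally show ?thesis .
    qed
    have "B k \<le> (\<mu> * B (2 * Suc j + 2) + B (2 * j + 2) / \<mu>) / 2"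
      using odd[OF \<mu>, of "Suc j"] by (simp add: j eval_nat_numeral)
    also have "\<dots> \<le> (\<mu> * (D ^ k * (P * N ^ (k + 1)) * (2 / s)) + D ^ k * (P * N ^ (k - 1)) * (s * (2 / C\<^sup>2)) / \<mu>) / 2"
      using up down \<mu> by (intro divide_right_mono add_mono mult_left_mono) auto
    also have "\<dots> = D ^ k * (P * N ^ k) * (2 / C)"
    proof -
      have "N ^ (k + 1) = N ^ k * N" by simp
      moreover have "N ^ k = N ^ (k - 1) * N" using k by (cases k) auto
      ultimately show ?thesis unfolding \<mu>_def using s1 C pos by (simp add: field_simps power2_eq_square)
    qed
    finally show ?thesis .
  qed
  then have "4 * B k \<le> 8 * D ^ k / C * (P * N ^ k)" by simp
  also have "\<dots> < 1 * (P * N ^ k)" using PN C by (intro mult_strict_right_mono) auto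
  finally show ?thesis by simp
qed

theorem theorem2p2:
  fixes d k :: nat and a b c :: real
  assumes "d \<ge> 2" and "k \<ge> 3" and "a > 0" and "b > 0" and "c > 0"
  shows "\<exists>C>0. \<forall>(F :: 'a ring) \<chi> V E.
    field F \<longrightarrow> finite (carrier F) \<longrightarrow> odd (order F) \<longrightarrow>
    nontrivial_additive_character F \<chi> \<longrightarrow>
    regular_variety F d \<chi> a b c V \<longrightarrow> E \<subseteq> V \<longrightarrow>
    real (card E) \<ge> C * real (order F) powr ((real d - 1) / 2 + 1 / (real k - 1)) \<longrightarrow>
      (even d \<longrightarrow> carrier F - {\<zero>\<^bsub>F\<^esub>} \<subseteq> dist_set F d k E) \<and>
      (odd d \<longrightarrow> dist_set F d k E = carrier F)"
proof -
  define D where "D = 2 * b + c\<^sup>2 + 1"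
  \<comment> \<open>\<open>8 * D ^ k\<close> is for \<open>energy_threshold\<close>,
    \<open>4 * b\<close> forces P >= 4, and the 1 makes the first comparison strict.\<close>
  define C where "C = 8 * D ^ k + 4 * b + 1"
  have D1: "1 \<le> D" unfolding D_def using assms by simp
  then have Dk: "0 < D ^ k" by simp
  have C: "1 \<le> C" "8 * D ^ k < C" "4 * b \<le> C" unfolding C_def using Dk assms by auto
  have main: "t \<in> dist_set F d k E"
    if F: "field F" "finite (carrier F)" "odd (order F)" and \<chi>: "nontrivial_additive_character F \<chi>"
      and V: "regular_variety F d \<chi> a b c V" and E: "E \<subseteq> V"
      and card: "C * real (order F) powr ((real d - 1) / 2 + 1 / (real k - 1)) \<le> real (card E)"
      and t: "t \<in> carrier F" "t \<noteq> \<zero>\<^bsub>F\<^esub> \<or> odd d"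
    for F :: "'a ring" and \<chi> V E t
  proof (rule ccontr)
    assume missing: "t \<notin> dist_set F d k E"
    interpret F: vector_character F \<chi> d
      using F \<chi> by (intro vector_character.intro odd_field_character.intro odd_finite_field.intro
        odd_finite_field_axioms.intro field_character.intro field_character_axioms.intro
        finite_field.intro finite_field_axioms.intro)
    define q where "q = real (order F)"
    define P where "P = sqrt q ^ (d - 1)"
    define N where "N = real (card E)"
    define \<rho> where "\<rho> = q powr (1 / (real k - 1))"
    have q: "1 \<le> q" unfolding q_def using F.order_pos by simp
    have P0: "0 < P" unfolding P_def using q by simp
    have P_powr: "P = q powr ((real d - 1) / 2)"
    proof -
      have "P = (q powr (1 / 2)) powr real (d - 1)" unfolding P_def using q by (simp add: powr_half_sqrt powr_realpow)
      then show ?thesis using assms(1) by (simp add: powr_powr of_nat_diff)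
    qed
    have P2: "P\<^sup>2 = q ^ (d - 1)" unfolding P_def using q by (simp flip: power_mult_distrib add: power2_eq_square)
    have \<rho>1: "1 \<le> \<rho>" unfolding \<rho>_def using q assms(2) by (intro ge_one_powr_ge_zero) auto
    have \<rho>k: "\<rho> ^ (k - 1) = q"
    proof -
      have "\<rho> ^ (k - 1) = \<rho> powr real (k - 1)" using \<rho>1 by (simp add: powr_realpow)
      also have "\<dots> = q" unfolding \<rho>_def using assms(2) q by (simp add: powr_powr of_nat_diff)
      finally show ?thesis .
    qed
    have N: "C * \<rho> * P \<le> N"
      using card unfolding N_def P_powr \<rho>_def q_def powr_add by (simp add: mult_ac)
    have "0 < C * \<rho> * P" using C \<rho>1 P0 by simp
    then have N0: "0 < N" using N by simp
    have VV: "V \<subseteq> vec_space F d" using V unfolding regular_variety_def is_variety_def by auto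
    have EV: "E \<subseteq> vec_space F d" using E VV by auto
    have finV: "finite V" using VV F.finite_V finite_subset by blast
    have cV: "real (card V) \<le> b * P\<^sup>2" using V unfolding regular_variety_def P2 q_def by auto
    \<comment> \<open>Undoing the normalisation by q^d turns the decay c q^(-(d+1)/2) into c
      P.\<close>
    have \<kappa>: "cmod (F.ehat V w) \<le> c * P" if w: "w \<in> vec_space F d - {zero_vec F d}" for w
    proof -
      have "cmod (fourier F d \<chi> (indicator V) w) \<le> c * q powr (- (real d + 1) / 2)"
        using V w unfolding regular_variety_def q_def by blast
      moreover have "cmod (fourier F d \<chi> (indicator V) w) = cmod (F.ehat V w) / q ^ d"
        using w by (subst F.fourier_indicator[OF VV]) (auto simp: norm_mult norm_divide norm_power q_def)
      ultimately have "cmod (F.ehat V w) \<le> c * (q powr (- (real d + 1) / 2) * q ^ d)"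
        using q by (simp add: divide_le_eq mult.assoc)
      also have "q powr (- (real d + 1) / 2) * q ^ d = q powr (- (real d + 1) / 2 + real d)"
        using q by (simp add: powr_add powr_realpow)
      also have "- (real d + 1) / 2 + real d = (real d - 1) / 2" by (simp add: field_simps)
      finally show ?thesis unfolding P_powr .
    qed
    have B2: "F.energy E 2 \<le> q * P\<^sup>2 * N"
    proof -
      have "q ^ d = q * P\<^sup>2" unfolding P2 using assms(1) by (cases d) auto
      then show ?thesis using F.energy_two[OF EV] by (simp add: q_def N_def)
    qed
    have rec: "F.energy E (2 * j + 2) \<le> 2 * (b * P\<^sup>2) * N ^ (2 * j + 1) + (c * P)\<^sup>2 * F.energy E (2 * j)" for j
    proof -
      have "F.energy E (2 * j + 2) \<le> 2 * real (card V) * N ^ (2 * j + 1) + (c * P)\<^sup>2 * F.energy E (2 * j)"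
        unfolding N_def using assms P0 by (intro F.energy_recursion[OF E VV \<kappa>]) auto
      also have "2 * real (card V) * N ^ (2 * j + 1) \<le> 2 * (b * P\<^sup>2) * N ^ (2 * j + 1)"
        using cV N0 by (intro mult_right_mono mult_left_mono) auto
      finally show ?thesis by simp
    qed
    have "C * \<rho> \<le> N / P" using N P0 by (simp add: le_divide_eq)
    then have small: "4 * F.energy E k < P * N ^ k"
      by (intro energy_threshold[OF assms(4) P0 N0 q D_def C(1,2) assms(2) refl \<rho>1 \<rho>k _ B2 rec F.energy_odd])
    \<comment> \<open>A large subset needs a large variety: 4 b P <= N <= |V| <= b P^2. Consequently
      P^2 - 2 P >= P^2 / 2.\<close>
    have P4: "4 \<le> P"
    proof -
      have "4 * b * P \<le> C * \<rho> * P"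
      proof (rule mult_right_mono)
        have "4 * b * 1 \<le> C * \<rho>" using C \<rho>1 assms(4) by (intro mult_mono) auto
        then show "4 * b \<le> C * \<rho>" by simp
      qed (use P0 in simp)
      also have "\<dots> \<le> N" by (rule N)
      also have "N \<le> real (card V)" unfolding N_def using card_mono[OF finV E] by simp
      also have "\<dots> \<le> b * P\<^sup>2" by (rule cV)
      finally show ?thesis using P0 assms(4) by (simp add: power2_eq_square)
    qed
    obtain l where l: "k = Suc l" using assms(2) by (cases k) auto
    have "P\<^sup>2 / 2 * N ^ k \<le> (P\<^sup>2 - 2 * P) * N ^ k"
      using P4 N0 by (intro mult_right_mono) (auto simp: power2_eq_square)
    also have "\<dots> \<le> 2 * P * F.energy E k"
      using F.missing_distance[OF EV t, of l P] missing assms(1) unfolding N_def l P_def q_def by simp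
    finally have "P * (P * N ^ k) \<le> P * (4 * F.energy E k)" by (simp add: power2_eq_square)
    then show False using P0 small by simp
  qed
  show ?thesis
  proof (intro exI[of _ C] conjI allI impI)
    show "0 < C" using C by simp
  next
    fix F :: "'a ring" and \<chi> V E
    assume h: "field F" "finite (carrier F)" "odd (order F)" "nontrivial_additive_character F \<chi>"
      "regular_variety F d \<chi> a b c V" "E \<subseteq> V"
      "C * real (order F) powr ((real d - 1) / 2 + 1 / (real k - 1)) \<le> real (card E)"
    then show "carrier F - {\<zero>\<^bsub>F\<^esub>} \<subseteq> dist_set F d k E" using main by blast
    assume "odd d"
    then have "carrier F \<subseteq> dist_set F d k E" using main h by blast
    moreover have "dist_set F d k E \<subseteq> carrier F"
    proof -
      interpret field F by (rule h)
      have "E \<subseteq> vec_space F d" using h(5,6) unfolding regular_variety_def is_variety_def by auto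
      then show ?thesis
        unfolding dist_set_def sq_norm_def vec_space_def using assms(2)
        by (auto intro!: finsum_closed minus_closed simp: PiE_iff subset_iff)
    qed
    ultimately show "dist_set F d k E = carrier F" by blast
  qed
qed

end
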